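(* Let $p\in(0,1)$ and let $h_1,h_2$ be non-negative integers with $\mathbf h=(h_1,h_2)\ne(0,0)$. For every $a,b>0$ there exists a constant $g^{\mathbf h}(a,b)$ such that $$\lim_{n\to+\infty}\frac1n\mathcal{L}^{\mathbf h}_{(\lfloor an\rfloor,\lfloor bn\rfloor)}=g^{\mathbf h}(a,b)\quad\text{almost surely and in }L^1.$$ Moreover, with $g(u,v)=\dfrac{\sqrt p\,\big(2\sqrt{uv}+(u+v)\sqrt p\big)}{1-p}$ for $u,v>0$ and the convention that $\frac{h_1-1+1/p}{h_2}=+\infty$ if $h_2=0$: - if $\frac{h_1}{(h_2-1)+1/p}<\frac ab<\frac{h_1-1+1/p}{h_2}$, then $\lambda=g^{\mathbf h}(a,b)$ is the unique solution (among $\lambda$ with $a-h_1\lambda>0$ and $b-h_2\lambda>0$) of the equation $\lambda=g(a-h_1\lambda,\,b-h_2\lambda)$; - if $\frac ab\le\frac{h_1}{(h_2-1)+1/p}$, then $g^{\mathbf h}(a,b)=\frac a{h_1}$; - if $\frac ab\ge\frac{h_1-1+1/p}{h_2}$, then $g^{\mathbf h}(a,b)=\frac b{h_2}$.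
   Context: Let $\Xi=(\Xi_{i,j})_{i,j\ge 1}$ be i.i.d. Bernoulli random variables with mean $p$, identified with the random set of $(i,j)\in(\mathbb{Z}_{>0})^2$ such that $\Xi_{i,j}=1$. For a pair of non-negative integers $\mathbf h=(h_1,h_2)\neq(0,0)$, write $(i,j)\stackrel{\mathbf h}{\prec}(i',j')$ if $i+h_1\le i'$ and $j+h_2\le j'$. $\mathcal{L}^{\mathbf h}_{(m,n)}$ is the maximal integer $L\ge 0$ such that there are points $(i_1,j_1),\dots,(i_L,j_L)\in\Xi$ with $1\le i_1\le\dots\le i_L\le m$, $1\le j_1\le\dots\le j_L\le n$ and $(i_1,j_1)\stackrel{\mathbf h}{\prec}(i_2,j_2)\stackrel{\mathbf h}{\prec}\dots\stackrel{\mathbf h}{\prec}(i_L,j_L)$. *)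

theory Defs
  imports "HOL-Probability.Probability"
begin

definition gap_prec :: "nat \<times> nat \<Rightarrow> nat \<times> nat \<Rightarrow> nat \<times> nat \<Rightarrow> bool" where
  "gap_prec h x y \<longleftrightarrow> fst x + fst h \<le> fst y \<and> snd x + snd h \<le> snd y"

text \<open>
  A chain is the list \<open>[(i\<^sub>1, j\<^sub>1), \<dots>, (i\<^sub>L, j\<^sub>L)]\<close>; for \<open>h \<noteq> (0, 0)\<close> its entries are distinct.
\<close>

definition gap_chain :: "nat \<times> nat \<Rightarrow> (nat \<times> nat) set \<Rightarrow> nat \<Rightarrow> nat \<Rightarrow> (nat \<times> nat) list \<Rightarrow> bool" where
  "gap_chain h S m n xs \<longleftrightarrow>
     set xs \<subseteq> S \<inter> ({1..m} \<times> {1..n}) \<and>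
     sorted (map fst xs) \<and> sorted (map snd xs) \<and>
     successively (gap_prec h) xs"

text \<open>
  For \<open>h = (0, 0)\<close> points could be repeated and the maximum would be meaningless;
  for \<open>h \<noteq> (0, 0)\<close> the set of lengths is finite, and it contains \<open>0\<close> (empty chain).
\<close>

definition longest_chain :: "nat \<times> nat \<Rightarrow> (nat \<times> nat) set \<Rightarrow> nat \<Rightarrow> nat \<Rightarrow> nat" where
  "longest_chain h S m n = Max {length xs |xs. gap_chain h S m n xs}"

lemma finite_chain_lengths:
  assumes "h \<noteq> (0, 0)"
  shows "finite {length xs |xs. gap_chain h S m n xs}"
proof -
  have distinct: "distinct xs" if "gap_chain h S m n xs" for xs
  proof -
    have "successively (\<lambda>x y. fst x + snd x < fst y + snd y) xs"
    proof (rule successively_mono)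
      show "successively (gap_prec h) xs"
        using that by (simp add: gap_chain_def)
    next
      fix x y assume "gap_prec h x y"
      moreover have "fst h + snd h > 0"
        using assms by (cases h) auto
      ultimately show "fst x + snd x < fst y + snd y"
        unfolding gap_prec_def by linarith
    qed
    hence "sorted_wrt (\<lambda>x y. fst x + snd x < fst y + snd y) xs"
      by (subst (asm) successively_conv_sorted_wrt) (auto simp: transp_def)
    thus ?thesis
      by (induction xs) auto
  qed
  have "{length xs |xs. gap_chain h S m n xs} \<subseteq> {..card ({1..m} \<times> {1..n})}"
  proof clarify
    fix xs assume "gap_chain h S m n xs"
    hence "length xs = card (set xs)" and "set xs \<subseteq> {1..m} \<times> {1..n}"
      using distinct by (simp_all add: distinct_card gap_chain_def)
    thus "length xs \<le> card ({1..m} \<times> {1..n})"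
      by (metis card_mono finite_SigmaI finite_atLeastAtMost)
  qed
  thus ?thesis
    using finite_subset by blast
qed

lemma chain_lengths_nonempty: "0 \<in> {length xs |xs. gap_chain h S m n xs}"
  by (auto simp: gap_chain_def)

definition bernoulli_points :: "(nat \<times> nat \<Rightarrow> 'w \<Rightarrow> bool) \<Rightarrow> 'w \<Rightarrow> (nat \<times> nat) set" where
  "bernoulli_points \<Xi> \<omega> = {x. fst x \<ge> 1 \<and> snd x \<ge> 1 \<and> \<Xi> x \<omega>}"

definition iid_bernoulli :: "'w measure \<Rightarrow> (nat \<times> nat \<Rightarrow> 'w \<Rightarrow> bool) \<Rightarrow> real \<Rightarrow> bool" where
  "iid_bernoulli M \<Xi> p \<longleftrightarrow>
     prob_space.indep_vars M (\<lambda>_. count_space UNIV) \<Xi> ({1..} \<times> {1..}) \<and>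
     (\<forall>x \<in> {1..} \<times> {1..}. distr M (count_space UNIV) (\<Xi> x) = measure_pmf (bernoulli_pmf p))"

text \<open>
  Integrability is demanded explicitly, as the integral of a non-integrable function is \<open>0\<close>.
\<close>

definition tendsto_L1 :: "'w measure \<Rightarrow> (nat \<Rightarrow> 'w \<Rightarrow> real) \<Rightarrow> ('w \<Rightarrow> real) \<Rightarrow> bool" where
  "tendsto_L1 M X Y \<longleftrightarrow>
     (\<forall>n. integrable M (X n)) \<and> integrable M Y \<and>
     (\<lambda>n. \<integral>\<omega>. \<bar>X n \<omega> - Y \<omega>\<bar> \<partial>M) \<longlonglongrightarrow> 0"

definition g_fun :: "real \<Rightarrow> real \<Rightarrow> real \<Rightarrow> real" where
  "g_fun p u v = sqrt p * (2 * sqrt (u * v) + (u + v) * sqrt p) / (1 - p)"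

definition lower_slope :: "real \<Rightarrow> nat \<times> nat \<Rightarrow> real" where
  "lower_slope p h = real (fst h) / ((real (snd h) - 1) + 1 / p)"

text \<open>
  Extended-real valued because of the convention that the quotient is \<open>+\<infinity>\<close> for \<open>h\<^sub>2 = 0\<close>.
\<close>

definition upper_slope :: "real \<Rightarrow> nat \<times> nat \<Rightarrow> ereal" where
  "upper_slope p h =
     (if snd h = 0 then \<infinity> else ereal ((real (fst h) - 1 + 1 / p) / real (snd h)))"

end

theory Submission
  imports Defs
begin

text \<open>
The proof reduces every gap \<open>h\<close> to the single gap \<open>(0, 1)\<close>, solves that model by comparison with an
explicit stationary version, and finds the limit by optimizing over the parameter of that version.

\<^emph>\<open>All gaps are equivalent.\<close> Let \<open>A\<^sub>k\<close> be the set of sites \<open>z\<close> such that some chain of length \<open>k\<close> ends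
weakly below \<open>z\<close>. A chain of length \<open>k + 1\<close> ends at a point of \<open>\<Xi>\<close> in \<open>A\<^sub>k + h\<close>. The event
\<open>A\<^sub>k = A\<close> is decided by the points of \<open>\<Xi>\<close> outside \<open>A + h\<close>, because the minimal sites of \<open>A\<close> carry the
ends of the chains and, as \<open>h \<noteq> (0, 0)\<close>, do not lie in \<open>A + h\<close>. Hence, given \<open>A\<^sub>k\<close>, the
points in \<open>A\<^sub>k + h\<close> are fresh coin tosses, and \<open>B\<^sub>k = A\<^sub>k - (k - 1) h\<close> is a Markov chain whose
transitions do not depend on \<open>h\<close>. Since a chain of length \<open>k\<close> fits below \<open>(m, n)\<close> iff
\<open>(m, n) - (k - 1) h \<in> B\<^sub>k\<close>, the probability of this event is the same as for the gap \<open>(0, 1)\<close> in a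
box of suitably changed size (\<open>prob_level\<close>, \<open>prob_reach_gap_change\<close>).

\<^emph>\<open>The gap \<open>(0, 1)\<close> is solvable.\<close> Here the longest chain satisfies the local recursion
\<open>L(i, j) = max (L(i - 1, j)) (L(i, j - 1) + \<xi>(i, j))\<close>. Put i.i.d. geometric increments of mean \<open>r\<close> on the
bottom side and i.i.d. Bernoulli increments of a matching density \<open>q\<close> on the left side. One step of the
recursion maps (geometric, Bernoulli) to (geometric, Bernoulli) with the same product law (Burke's
property, \<open>burke_cell\<close>), so the increments on the right side of the box are again i.i.d.
Bernoulli. The value \<open>G\<close> of the stationary recursion at \<open>(m, n)\<close> is therefore a geometric sum plus a Bernoulli sum, of
mean \<open>m r + n q\<close>, with exponential concentration. As \<open>L \<le> G\<close>, this bounds \<open>L\<close> from above for every \<open>r\<close>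
(\<open>chain01_upper_tail\<close>). Conversely, an optimal path of \<open>G\<close> leaves the boundary
somewhere. If \<open>r\<close> is optimal for the direction of \<open>(m, n)\<close>, then leaving at distance \<open>\<delta> n\<close> costs a
positive multiple of \<open>n\<close>: apply the upper bound with a slightly different \<open>r\<close> to the rest of the path
(\<open>late_exit_loses\<close>). So the path leaves early and \<open>L\<close> is almost as large as \<open>G\<close>
(\<open>chain01_lower_tail\<close>).

\<^emph>\<open>The constant.\<close> With \<open>u = a - h\<^sub>1 \<theta>\<close> and \<open>v = b - h\<^sub>2 \<theta>\<close>, the first step turns \<open>L\<^sup>h \<ge> \<theta> n\<close> into the event that
the chain for the gap \<open>(0, 1)\<close> in a box of size \<open>(u n, (v + \<theta>) n)\<close> has length at least \<open>\<theta> n\<close>. The optimal \<open>r\<close> is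
\<open>sqrt (v p / u)\<close>, and the comparison becomes \<open>\<theta> > g(u, v)\<close> or \<open>\<theta> < g(u, v)\<close>
(\<open>optimal_density\<close>). All error probabilities are summable, so Borel--Cantelli gives almost sure
convergence, and the bound \<open>L \<le> (a + b) n\<close> gives convergence in mean. Finally \<open>\<theta> - g(u, v)\<close> increases in \<open>\<theta>\<close> until \<open>u\<close> or \<open>v\<close> vanishes;
its sign there, and which of the two vanishes, distinguish the three cases of the theorem.
\<close>

section \<open>Chains and their level sets\<close>

text \<open>
The recursion removes the last point \<open>(x, y)\<close> of a chain. Subtraction on \<open>nat\<close> truncates, but this is
harmless: for \<open>k > 0\<close> a truncated coordinate is \<open>0\<close>, and no chain of positive length ends there.
\<close>

primrec reach :: "nat \<times> nat \<Rightarrow> (nat \<times> nat) set \<Rightarrow> nat \<Rightarrow> nat \<Rightarrow> nat \<Rightarrow> bool" where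
  "reach h S 0 i j \<longleftrightarrow> True"
| "reach h S (Suc k) i j \<longleftrightarrow>
     (\<exists>x y. (x, y) \<in> S \<and> 1 \<le> x \<and> x \<le> i \<and> 1 \<le> y \<and> y \<le> j \<and> reach h S k (x - fst h) (y - snd h))"

text \<open>
The two monotonicity conditions follow from the gap condition because the gaps are non-negative.
\<close>

lemma gap_chain_iff:
  "gap_chain h S m n xs \<longleftrightarrow> set xs \<subseteq> S \<inter> ({1..m} \<times> {1..n}) \<and> successively (gap_prec h) xs"
proof -
  have "sorted (map fst xs) \<and> sorted (map snd xs)" if "successively (gap_prec h) xs"
  proof -
    have *: "successively (\<lambda>x y. fst x \<le> fst y \<and> snd x \<le> snd y) xs"
      by (rule successively_mono[OF that]) (auto simp: gap_prec_def)
    have "sorted_wrt (\<lambda>x y. fst x \<le> fst y \<and> snd x \<le> snd y) xs"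
      using * by (subst (asm) successively_conv_sorted_wrt) (auto simp: transp_def)
    thus ?thesis
      by (auto simp: sorted_map intro: sorted_wrt_mono_rel[rotated])
  qed
  thus ?thesis by (auto simp: gap_chain_def)
qed

lemma gap_chain_Nil [simp]: "gap_chain h S m n []"
  by (simp add: gap_chain_iff)

lemma gap_chain_snoc_iff:
  "gap_chain h S m n (xs @ [(x, y)]) \<longleftrightarrow>
     (x, y) \<in> S \<and> 1 \<le> x \<and> x \<le> m \<and> 1 \<le> y \<and> y \<le> n \<and> gap_chain h S (x - fst h) (y - snd h) xs"
proof (cases "xs = []")
  case True
  thus ?thesis by (auto simp: gap_chain_iff)
next
  case ne: False
  show ?thesis
  proof
    assume L: "gap_chain h S m n (xs @ [(x, y)])"
    hence ch: "successively (gap_prec h) xs" and last: "gap_prec h (last xs) (x, y)"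
      and sub: "set xs \<subseteq> S \<inter> ({1..m} \<times> {1..n})"
      using ne by (auto simp: gap_chain_iff successively_append_iff)
    have "transp (gap_prec h)" by (auto simp: transp_def gap_prec_def)
    have "successively (gap_prec h) (xs @ [(x, y)])"
      using L by (simp add: gap_chain_iff)
    hence "sorted_wrt (gap_prec h) (xs @ [(x, y)])"
      using \<open>transp (gap_prec h)\<close> by (simp add: successively_conv_sorted_wrt)
    hence "\<forall>z\<in>set xs. gap_prec h z (x, y)"
      by (simp add: sorted_wrt_append)
    hence "set xs \<subseteq> {1..x - fst h} \<times> {1..y - snd h}"
      using sub by (force simp: gap_prec_def)
    thus "(x, y) \<in> S \<and> 1 \<le> x \<and> x \<le> m \<and> 1 \<le> y \<and> y \<le> n \<and> gap_chain h S (x - fst h) (y - snd h) xs"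
      using L ch sub by (auto simp: gap_chain_iff)
  next
    assume R: "(x, y) \<in> S \<and> 1 \<le> x \<and> x \<le> m \<and> 1 \<le> y \<and> y \<le> n \<and> gap_chain h S (x - fst h) (y - snd h) xs"
    hence sub: "set xs \<subseteq> {1..x - fst h} \<times> {1..y - snd h}" by (auto simp: gap_chain_iff)
    have "last xs \<in> {1..x - fst h} \<times> {1..y - snd h}"
      using sub ne last_in_set by blast
    hence "gap_prec h (last xs) (x, y)"
      by (auto simp: gap_prec_def)
    moreover have "set xs \<subseteq> {1..m} \<times> {1..n}"
      using sub R by fastforce
    ultimately show "gap_chain h S m n (xs @ [(x, y)])"
      using R ne by (auto simp: gap_chain_iff successively_append_iff)
  qed
qed

lemma reach_iff_chain: "reach h S k m n \<longleftrightarrow> (\<exists>xs. gap_chain h S m n xs \<and> length xs = k)"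
proof (induction k arbitrary: m n)
  case (Suc k)
  have "(\<exists>xs. gap_chain h S m n xs \<and> length xs = Suc k) \<longleftrightarrow>
        (\<exists>xs x y. gap_chain h S m n (xs @ [(x, y)]) \<and> length xs = k)"
    by (metis length_Suc_conv_rev length_append_singleton surj_pair)
  thus ?case by (auto simp: gap_chain_snoc_iff Suc.IH)
qed simp

lemma le_longest_chain_iff_reach:
  assumes "h \<noteq> (0, 0)"
  shows "k \<le> longest_chain h S m n \<longleftrightarrow> reach h S k m n"
proof -
  let ?X = "{length xs |xs. gap_chain h S m n xs}"
  have fin: "finite ?X" by (rule finite_chain_lengths[OF assms])
  have ne: "?X \<noteq> {}" using chain_lengths_nonempty by blast
  have "k \<le> longest_chain h S m n \<longleftrightarrow> (\<exists>xs. gap_chain h S m n xs \<and> k \<le> length xs)"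
    unfolding longest_chain_def using Max_ge_iff[OF fin ne, of k] by auto
  also have "\<dots> \<longleftrightarrow> (\<exists>xs. gap_chain h S m n xs \<and> length xs = k)"
  proof
    assume "\<exists>xs. gap_chain h S m n xs \<and> k \<le> length xs"
    then obtain xs where xs: "gap_chain h S m n xs" "k \<le> length xs" by blast
    have "successively (gap_prec h) (take k xs)"
      using xs(1) by (metis append_take_drop_id gap_chain_iff successively_append_iff)
    hence "gap_chain h S m n (take k xs)"
      using xs(1) set_take_subset[of k xs] by (auto simp: gap_chain_iff)
    thus "\<exists>xs. gap_chain h S m n xs \<and> length xs = k"
      using xs(2) by (intro exI[of _ "take k xs"]) auto
  qed auto
  finally show ?thesis by (simp add: reach_iff_chain)
qed

lemma reach_cong_box:
  assumes "S \<inter> ({1..i} \<times> {1..j}) = T \<inter> ({1..i} \<times> {1..j})"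
  shows "reach h S k i j \<longleftrightarrow> reach h T k i j"
  using assms
proof (induction k arbitrary: i j)
  case (Suc k)
  have *: "reach h S k (x - fst h) (y - snd h) = reach h T k (x - fst h) (y - snd h)"
    if "x \<le> i" "y \<le> j" for x y
  proof (rule Suc.IH)
    have "{1..x - fst h} \<times> {1..y - snd h} \<subseteq> {1..i} \<times> {1..j}"
      using that by auto
    thus "S \<inter> ({1..x - fst h} \<times> {1..y - snd h}) = T \<inter> ({1..x - fst h} \<times> {1..y - snd h})"
      using Suc.prems by blast
  qed
  have **: "(x, y) \<in> S \<and> 1 \<le> x \<and> x \<le> i \<and> 1 \<le> y \<and> y \<le> j \<longleftrightarrow>
      (x, y) \<in> T \<and> 1 \<le> x \<and> x \<le> i \<and> 1 \<le> y \<and> y \<le> j" for x y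
    using Suc.prems by (auto simp: set_eq_iff)
  show ?case unfolding reach.simps using * ** by meson
qed simp

lemma reach_mono:
  assumes "reach h S k i j" "i \<le> i'" "j \<le> j'"
  shows "reach h S k i' j'"
proof (cases k)
  case (Suc k')
  thus ?thesis using assms unfolding Suc reach.simps by (meson le_trans)
qed simp

lemma longest_chain_mono:
  assumes "h \<noteq> (0, 0)" "i \<le> i'" "j \<le> j'"
  shows "longest_chain h S i j \<le> longest_chain h S i' j'"
proof -
  have "reach h S (longest_chain h S i j) i j"
    by (simp flip: le_longest_chain_iff_reach[OF assms(1)])
  thus ?thesis
    using reach_mono[OF _ assms(2,3)] by (simp add: le_longest_chain_iff_reach[OF assms(1)])
qed

lemma longest_chain_cong_box:
  assumes "h \<noteq> (0, 0)" "S \<inter> ({1..i} \<times> {1..j}) = T \<inter> ({1..i} \<times> {1..j})"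
  shows "longest_chain h S i j = longest_chain h T i j"
proof (rule antisym)
  show "longest_chain h S i j \<le> longest_chain h T i j"
    using reach_cong_box[OF assms(2)] order_refl le_longest_chain_iff_reach[OF assms(1)] by metis
  show "longest_chain h T i j \<le> longest_chain h S i j"
    using reach_cong_box[OF assms(2)] order_refl le_longest_chain_iff_reach[OF assms(1)] by metis
qed

definition recenter :: "nat \<times> nat \<Rightarrow> (nat \<times> nat) set \<Rightarrow> (nat \<times> nat) set" where
  "recenter s S = {z. (fst z + fst s, snd z + snd s) \<in> S}"

text \<open>
This is the set \<open>B\<^sub>k\<close> of the introduction, cut off to \<open>D\<close>. With truncated \<open>k - 1\<close>, the level \<open>k = 0\<close> is all of \<open>D\<close>, which makes the
recursion below start at \<open>0\<close>.
\<close>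

definition level :: "nat \<times> nat \<Rightarrow> (nat \<times> nat) set \<Rightarrow> (nat \<times> nat) set \<Rightarrow> nat \<Rightarrow> (nat \<times> nat) set" where
  "level h D S k = {z \<in> D. reach h S k (fst z + (k - 1) * fst h) (snd z + (k - 1) * snd h)}"

definition upper_part :: "(nat \<times> nat) set \<Rightarrow> (nat \<times> nat) set \<Rightarrow> (nat \<times> nat) set" where
  "upper_part D C = {z \<in> D. \<exists>w \<in> C. fst w \<le> fst z \<and> snd w \<le> snd z}"

lemma level_0 [simp]: "level h D S 0 = D"
  by (simp add: level_def)

lemma reach_lower_bound:
  assumes "reach h S (Suc k) i j"
  shows "Suc (k * fst h) \<le> i \<and> Suc (k * snd h) \<le> j"
  using assms
proof (induction k arbitrary: i j)
  case (Suc k)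
  from Suc.prems obtain x y where xy: "x \<le> i" "y \<le> j" "reach h S (Suc k) (x - fst h) (y - snd h)"
    unfolding reach.simps(2)[of h S "Suc k"] by blast
  from Suc.IH[OF xy(3)] xy(1,2) show ?case by (simp del: reach.simps) linarith
next
  case 0
  thus ?case by auto
qed

text \<open>
A chain of length \<open>k + 1\<close> ends at a point \<open>w + k h\<close> with \<open>w \<in> B\<^sub>k\<close>, and in the moving frame \<open>w\<close> stays
in the same box: this is why the evolution of \<open>B\<^sub>k\<close> can be followed inside one fixed \<open>D\<close>.
\<close>

lemma level_Suc:
  assumes D: "D = {1..u} \<times> {1..v}"
  shows "level h D S (Suc k) = upper_part D (level h D S k \<inter> recenter (k * fst h, k * snd h) S)"
    (is "?L = upper_part D (?B \<inter> ?T)")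
proof (intro equalityI subsetI)
  fix z assume z: "z \<in> ?L"
  then obtain x y where xy: "(x, y) \<in> S" "x \<le> fst z + k * fst h" "y \<le> snd z + k * snd h"
      "1 \<le> x" "1 \<le> y" "reach h S k (x - fst h) (y - snd h)"
    by (auto simp: level_def)
  have "Suc (k * fst h) \<le> x \<and> Suc (k * snd h) \<le> y"
    using reach_lower_bound[of h S k x y] xy by auto
  then obtain a b where ab: "x = a + k * fst h" "y = b + k * snd h" "1 \<le> a" "1 \<le> b"
    by (intro that[of "x - k * fst h" "y - k * snd h"]) linarith+
  have le: "a \<le> fst z" "b \<le> snd z" using xy ab by auto
  have zD: "z \<in> D" using z by (simp add: level_def)
  have "(a, b) \<in> D" using le ab zD unfolding D by auto
  moreover have "reach h S k (a + (k - 1) * fst h) (b + (k - 1) * snd h)"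
  proof (cases k)
    case (Suc k')
    thus ?thesis using xy(6) by (simp add: ab)
  qed simp
  ultimately have "(a, b) \<in> ?B \<inter> ?T"
    using xy(1) by (auto simp: level_def recenter_def ab)
  thus "z \<in> upper_part D (?B \<inter> ?T)"
    using le zD by (auto simp: upper_part_def intro!: bexI[of _ "(a, b)"])
next
  fix z assume "z \<in> upper_part D (?B \<inter> ?T)"
  then obtain a b where zD: "z \<in> D" and ab: "(a, b) \<in> ?B" "(a, b) \<in> ?T" "a \<le> fst z" "b \<le> snd z"
    unfolding upper_part_def by force
  have r: "reach h S k (a + (k - 1) * fst h) (b + (k - 1) * snd h)"
    and pos: "1 \<le> a" "1 \<le> b"
    using ab(1) unfolding level_def D by auto
  have "reach h S k (a + k * fst h - fst h) (b + k * snd h - snd h)"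
    using r by (cases k) auto
  moreover have "(a + k * fst h, b + k * snd h) \<in> S"
    using ab(2) by (simp add: recenter_def)
  ultimately have "reach h S (Suc k) (fst z + k * fst h) (snd z + k * snd h)"
    unfolding reach.simps
    by (intro exI[of _ "a + k * fst h"] exI[of _ "b + k * snd h"]) (use ab pos in auto)
  thus "z \<in> ?L" using zD by (simp add: level_def)
qed

lemma level_upward_closed:
  assumes "w \<in> level h D S k" "z \<in> D" "fst w \<le> fst z" "snd w \<le> snd z"
  shows "z \<in> level h D S k"
proof -
  have "reach h S k (fst w + (k - 1) * fst h) (snd w + (k - 1) * snd h)"
    using assms(1) by (simp add: level_def)
  hence "reach h S k (fst z + (k - 1) * fst h) (snd z + (k - 1) * snd h)"
    by (rule reach_mono) (use assms(3,4) in simp_all)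
  thus ?thesis using assms(2) by (simp add: level_def)
qed

section \<open>The law of the level sets does not depend on the gap\<close>

text \<open>
Finite windows of the Bernoulli field are handled as discrete laws on sets; the link to the given
probability space is made only at the end.
\<close>

definition bern_set :: "real \<Rightarrow> 'a set \<Rightarrow> 'a set pmf" where
  "bern_set p E = map_pmf Collect (Pi_pmf E False (\<lambda>_. bernoulli_pmf p))"

lemma bern_set_empty [simp]: "bern_set p {} = return_pmf {}"
  by (simp add: bern_set_def)

lemma bern_set_insert:
  assumes "finite E" "x \<notin> E"
  shows "bern_set p (insert x E) =
           do {b \<leftarrow> bernoulli_pmf p; c \<leftarrow> bern_set p E; return_pmf (if b then insert x c else c)}"
proof -
  have *: "Collect (f(x := b)) = (if b then insert x (Collect f) else Collect f)"
    if "f \<in> set_pmf (Pi_pmf E False (\<lambda>_. bernoulli_pmf p))" for f b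
  proof -
    have "\<not> f x"
      using set_Pi_pmf_subset[OF assms(1), of False "\<lambda>_. bernoulli_pmf p"] that assms(2) by auto
    thus ?thesis by (auto split: if_splits)
  qed
  show ?thesis
    unfolding bern_set_def Pi_pmf_insert'[OF assms] map_bind_pmf bind_map_pmf map_return_pmf
    by (intro bind_pmf_cong refl) (simp add: *)
qed

lemma bern_set_union:
  assumes "finite A" "finite B" "A \<inter> B = {}"
  shows "bern_set p (A \<union> B) = do {a \<leftarrow> bern_set p A; b \<leftarrow> bern_set p B; return_pmf (a \<union> b)}"
  using assms(1,3)
proof (induction A rule: finite_induct)
  case (insert x A)
  have "x \<notin> A \<union> B" using insert by auto
  moreover have "finite (A \<union> B)" using insert assms by auto
  ultimately have "bern_set p (insert x A \<union> B) =
      do {t \<leftarrow> bernoulli_pmf p; c \<leftarrow> bern_set p (A \<union> B); return_pmf (if t then insert x c else c)}"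
    by (simp add: bern_set_insert)
  also have "\<dots> = do {a \<leftarrow> bern_set p (insert x A); b \<leftarrow> bern_set p B; return_pmf (a \<union> b)}"
    using insert
    by (auto simp: bern_set_insert bind_assoc_pmf bind_return_pmf if_distrib[of "\<lambda>c. c \<union> _"]
        intro!: bind_pmf_cong)
  finally show ?case .
qed (simp add: bind_return_pmf bind_return_pmf')

lemma bern_set_image:
  assumes "finite A" "inj_on f A"
  shows "bern_set p (f ` A) = map_pmf (image f) (bern_set p A)"
  using assms
proof (induction A rule: finite_induct)
  case (insert x A)
  hence "f x \<notin> f ` A" "inj_on f A" by auto
  thus ?case
    using insert
    by (auto simp: bern_set_insert map_bind_pmf bind_map_pmf intro!: bind_pmf_cong)
qed simp

lemma bern_set_subset:
  assumes "finite E" "c \<in> set_pmf (bern_set p E)"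
  shows "c \<subseteq> E"
  using set_Pi_pmf_subset[OF assms(1), of False "\<lambda>_. bernoulli_pmf p"] assms(2)
  by (auto simp: bern_set_def)

lemma pmf_bern_set:
  assumes "finite E" "c \<subseteq> E"
  shows "pmf (bern_set p E) c = (\<Prod>z\<in>E. pmf (bernoulli_pmf p) (z \<in> c))"
proof -
  have "pmf (bern_set p E) c = pmf (bern_set p E) (Collect (\<lambda>z. z \<in> c))" by simp
  also have "\<dots> = pmf (Pi_pmf E False (\<lambda>_. bernoulli_pmf p)) (\<lambda>z. z \<in> c)"
    unfolding bern_set_def by (rule pmf_map_inj') (auto simp: inj_on_def fun_eq_iff set_eq_iff)
  also have "\<dots> = (\<Prod>z\<in>E. pmf (bernoulli_pmf p) (z \<in> c))"
    by (rule pmf_Pi') (use assms in auto)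
  finally show ?thesis .
qed

lemma prob_bern_set_cong:
  assumes "finite E" "\<And>c. c \<subseteq> E \<Longrightarrow> P c \<longleftrightarrow> Q c"
  shows "measure_pmf.prob (bern_set p E) {c. P c} = measure_pmf.prob (bern_set p E) {c. Q c}"
  by (rule measure_pmf.finite_measure_eq_AE)
     (use assms(2) bern_set_subset[OF assms(1), of _ p] in \<open>auto simp: AE_measure_pmf_iff\<close>)

text \<open>
The form of independence used for level sets: \<open>P\<close> ignores the points in \<open>K\<close>, and \<open>Q\<close> sees only those.
\<close>

lemma prob_bern_set_indep:
  assumes E: "finite E" "K \<subseteq> E" and P: "\<And>c. c \<subseteq> E \<Longrightarrow> P c \<longleftrightarrow> P (c - K)"
  shows "measure_pmf.prob (bern_set p E) {c. P c \<and> Q (c \<inter> K)} =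
         measure_pmf.prob (bern_set p E) {c. P c} * measure_pmf.prob (bern_set p K) {c. Q c}"
proof -
  let ?pr = "pair_pmf (bern_set p K) (bern_set p (E - K))"
  have fin: "finite K" "finite (E - K)" using E finite_subset by auto
  have "bern_set p (K \<union> (E - K)) = map_pmf (\<lambda>(a, b). a \<union> b) ?pr"
    by (subst bern_set_union) (use fin in \<open>auto simp: pair_pmf_def map_bind_pmf map_pmf_def bind_assoc_pmf bind_return_pmf\<close>)
  hence *: "bern_set p E = map_pmf (\<lambda>(a, b). a \<union> b) ?pr"
    using E by (simp add: Un_absorb1)
  have key: "measure_pmf.prob (bern_set p E) {c. P c \<and> R (c \<inter> K)} =
      measure_pmf.prob (bern_set p K) {c. R c} * measure_pmf.prob (bern_set p (E - K)) {c. P c}" for R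
  proof -
    have "measure_pmf.prob (bern_set p E) {c. P c \<and> R (c \<inter> K)} =
        measure_pmf.prob ?pr {(a, b). P (a \<union> b) \<and> R ((a \<union> b) \<inter> K)}"
      by (simp add: * vimage_def case_prod_unfold)
    also have "\<dots> = measure_pmf.prob ?pr (({a. R a} \<inter> Pow K) \<times> ({b. P b} \<inter> Pow (E - K)))"
    proof (rule measure_pmf.finite_measure_eq_AE)
      have f1: "P (a \<union> b) \<and> R ((a \<union> b) \<inter> K) \<longleftrightarrow> R a \<and> P b" if "a \<subseteq> K" "b \<subseteq> E - K" for a b
      proof -
        have "(a \<union> b) \<inter> K = a" "a \<union> b - K = b" "a \<union> b \<subseteq> E" "b \<subseteq> E" "b - K = b" using that E by auto
        thus ?thesis using P by metis
      qed
      have f2: "a \<subseteq> K \<and> b \<subseteq> E - K" if "(a, b) \<in> set_pmf ?pr" for a b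
        using that bern_set_subset[OF fin(1), of a p] bern_set_subset[OF fin(2), of b p] by auto
      have "(x \<in> {(a, b). P (a \<union> b) \<and> R ((a \<union> b) \<inter> K)}) =
          (x \<in> ({a. R a} \<inter> Pow K) \<times> ({b. P b} \<inter> Pow (E - K)))" if "x \<in> set_pmf ?pr" for x
      proof -
        obtain a b where x: "x = (a, b)" by (cases x)
        have "a \<subseteq> K" "b \<subseteq> E - K" using f2[of a b] that x by auto
        thus ?thesis using f1[of a b] unfolding x by blast
      qed
      thus "AE x in measure_pmf ?pr. (x \<in> {(a, b). P (a \<union> b) \<and> R ((a \<union> b) \<inter> K)}) =
          (x \<in> ({a. R a} \<inter> Pow K) \<times> ({b. P b} \<inter> Pow (E - K)))"
        by (rule AE_pmfI)
    qed auto
    also have "\<dots> = measure_pmf.prob (bern_set p K) ({a. R a} \<inter> Pow K) *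
        measure_pmf.prob (bern_set p (E - K)) ({b. P b} \<inter> Pow (E - K))"
      by (rule measure_pmf_prob_product) (use fin in \<open>auto intro!: countable_finite\<close>)
    also have "measure_pmf.prob (bern_set p K) ({a. R a} \<inter> Pow K) = measure_pmf.prob (bern_set p K) {a. R a}"
      by (rule measure_pmf.finite_measure_eq_AE)
         (use bern_set_subset[OF fin(1), of _ p] in \<open>auto simp: AE_measure_pmf_iff\<close>)
    also have "measure_pmf.prob (bern_set p (E - K)) ({b. P b} \<inter> Pow (E - K)) =
        measure_pmf.prob (bern_set p (E - K)) {b. P b}"
      by (rule measure_pmf.finite_measure_eq_AE)
         (use bern_set_subset[OF fin(2), of _ p] in \<open>fastforce simp: AE_measure_pmf_iff\<close>, auto)
    finally show ?thesis .
  qed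
  show ?thesis using key[of Q] key[of "\<lambda>_. True"] by simp
qed

lemma prob_bern_set_restrict:
  assumes "finite E" "K \<subseteq> E"
  shows "measure_pmf.prob (bern_set p E) {c. Q (c \<inter> K)} = measure_pmf.prob (bern_set p K) {c. Q c}"
  using prob_bern_set_indep[OF assms, of "\<lambda>_. True" p Q] by simp

definition displace :: "nat \<times> nat \<Rightarrow> nat \<times> nat \<Rightarrow> nat \<times> nat" where
  "displace s z = (fst z + fst s, snd z + snd s)"

lemma inj_displace: "inj_on (displace s) A"
  by (auto simp: inj_on_def displace_def prod_eq_iff)

lemma recenter_displace [simp]: "recenter s (displace s ` c) = c"
  by (auto simp: recenter_def displace_def prod_eq_iff)

lemma prob_bern_set_recenter:
  assumes "finite E" "displace s ` K \<subseteq> E"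
  shows "measure_pmf.prob (bern_set p E) {c. Q (recenter s c \<inter> K)} = measure_pmf.prob (bern_set p K) {c. Q c}"
proof -
  have fin: "finite K"
    using finite_subset[OF assms(2,1)] finite_imageD[OF _ inj_displace] by blast
  have rc: "recenter s (c \<inter> displace s ` K) = recenter s c \<inter> K" for c
    by (auto simp: recenter_def displace_def prod_eq_iff)
  have "measure_pmf.prob (bern_set p E) {c. Q (recenter s c \<inter> K)} =
        measure_pmf.prob (bern_set p (displace s ` K)) {c. Q (recenter s c)}"
    using prob_bern_set_restrict[OF assms, of p "\<lambda>d. Q (recenter s d)"] by (simp add: rc)
  also have "\<dots> = measure_pmf.prob (bern_set p K) {c. Q c}"
    by (subst bern_set_image) (use fin inj_displace in auto)
  finally show ?thesis .
qed

text \<open>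
The stopping-set property. If \<open>z\<close> is a minimal site of \<open>b\<close>, or lies outside \<open>b\<close>, then no point of
\<open>b + k h\<close> lies below \<open>z + (k - 1) h\<close>: such a point would give \<open>w \<in> b\<close> with \<open>w + h \<le> z\<close>. Hence
the chains that decide the membership of \<open>z\<close> do not use \<open>b + k h\<close>, and the remaining sites of \<open>b\<close> follow since
level sets are closed upwards.
\<close>

lemma level_stopping:
  fixes c c' :: "(nat \<times> nat) set"
  assumes h: "h \<noteq> (0, 0)" and agree: "c - displace (k * fst h, k * snd h) ` b = c' - displace (k * fst h, k * snd h) ` b"
    and level: "level h D c k = b" and fin: "finite D"
  shows "level h D c' k = b"
proof (cases k)
  case 0
  thus ?thesis using level unfolding 0 level_0 by blast
next
  case (Suc k')
  let ?K = "displace (k * fst h, k * snd h) ` b"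
  have eq: "z \<in> level h D c' k \<longleftrightarrow> z \<in> b"
    if z: "z \<in> D" and min: "\<And>w. w \<in> b \<Longrightarrow> fst w \<le> fst z \<Longrightarrow> snd w \<le> snd z \<Longrightarrow> w = z" for z
  proof -
    let ?i = "fst z + (k - 1) * fst h" and ?j = "snd z + (k - 1) * snd h"
    have "?K \<inter> ({1..?i} \<times> {1..?j}) = {}"
    proof (rule equals0I)
      fix y assume "y \<in> ?K \<inter> ({1..?i} \<times> {1..?j})"
      hence yK: "y \<in> ?K" and box: "y \<in> {1..?i} \<times> {1..?j}" by simp_all
      from yK obtain w where w: "w \<in> b" and y: "y = displace (k * fst h, k * snd h) w" ..
      have "fst w + k * fst h \<le> ?i" "snd w + k * snd h \<le> ?j"
        using box unfolding y displace_def by (simp_all add: mem_Times_iff)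
      hence le: "fst w + fst h \<le> fst z" "snd w + snd h \<le> snd z"
        unfolding Suc by simp_all
      hence "w = z" using min[OF w] by auto
      thus False using le h by (cases h) auto
    qed
    hence "c \<inter> ({1..?i} \<times> {1..?j}) = c' \<inter> ({1..?i} \<times> {1..?j})"
      using agree by blast
    hence "reach h c k ?i ?j \<longleftrightarrow> reach h c' k ?i ?j"
      by (rule reach_cong_box)
    thus ?thesis using z level by (auto simp: level_def)
  qed
  show ?thesis
  proof (intro equalityI subsetI)
    fix z assume z: "z \<in> b"
    \<comment> \<open>A minimal site of \<open>b\<close> below \<open>z\<close>: one that minimizes the sum of the coordinates.\<close>
    define W where "W = {w \<in> b. fst w \<le> fst z \<and> snd w \<le> snd z}"
    obtain w where w: "w \<in> W" and wmin: "\<And>w'. w' \<in> W \<Longrightarrow> fst w + snd w \<le> fst w' + snd w'"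
      using ex_has_least_nat[of "\<lambda>w. w \<in> W" z "\<lambda>w. fst w + snd w"] z by (auto simp: W_def)
    have "w' = w" if "w' \<in> b" "fst w' \<le> fst w" "snd w' \<le> snd w" for w'
    proof -
      have "w' \<in> W" using that w by (auto simp: W_def)
      from wmin[OF this] that show ?thesis by (auto simp: prod_eq_iff)
    qed
    moreover have "w \<in> D" "w \<in> b" using w level by (auto simp: W_def level_def)
    ultimately have "w \<in> level h D c' k" using eq by blast
    thus "z \<in> level h D c' k"
      by (rule level_upward_closed) (use w z level in \<open>auto simp: W_def level_def\<close>)
  next
    fix z assume z: "z \<in> level h D c' k"
    show "z \<in> b"
    proof (rule ccontr)
      assume nz: "z \<notin> b"
      have zD: "z \<in> D" using z by (simp add: level_def)
      have "z \<in> b" if "w \<in> b" "fst w \<le> fst z" "snd w \<le> snd z" for w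
        using level_upward_closed[of w h D c k z] that zD level by simp
      hence "z \<in> level h D c' k \<longleftrightarrow> z \<in> b"
        by (intro eq zD) (use nz in blast)
      thus False using nz z by simp
    qed
  qed
qed

text \<open>
The marginal laws of the Markov chain \<open>B\<^sub>k\<close>; the gap does not occur.
\<close>

primrec level_law :: "real \<Rightarrow> (nat \<times> nat) set \<Rightarrow> nat \<Rightarrow> (nat \<times> nat) set \<Rightarrow> real" where
  "level_law p D 0 b = of_bool (b = D)"
| "level_law p D (Suc k) b =
     (\<Sum>b'\<in>Pow D. level_law p D k b' * measure_pmf.prob (bern_set p D) {c. upper_part D (b' \<inter> c) = b})"

text \<open>
Conditionally on \<open>B\<^sub>k = b\<close> the points in \<open>b + k h\<close> are untouched, by \<open>level_stopping\<close>, so shifting them back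
by \<open>k h\<close> gives a fresh Bernoulli set on \<open>b\<close>.
\<close>

lemma prob_level:
  assumes h: "h \<noteq> (0, 0)" and D: "D = {1..u} \<times> {1..v}" and E: "finite E"
    and sub: "\<And>j. j < k \<Longrightarrow> displace (j * fst h, j * snd h) ` D \<subseteq> E"
  shows "measure_pmf.prob (bern_set p E) {c. level h D c k = b} = level_law p D k b"
  using sub
proof (induction k arbitrary: b)
  case 0
  show ?case by (cases "b = D") auto
next
  case (Suc k)
  let ?s = "(k * fst h, k * snd h)"
  have finD: "finite D" by (simp add: D)
  have IH: "measure_pmf.prob (bern_set p E) {c. level h D c k = b} = level_law p D k b" for b
    by (rule Suc.IH) (use Suc.prems in auto)
  have "{c. level h D c (Suc k) = b} =
      (\<Union>b'\<in>Pow D. {c. level h D c k = b' \<and> upper_part D (b' \<inter> recenter ?s c) = b})"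
  proof (rule set_eqI)
    fix c
    have "level h D c k \<in> Pow D" unfolding level_def by blast
    thus "c \<in> {c. level h D c (Suc k) = b} \<longleftrightarrow>
        c \<in> (\<Union>b'\<in>Pow D. {c. level h D c k = b' \<and> upper_part D (b' \<inter> recenter ?s c) = b})"
      by (simp add: level_Suc[OF D, of h c k] del: Pow_iff)
  qed
  also have "measure_pmf.prob (bern_set p E) \<dots> =
      (\<Sum>b'\<in>Pow D. measure_pmf.prob (bern_set p E) {c. level h D c k = b' \<and> upper_part D (b' \<inter> recenter ?s c) = b})"
    by (rule measure_pmf.finite_measure_finite_Union) (auto simp: finD disjoint_family_on_def)
  also have "\<dots> = (\<Sum>b'\<in>Pow D. level_law p D k b' * measure_pmf.prob (bern_set p D) {c. upper_part D (b' \<inter> c) = b})"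
  proof (rule sum.cong[OF refl])
    fix b' assume b': "b' \<in> Pow D"
    let ?K = "displace ?s ` b'"
    have finb': "finite b'" using b' finD finite_subset by blast
    have K: "?K \<subseteq> E" using Suc.prems[of k] b' by auto
    have rc: "b' \<inter> recenter ?s (c \<inter> ?K) = b' \<inter> recenter ?s c" for c
      by (auto simp: recenter_def displace_def prod_eq_iff)
    have "measure_pmf.prob (bern_set p E) {c. level h D c k = b' \<and> upper_part D (b' \<inter> recenter ?s (c \<inter> ?K)) = b} =
      measure_pmf.prob (bern_set p E) {c. level h D c k = b'} *
      measure_pmf.prob (bern_set p ?K) {c. upper_part D (b' \<inter> recenter ?s c) = b}"
    proof (rule prob_bern_set_indep[OF E K])
      fix c
      have "c - ?K = (c - ?K) - ?K" "(c - ?K) - ?K = c - ?K" by blast+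
      thus "level h D c k = b' \<longleftrightarrow> level h D (c - ?K) k = b'"
        using level_stopping[OF h _ _ finD] by metis
    qed
    also have "measure_pmf.prob (bern_set p ?K) {c. upper_part D (b' \<inter> recenter ?s c) = b} =
       measure_pmf.prob (bern_set p b') {c. upper_part D (b' \<inter> c) = b}"
      by (subst bern_set_image) (use finb' in \<open>auto simp: inj_displace\<close>)
    also have "\<dots> = measure_pmf.prob (bern_set p D) {c. upper_part D (b' \<inter> c) = b}"
    proof -
      have "b' \<inter> (c \<inter> b') = b' \<inter> c" for c by blast
      thus ?thesis
        using prob_bern_set_restrict[of D b' p "\<lambda>c. upper_part D (b' \<inter> c) = b"] b' finD by simp
    qed
    finally show "measure_pmf.prob (bern_set p E) {c. level h D c k = b' \<and> upper_part D (b' \<inter> recenter ?s c) = b} =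
       level_law p D k b' * measure_pmf.prob (bern_set p D) {c. upper_part D (b' \<inter> c) = b}"
      by (simp add: rc IH)
  qed
  finally show ?case by simp
qed

lemma prob_reach:
  assumes h: "h \<noteq> (0, 0)" and uv: "1 \<le> u" "1 \<le> v" and D: "D = {1..u} \<times> {1..v}"
    and mn: "m = u + (k - 1) * fst h" "n = v + (k - 1) * snd h"
  shows "measure_pmf.prob (bern_set p ({1..m} \<times> {1..n})) {c. reach h c k m n} =
         (\<Sum>b\<in>{b. b \<subseteq> D \<and> (u, v) \<in> b}. level_law p D k b)"
proof -
  let ?E = "{1..m} \<times> {1..n}"
  have finD: "finite D" by (simp add: D)
  have "{c. reach h c k m n} = (\<Union>b\<in>{b. b \<subseteq> D \<and> (u, v) \<in> b}. {c. level h D c k = b})"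
    using uv by (auto simp: level_def D mn)
  also have "measure_pmf.prob (bern_set p ?E) \<dots> =
      (\<Sum>b\<in>{b. b \<subseteq> D \<and> (u, v) \<in> b}. measure_pmf.prob (bern_set p ?E) {c. level h D c k = b})"
    by (rule measure_pmf.finite_measure_finite_Union) (auto simp: finD disjoint_family_on_def)
  also have "\<dots> = (\<Sum>b\<in>{b. b \<subseteq> D \<and> (u, v) \<in> b}. level_law p D k b)"
  proof (rule sum.cong[OF refl], rule prob_level[OF h D])
    fix j assume "j < k"
    hence "j * fst h \<le> (k - 1) * fst h" "j * snd h \<le> (k - 1) * snd h"
      by (intro mult_right_mono; simp)+
    thus "displace (j * fst h, j * snd h) ` D \<subseteq> ?E"
      unfolding D mn displace_def by (auto simp del: mult_le_cancel2 simp: add_mono)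
  qed simp
  finally show ?thesis .
qed

text \<open>
Both sides are the probability that \<open>B\<^sub>k\<close> contains the same site \<open>(m, n) - (k - 1) h\<close>. If this site leaves the
quadrant, truncation makes both boxes too small for a chain of length \<open>k\<close>.
\<close>

lemma prob_reach_gap_change:
  fixes m n k :: nat
  assumes h: "h \<noteq> (0, 0)" and k: "1 \<le> k"
  defines "u \<equiv> m - (k - 1) * fst h" and "v \<equiv> n - (k - 1) * snd h + (k - 1)"
  shows "measure_pmf.prob (bern_set p ({1..m} \<times> {1..n})) {c. reach h c k m n} =
         measure_pmf.prob (bern_set p ({1..u} \<times> {1..v})) {c. reach (0, 1) c k u v}"
proof (cases "1 \<le> u \<and> 1 \<le> n - (k - 1) * snd h")
  case True
  define w where "w = n - (k - 1) * snd h"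
  have "measure_pmf.prob (bern_set p ({1..m} \<times> {1..n})) {c. reach h c k m n} =
         (\<Sum>b\<in>{b. b \<subseteq> {1..u} \<times> {1..w} \<and> (u, w) \<in> b}. level_law p ({1..u} \<times> {1..w}) k b)"
    by (rule prob_reach[OF h _ _ refl]) (use True in \<open>auto simp: w_def u_def\<close>)
  also have "\<dots> = measure_pmf.prob (bern_set p ({1..u} \<times> {1..v})) {c. reach (0, 1) c k u v}"
    by (rule prob_reach[symmetric]) (use True in \<open>auto simp: w_def v_def\<close>)
  finally show ?thesis .
next
  case False
  have "\<not> reach h c k m n" for c
    using reach_lower_bound[of h c "k - 1" m n] k False by (auto simp: u_def)
  moreover have "\<not> reach (0, 1) c k u v" for c
    using reach_lower_bound[of "(0, 1)" c "k - 1" u v] k False by (auto simp: v_def)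
  ultimately show ?thesis by simp
qed

section \<open>Exponential concentration and the local Burke property\<close>

lemma replicate_pmf_snoc:
  "replicate_pmf (Suc n) p = do {xs \<leftarrow> replicate_pmf n p; x \<leftarrow> p; return_pmf (xs @ [x])}"
  using replicate_pmf_distrib[of n 1 p]
  by (simp add: bind_return_pmf bind_assoc_pmf)

lemma exp_moment_replicate_pmf:
  fixes f :: "'a \<Rightarrow> real" and \<mu> :: "'a pmf"
  shows "(\<integral>\<^sup>+ xs. ennreal (exp (sum_list (map f xs))) \<partial>replicate_pmf k \<mu>) =
         (\<integral>\<^sup>+ x. ennreal (exp (f x)) \<partial>\<mu>) ^ k"
proof (induction k)
  case (Suc k)
  have "(\<integral>\<^sup>+ xs. ennreal (exp (sum_list (map f xs))) \<partial>replicate_pmf (Suc k) \<mu>) =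
      (\<integral>\<^sup>+ x. \<integral>\<^sup>+ xs. ennreal (exp (f x)) * ennreal (exp (sum_list (map f xs))) \<partial>replicate_pmf k \<mu> \<partial>\<mu>)"
    by (simp add: nn_integral_bind_pmf exp_add ennreal_mult)
  also have "\<dots> = (\<integral>\<^sup>+ x. ennreal (exp (f x)) \<partial>\<mu>) * (\<integral>\<^sup>+ x. ennreal (exp (f x)) \<partial>\<mu>) ^ k"
    by (simp add: nn_integral_cmult nn_integral_multc Suc.IH)
  finally show ?case by simp
qed simp

lemma chernoff_replicate_pmf:
  fixes f :: "'a \<Rightarrow> real" and \<mu> :: "'a pmf"
  assumes "(\<integral>\<^sup>+ x. ennreal (exp (f x)) \<partial>\<mu>) \<le> ennreal (exp c)"
  shows "measure_pmf.prob (replicate_pmf k \<mu>) {xs. real k * c + s \<le> sum_list (map f xs)} \<le> exp (- s)"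
proof -
  let ?A = "{xs. real k * c + s \<le> sum_list (map f xs)}"
  let ?C = "ennreal (exp (- s)) * ennreal (exp (- real k * c))"
  have "emeasure (replicate_pmf k \<mu>) ?A = (\<integral>\<^sup>+ xs. indicator ?A xs \<partial>replicate_pmf k \<mu>)"
    by simp
  also have "\<dots> \<le> (\<integral>\<^sup>+ xs. ?C * ennreal (exp (sum_list (map f xs))) \<partial>replicate_pmf k \<mu>)"
  proof (rule nn_integral_mono)
    fix xs
    have "?C * ennreal (exp (sum_list (map f xs))) = ennreal (exp (sum_list (map f xs) - (real k * c + s)))"
      by (simp add: ennreal_mult[symmetric] exp_add[symmetric] algebra_simps)
    thus "indicator ?A xs \<le> ?C * ennreal (exp (sum_list (map f xs)))"
      by (auto simp: indicator_def simp flip: ennreal_1 intro!: ennreal_leI)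
  qed
  also have "\<dots> = ?C * (\<integral>\<^sup>+ x. ennreal (exp (f x)) \<partial>\<mu>) ^ k"
    by (simp add: nn_integral_cmult exp_moment_replicate_pmf)
  also have "\<dots> \<le> ?C * ennreal (exp c) ^ k"
    by (intro mult_left_mono power_mono assms) auto
  also have "\<dots> = ennreal (exp (- s))"
    by (simp add: ennreal_power ennreal_mult[symmetric] exp_of_nat_mult[symmetric] exp_add[symmetric])
  finally show ?thesis
    by (simp add: measure_pmf.emeasure_eq_measure)
qed

text \<open>
An upper exponential moment condition around \<open>m\<close>. Applied to \<open>\<sigma> f\<close> and \<open>\<sigma> m\<close> with \<open>\<sigma> = 1\<close> and
\<open>\<sigma> = -1\<close> it controls both tails at once.
\<close>

definition exp_conc :: "'a pmf \<Rightarrow> ('a \<Rightarrow> real) \<Rightarrow> real \<Rightarrow> bool" where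
  "exp_conc \<mu> f m \<longleftrightarrow>
     (\<forall>\<epsilon>>0. \<exists>t>0. (\<integral>\<^sup>+ x. ennreal (exp (t * f x)) \<partial>\<mu>) \<le> ennreal (exp (t * (m + \<epsilon>))))"

text \<open>
The bound is uniform over all numbers \<open>k \<le> K n\<close> of summands; the exit argument needs it
for all prefixes of the boundary simultaneously.
\<close>

lemma exp_conc_deviation:
  assumes "exp_conc \<mu> f m" "\<epsilon> > 0" "K > 0"
  obtains c where "c > 0"
    "\<And>k n. real k \<le> K * real n \<Longrightarrow>
       measure_pmf.prob (replicate_pmf k \<mu>) {xs. real k * m + \<epsilon> * real n \<le> sum_list (map f xs)}
         \<le> exp (- c * real n)"
proof -
  define \<delta> where "\<delta> = \<epsilon> / (2 * K)"
  have "\<delta> > 0" using assms by (simp add: \<delta>_def)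
  then obtain t where t: "t > 0"
    "(\<integral>\<^sup>+ x. ennreal (exp (t * f x)) \<partial>\<mu>) \<le> ennreal (exp (t * (m + \<delta>)))"
    using assms(1) unfolding exp_conc_def by blast
  show ?thesis
  proof (rule that)
    show "t * \<epsilon> / 2 > 0" using t assms by simp
    fix k n :: nat assume k: "real k \<le> K * real n"
    have "real k * \<delta> \<le> K * real n * \<delta>"
      using k \<open>\<delta> > 0\<close> by (intro mult_right_mono) auto
    also have "\<dots> = \<epsilon> * real n / 2" using assms by (simp add: \<delta>_def)
    finally have le: "real k * (m + \<delta>) + \<epsilon> * real n / 2 \<le> real k * m + \<epsilon> * real n"
      by (simp add: algebra_simps)
    have "measure_pmf.prob (replicate_pmf k \<mu>) {xs. real k * m + \<epsilon> * real n \<le> sum_list (map f xs)} \<le>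
      measure_pmf.prob (replicate_pmf k \<mu>)
        {xs. real k * (t * (m + \<delta>)) + t * \<epsilon> / 2 * real n \<le> sum_list (map (\<lambda>x. t * f x) xs)}"
    proof (rule measure_pmf.finite_measure_mono)
      show "{xs. real k * m + \<epsilon> * real n \<le> sum_list (map f xs)} \<subseteq>
        {xs. real k * (t * (m + \<delta>)) + t * \<epsilon> / 2 * real n \<le> sum_list (map (\<lambda>x. t * f x) xs)}"
      proof safe
        fix xs assume "real k * m + \<epsilon> * real n \<le> sum_list (map f xs)"
        hence "t * (real k * (m + \<delta>) + \<epsilon> * real n / 2) \<le> t * sum_list (map f xs)"
          using le t(1) by (intro mult_left_mono) auto
        thus "real k * (t * (m + \<delta>)) + t * \<epsilon> / 2 * real n \<le> sum_list (map (\<lambda>x. t * f x) xs)"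
          by (simp add: sum_list_const_mult algebra_simps)
      qed
    qed simp
    also have "\<dots> \<le> exp (- (t * \<epsilon> / 2 * real n))"
      by (rule chernoff_replicate_pmf[OF t(2)])
    finally show "measure_pmf.prob (replicate_pmf k \<mu>) {xs. real k * m + \<epsilon> * real n \<le> sum_list (map f xs)}
        \<le> exp (- (t * \<epsilon> / 2) * real n)" by simp
  qed
qed

text \<open>
Both sides of the moment inequality agree at \<open>t = 0\<close>, and the derivative of their difference there is \<open>\<epsilon> > 0\<close>.
\<close>

lemma exp_conc_bernoulli:
  assumes "0 \<le> q" "q \<le> 1"
  shows "exp_conc (bernoulli_pmf q) (\<lambda>b. \<sigma> * of_bool b) (\<sigma> * q)"
  unfolding exp_conc_def
proof safe
  fix \<epsilon> :: real assume "\<epsilon> > 0"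
  define \<phi> where "\<phi> = (\<lambda>t. exp (t * (\<sigma> * q + \<epsilon>)) - (q * exp (\<sigma> * t) + (1 - q)))"
  have "(\<phi> has_real_derivative \<epsilon>) (at 0)"
    unfolding \<phi>_def by (auto intro!: derivative_eq_intros)
  from DERIV_pos_inc_right[OF this \<open>\<epsilon> > 0\<close>] obtain d where d: "d > 0" "\<And>t. 0 < t \<Longrightarrow> t < d \<Longrightarrow> \<phi> 0 < \<phi> t"
    by auto
  have "\<phi> 0 = 0" by (simp add: \<phi>_def)
  hence "q * exp (\<sigma> * (d/2)) + (1 - q) \<le> exp (d/2 * (\<sigma> * q + \<epsilon>))"
    using d(2)[of "d/2"] d(1) by (simp add: \<phi>_def)
  moreover have "(\<integral>\<^sup>+ x. ennreal (exp (d/2 * (\<sigma> * of_bool x))) \<partial>bernoulli_pmf q) =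
      ennreal (q * exp (\<sigma> * (d/2)) + (1 - q))"
    using assms by (simp add: nn_integral_bernoulli_pmf ennreal_mult[symmetric] ennreal_plus[symmetric] mult_ac del: ennreal_plus)
  ultimately show "\<exists>t>0. (\<integral>\<^sup>+ x. ennreal (exp (t * (\<sigma> * of_bool x))) \<partial>bernoulli_pmf q) \<le>
      ennreal (exp (t * (\<sigma> * q + \<epsilon>)))"
    using d(1) by (intro exI[of _ "d/2"]) (auto intro!: ennreal_leI)
qed

text \<open>
Parametrized by the mean \<open>r\<close>, which makes the stationary value linear in \<open>r\<close>.
\<close>

definition geo_pmf :: "real \<Rightarrow> nat pmf" where
  "geo_pmf r = geometric_pmf (1 / (1 + r))"

lemma pmf_geo:
  assumes "r > 0"
  shows "pmf (geo_pmf r) k = (r / (1 + r)) ^ k * (1 / (1 + r))"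
proof -
  have "1 - 1 / (1 + r) = r / (1 + r)" using assms by (simp add: field_simps)
  thus ?thesis unfolding geo_pmf_def using assms by (subst pmf_geometric) auto
qed

lemma exp_moment_geo:
  assumes r: "r > 0" and u: "r / (1 + r) * exp u < 1"
  shows "(\<integral>\<^sup>+ k. ennreal (exp (u * real k)) \<partial>geo_pmf r) = ennreal (1 / (1 + r) / (1 - r / (1 + r) * exp u))"
proof -
  have "(\<integral>\<^sup>+ k. ennreal (exp (u * real k)) \<partial>geo_pmf r) = (\<integral>\<^sup>+ k. ennreal (1 / (1 + r) * (r / (1 + r) * exp u) ^ k) \<partial>count_space UNIV)"
    unfolding nn_integral_measure_pmf
    using r by (intro nn_integral_cong) (simp add: pmf_geo ennreal_mult[symmetric] exp_of_nat2_mult power_mult_distrib power_divide mult_ac)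
  also have "\<dots> = (\<Sum>k. ennreal (1 / (1 + r) * (r / (1 + r) * exp u) ^ k))"
    by (rule nn_integral_count_space_nat)
  also have "\<dots> = ennreal (1 / (1 + r) * (1 / (1 - r / (1 + r) * exp u)))"
    using r u by (intro suminf_ennreal_eq sums_mult geometric_sums) auto
  finally show ?thesis by simp
qed

lemma exp_conc_geo:
  assumes "r > 0"
  shows "exp_conc (geo_pmf r) (\<lambda>k. \<sigma> * real k) (\<sigma> * r)"
  unfolding exp_conc_def
proof safe
  fix \<epsilon> :: real assume "\<epsilon> > 0"
  define \<alpha> where "\<alpha> = r / (1 + r)"
  define s where "s = 1 / (1 + r)"
  have s: "s > 0" "s = 1 - \<alpha>" "s * r = \<alpha>" using assms by (auto simp: s_def \<alpha>_def field_simps)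
  define \<phi> where "\<phi> = (\<lambda>t. (1 - \<alpha> * exp (\<sigma> * t)) * exp (t * (\<sigma> * r + \<epsilon>)))"
  have "(\<phi> has_real_derivative s * (\<sigma> * r + \<epsilon>) - \<sigma> * \<alpha>) (at 0)"
    unfolding \<phi>_def by (auto intro!: derivative_eq_intros simp: s(2))
  also have "s * (\<sigma> * r + \<epsilon>) - \<sigma> * \<alpha> = s * \<epsilon>"
    by (simp add: s(3)[symmetric] algebra_simps)
  finally obtain d where d: "d > 0" "\<And>t. 0 < t \<Longrightarrow> t < d \<Longrightarrow> \<phi> 0 < \<phi> t"
    using DERIV_pos_inc_right[of \<phi> "s * \<epsilon>" 0] s \<open>\<epsilon> > 0\<close> by auto
  define t where "t = d / 2"
  have t: "t > 0" using d by (simp add: t_def)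
  have "s < \<phi> t" using d(2)[of t] d(1) by (simp add: \<phi>_def s t_def)
  hence 1: "s < (1 - \<alpha> * exp (\<sigma> * t)) * exp (t * (\<sigma> * r + \<epsilon>))" by (simp add: \<phi>_def)
  hence pos: "0 < 1 - \<alpha> * exp (\<sigma> * t)"
    using s(1) by (metis exp_gt_zero order.strict_trans zero_less_mult_pos2)
  have "(\<integral>\<^sup>+ k. ennreal (exp (t * (\<sigma> * real k))) \<partial>geo_pmf r) = ennreal (s / (1 - \<alpha> * exp (\<sigma> * t)))"
    using exp_moment_geo[OF assms, of "\<sigma> * t"] pos by (simp add: \<alpha>_def s_def mult_ac)
  also have "\<dots> \<le> ennreal (exp (t * (\<sigma> * r + \<epsilon>)))"
    using 1 pos by (intro ennreal_leI) (simp add: field_simps)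
  finally show "\<exists>t>0. (\<integral>\<^sup>+ x. ennreal (exp (t * (\<sigma> * real x))) \<partial>geo_pmf r) \<le> ennreal (exp (t * (\<sigma> * r + \<epsilon>)))"
    using t by blast
qed

text \<open>
One step of the recursion \<open>max (f + J) (g + x)\<close> in terms of increments: \<open>I = g - f\<close> is the horizontal increment below the
cell, \<open>J\<close> the vertical increment to its left and \<open>x\<close> the point in it. The result is the pair of the
horizontal increment above and the vertical increment to the right.
\<close>

definition cell :: "nat \<Rightarrow> bool \<Rightarrow> bool \<Rightarrow> nat \<times> bool" where
  "cell I J x = (I + of_bool x - of_bool J, x \<or> (J \<and> I = 0))"

text \<open>
The density \<open>q\<close> for which geometric increments of mean \<open>r\<close> and Bernoulli increments of density \<open>q\<close> are
stationary: with \<open>\<alpha> = r / (1 + r)\<close> it solves \<open>p (q \<alpha> + (1 - q)) = q \<alpha>\<close>.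
\<close>

definition bern_density :: "real \<Rightarrow> real \<Rightarrow> real" where
  "bern_density p r = p * (1 + r) / (p + r)"

text \<open>
Burke's property. The probability of an output \<open>(i, b)\<close> is a sum over the four values of \<open>(J, x)\<close>. Since the geometric
weights satisfy \<open>P(k + 1) = \<alpha> P(k)\<close>, all cases reduce to the defining equation of the density.
\<close>

lemma burke_cell:
  assumes p: "0 < p" "p < 1" and r: "r > 0"
  shows "do {I \<leftarrow> geo_pmf r; J \<leftarrow> bernoulli_pmf (bern_density p r); x \<leftarrow> bernoulli_pmf p; return_pmf (cell I J x)} =
         pair_pmf (geo_pmf r) (bernoulli_pmf (bern_density p r))"
proof (rule pmf_eqI, clarify)
  fix i b
  let ?q = "bern_density p r"
  have q: "0 \<le> ?q" "?q \<le> 1" using p r by (auto simp: bern_density_def field_simps)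
  define w where "w = (\<lambda>J x. pmf (map_pmf (\<lambda>I. cell I J x) (geo_pmf r)) (i, b))"
  have "do {I \<leftarrow> geo_pmf r; J \<leftarrow> bernoulli_pmf ?q; x \<leftarrow> bernoulli_pmf p; return_pmf (cell I J x)} =
        do {J \<leftarrow> bernoulli_pmf ?q; x \<leftarrow> bernoulli_pmf p; map_pmf (\<lambda>I. cell I J x) (geo_pmf r)}"
    unfolding map_pmf_def
    by (subst bind_commute_pmf, intro bind_pmf_cong refl, subst bind_commute_pmf) simp
  also have "pmf \<dots> (i, b) = ?q * (p * w True True + (1 - p) * w True False) +
      (1 - ?q) * (p * w False True + (1 - p) * w False False)"
    using q p by (simp add: pmf_bind w_def algebra_simps)
  also have "\<dots> = pmf (geo_pmf r) i * pmf (bernoulli_pmf ?q) b"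
  proof -
    have "(\<lambda>I. cell I True True) -` {(i, b)} = (if b then {i} else {})"
         "(\<lambda>I. cell I True False) -` {(i, b)} = (if b then (if i = 0 then {0} else {}) else {Suc i})"
         "(\<lambda>I. cell I False True) -` {(i, b)} = (if b \<and> i > 0 then {i - 1} else {})"
         "(\<lambda>I. cell I False False) -` {(i, b)} = (if b then {} else {i})"
      by (cases b; cases i; simp add: cell_def vimage_def set_eq_iff; presburger)+
    hence w: "w True True = (if b then pmf (geo_pmf r) i else 0)"
         "w True False = (if b then (if i = 0 then pmf (geo_pmf r) 0 else 0) else pmf (geo_pmf r) (Suc i))"
         "w False True = (if b \<and> i > 0 then pmf (geo_pmf r) (i - 1) else 0)"
         "w False False = (if b then 0 else pmf (geo_pmf r) i)"
      by (auto simp: w_def pmf_map measure_pmf_single)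
    define \<alpha> where "\<alpha> = r / (1 + r)"
    have nz: "p + r \<noteq> 0" "1 + r \<noteq> 0" using p r by auto
    have q\<alpha>: "?q * \<alpha> = p * r / (p + r)"
      using nz by (simp add: bern_density_def \<alpha>_def divide_simps)
    have q1: "1 - ?q = r * (1 - p) / (p + r)"
      using nz by (simp add: bern_density_def field_simps)
    have "?q * \<alpha> + (1 - ?q) = r / (p + r)"
      unfolding q\<alpha> q1 by (simp add: add_divide_distrib[symmetric] algebra_simps)
    hence E: "p * (?q * \<alpha> + (1 - ?q)) = ?q * \<alpha>" "(1 - p) * (?q * \<alpha> + (1 - ?q)) = 1 - ?q"
      unfolding q\<alpha> q1 by simp_all
    have Suc_geo: "pmf (geo_pmf r) (Suc k) = \<alpha> * pmf (geo_pmf r) k" for k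
      by (simp add: pmf_geo[OF r] \<alpha>_def)
    show ?thesis
    proof (cases b)
      case True
      show ?thesis
      proof (cases i)
        case 0
        thus ?thesis using True q by (simp add: w algebra_simps)
      next
        case (Suc i')
        have "?q * (p * (\<alpha> * pmf (geo_pmf r) i')) + (1 - ?q) * (p * pmf (geo_pmf r) i') =
            (p * (?q * \<alpha> + (1 - ?q))) * pmf (geo_pmf r) i'" by (simp add: algebra_simps)
        thus ?thesis using True q unfolding E(1) by (simp add: w Suc Suc_geo algebra_simps)
      qed
    next
      case False
      have "?q * ((1 - p) * (\<alpha> * pmf (geo_pmf r) i)) + (1 - ?q) * ((1 - p) * pmf (geo_pmf r) i) =
            ((1 - p) * (?q * \<alpha> + (1 - ?q))) * pmf (geo_pmf r) i" by (simp add: algebra_simps)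
      thus ?thesis using False q unfolding E(2) by (simp add: w Suc_geo)
    qed
  qed
  finally show "pmf (do {I \<leftarrow> geo_pmf r; J \<leftarrow> bernoulli_pmf ?q; x \<leftarrow> bernoulli_pmf p; return_pmf (cell I J x)}) (i, b) =
      pmf (pair_pmf (geo_pmf r) (bernoulli_pmf ?q)) (i, b)"
    by (simp add: pmf_pair)
qed

section \<open>Stationary last passage percolation\<close>

text \<open>
The cells of a column are traversed upwards, passing the horizontal increment along; a list of vertical
increments on the left becomes the one on the right.
\<close>

fun col_update :: "nat \<Rightarrow> bool list \<Rightarrow> bool list \<Rightarrow> bool list" where
  "col_update I (J # Js) (x # xs) = snd (cell I J x) # col_update (fst (cell I J x)) Js xs"
| "col_update I _ _ = []"

definition sweep :: "nat list \<Rightarrow> bool list \<Rightarrow> bool list list \<Rightarrow> bool list" where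
  "sweep Is Js Xs = fold (\<lambda>(I, xs) Js. col_update I Js xs) (zip Is Xs) Js"

lemma sweep_Nil [simp]: "sweep [] Js Xs = Js"
  by (simp add: sweep_def)

lemma sweep_Cons [simp]: "sweep (I # Is) Js (xs # Xs) = sweep Is (col_update I Js xs) Xs"
  by (simp add: sweep_def)

lemma sweep_snoc:
  "length Is = length Xs \<Longrightarrow> sweep (Is @ [I]) Js (Xs @ [xs]) = col_update I (sweep Is Js Xs) xs"
  by (simp add: sweep_def)

lemma length_col_update:
  "length Js = length xs \<Longrightarrow> length (col_update I Js xs) = length xs"
  by (induction I Js xs rule: col_update.induct) auto

text \<open>
After the lowest cell, its two outputs are independent with the original laws, so the rest of the column is a shorter
instance of the same situation. Only the order of independent choices has to be changed.
\<close>

lemma burke_column: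
  assumes p: "0 < p" "p < 1" and r: "r > 0"
  shows "do {I \<leftarrow> geo_pmf r; Js \<leftarrow> replicate_pmf n (bernoulli_pmf (bern_density p r)); xs \<leftarrow> replicate_pmf n (bernoulli_pmf p);
             return_pmf (col_update I Js xs)} = replicate_pmf n (bernoulli_pmf (bern_density p r))"
proof (induction n)
  case (Suc n)
  let ?G = "geo_pmf r" and ?Q = "bernoulli_pmf (bern_density p r)" and ?P = "bernoulli_pmf p"
  let ?R = "replicate_pmf n"
  have "do {I \<leftarrow> ?G; Js \<leftarrow> replicate_pmf (Suc n) ?Q; xs \<leftarrow> replicate_pmf (Suc n) ?P; return_pmf (col_update I Js xs)} =
    do {I \<leftarrow> ?G; J \<leftarrow> ?Q; Js \<leftarrow> ?R ?Q; x \<leftarrow> ?P; xs \<leftarrow> ?R ?P;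
        return_pmf (snd (cell I J x) # col_update (fst (cell I J x)) Js xs)}"
    by (simp add: bind_assoc_pmf bind_return_pmf)
  also have "\<dots> = do {I \<leftarrow> ?G; J \<leftarrow> ?Q; x \<leftarrow> ?P; Js \<leftarrow> ?R ?Q; xs \<leftarrow> ?R ?P;
        return_pmf (snd (cell I J x) # col_update (fst (cell I J x)) Js xs)}"
    by (intro bind_pmf_cong refl, rule bind_commute_pmf)
  also have "\<dots> = do {z \<leftarrow> do {I \<leftarrow> ?G; J \<leftarrow> ?Q; x \<leftarrow> ?P; return_pmf (cell I J x)}; Js \<leftarrow> ?R ?Q; xs \<leftarrow> ?R ?P;
        return_pmf (snd z # col_update (fst z) Js xs)}"
    by (simp add: bind_assoc_pmf bind_return_pmf)
  also have "\<dots> = do {z \<leftarrow> pair_pmf ?G ?Q; Js \<leftarrow> ?R ?Q; xs \<leftarrow> ?R ?P;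
        return_pmf (snd z # col_update (fst z) Js xs)}"
    by (simp only: burke_cell[OF p r])
  also have "\<dots> = do {J \<leftarrow> ?Q; I \<leftarrow> ?G; Js \<leftarrow> ?R ?Q; xs \<leftarrow> ?R ?P; return_pmf (J # col_update I Js xs)}"
    unfolding pair_pmf_def bind_assoc_pmf bind_return_pmf fst_conv snd_conv
    by (rule bind_commute_pmf)
  also have "\<dots> = do {J \<leftarrow> ?Q; js \<leftarrow> do {I \<leftarrow> ?G; Js \<leftarrow> ?R ?Q; xs \<leftarrow> ?R ?P; return_pmf (col_update I Js xs)};
       return_pmf (J # js)}"
    by (simp add: bind_assoc_pmf bind_return_pmf)
  also have "\<dots> = replicate_pmf (Suc n) ?Q"
    by (simp only: Suc.IH replicate_pmf.simps)
  finally show ?case .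
qed (simp add: bind_return_pmf)

lemma burke_sweep:
  assumes p: "0 < p" "p < 1" and r: "r > 0"
  shows "do {Is \<leftarrow> replicate_pmf m (geo_pmf r); Js \<leftarrow> replicate_pmf n (bernoulli_pmf (bern_density p r));
             Xs \<leftarrow> replicate_pmf m (replicate_pmf n (bernoulli_pmf p)); return_pmf (sweep Is Js Xs)} =
         replicate_pmf n (bernoulli_pmf (bern_density p r))"
proof (induction m)
  case (Suc m)
  let ?G = "geo_pmf r" and ?Q = "replicate_pmf n (bernoulli_pmf (bern_density p r))" and ?P = "replicate_pmf n (bernoulli_pmf p)"
  let ?R = "replicate_pmf m"
  have "do {Is \<leftarrow> replicate_pmf (Suc m) ?G; Js \<leftarrow> ?Q; Xs \<leftarrow> replicate_pmf (Suc m) ?P; return_pmf (sweep Is Js Xs)} =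
    do {I \<leftarrow> ?G; Is \<leftarrow> replicate_pmf m ?G; Js \<leftarrow> ?Q; xs \<leftarrow> ?P; Xs \<leftarrow> ?R ?P;
      return_pmf (sweep Is (col_update I Js xs) Xs)}"
    by (simp add: bind_assoc_pmf bind_return_pmf)
  also have "\<dots> = do {Is \<leftarrow> ?R ?G; I \<leftarrow> ?G; Js \<leftarrow> ?Q; xs \<leftarrow> ?P; Xs \<leftarrow> ?R ?P;
      return_pmf (sweep Is (col_update I Js xs) Xs)}"
    by (rule bind_commute_pmf)
  also have "\<dots> = do {Is \<leftarrow> ?R ?G; Js \<leftarrow> do {I \<leftarrow> ?G; Js \<leftarrow> ?Q; xs \<leftarrow> ?P; return_pmf (col_update I Js xs)};
      Xs \<leftarrow> ?R ?P; return_pmf (sweep Is Js Xs)}"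
    by (simp add: bind_assoc_pmf bind_return_pmf)
  also have "\<dots> = ?Q"
    by (simp only: burke_column[OF p r] Suc.IH)
  finally show ?case .
qed (simp add: bind_return_pmf bind_return_pmf')

definition column :: "(nat \<times> nat) set \<Rightarrow> nat \<Rightarrow> nat \<Rightarrow> bool list" where
  "column S n i = map (\<lambda>j. (i, Suc j) \<in> S) [0..<n]"

definition columns :: "(nat \<times> nat) set \<Rightarrow> nat \<Rightarrow> nat \<Rightarrow> bool list list" where
  "columns S m n = map (\<lambda>i. column S n (Suc i)) [0..<m]"

lemma column_bern_set:
  "map_pmf (\<lambda>c. column c n i) (bern_set p ({i} \<times> {1..n})) = replicate_pmf n (bernoulli_pmf p)"
proof (induction n)
  case 0
  show ?case by (simp add: column_def)
next
  case (Suc n)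
  let ?E = "{i} \<times> {1..n}"
  have E: "{i} \<times> {1..Suc n} = insert (i, Suc n) ?E" by auto
  have fin: "finite ?E" "(i, Suc n) \<notin> ?E" by auto
  have col: "column (if b then insert (i, Suc n) c else c) (Suc n) i = column c n i @ [b]"
    if "c \<in> set_pmf (bern_set p ?E)" for b c
    using bern_set_subset[OF fin(1) that] by (auto simp: column_def)
  have "map_pmf (\<lambda>c. column c (Suc n) i) (bern_set p ({i} \<times> {1..Suc n})) =
     do {b \<leftarrow> bernoulli_pmf p; c \<leftarrow> bern_set p ?E; return_pmf (column c n i @ [b])}"
    unfolding E bern_set_insert[OF fin] map_bind_pmf map_return_pmf
    by (intro bind_pmf_cong refl) (simp add: col)
  also have "\<dots> = do {b \<leftarrow> bernoulli_pmf p; xs \<leftarrow> map_pmf (\<lambda>c. column c n i) (bern_set p ?E); return_pmf (xs @ [b])}"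
    by (simp add: bind_map_pmf)
  also have "\<dots> = replicate_pmf (Suc n) (bernoulli_pmf p)"
    unfolding Suc.IH replicate_pmf_snoc by (rule bind_commute_pmf)
  finally show ?case .
qed

lemma columns_bern_set:
  "map_pmf (\<lambda>c. columns c m n) (bern_set p ({1..m} \<times> {1..n})) = replicate_pmf m (replicate_pmf n (bernoulli_pmf p))"
proof (induction m)
  case 0
  show ?case by (simp add: columns_def)
next
  case (Suc m)
  let ?E = "{1..m} \<times> {1..n}" and ?C = "{Suc m} \<times> {1..n}"
  have E: "{1..Suc m} \<times> {1..n} = ?E \<union> ?C" by auto
  have fin: "finite ?E" "finite ?C" "?E \<inter> ?C = {}" by auto
  have col: "columns (a \<union> b) (Suc m) n = columns a m n @ [column b n (Suc m)]"
    if "a \<in> set_pmf (bern_set p ?E)" "b \<in> set_pmf (bern_set p ?C)" for a b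
    using bern_set_subset[OF fin(1) that(1)] bern_set_subset[OF fin(2) that(2)]
    by (auto simp: columns_def column_def)
  have "map_pmf (\<lambda>c. columns c (Suc m) n) (bern_set p ({1..Suc m} \<times> {1..n})) =
     do {a \<leftarrow> bern_set p ?E; b \<leftarrow> bern_set p ?C; return_pmf (columns a m n @ [column b n (Suc m)])}"
    unfolding E bern_set_union[OF fin] map_bind_pmf map_return_pmf
    by (intro bind_pmf_cong refl) (simp add: col)
  also have "\<dots> = do {Xs \<leftarrow> map_pmf (\<lambda>a. columns a m n) (bern_set p ?E);
      xs \<leftarrow> map_pmf (\<lambda>b. column b n (Suc m)) (bern_set p ?C); return_pmf (Xs @ [xs])}"
    by (simp add: bind_map_pmf)
  also have "\<dots> = replicate_pmf (Suc m) (replicate_pmf n (bernoulli_pmf p))"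
    unfolding Suc.IH column_bern_set replicate_pmf_snoc ..
  finally show ?case .
qed

text \<open>
The longest chain for gap \<open>(0, 1)\<close> obeys the same recursion with zero boundary values
(\<open>chain01_Suc_Suc\<close>). Positive boundary values act as sources.
\<close>

fun lpp :: "(nat \<Rightarrow> nat) \<Rightarrow> (nat \<Rightarrow> nat) \<Rightarrow> (nat \<times> nat) set \<Rightarrow> nat \<Rightarrow> nat \<Rightarrow> nat" where
  "lpp a b S 0 j = b j"
| "lpp a b S (Suc i) 0 = a (Suc i)"
| "lpp a b S (Suc i) (Suc j) = max (lpp a b S i (Suc j)) (lpp a b S (Suc i) j + of_bool ((Suc i, Suc j) \<in> S))"

abbreviation ones :: "bool list \<Rightarrow> nat" where
  "ones xs \<equiv> sum_list (map of_bool xs)"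

lemma col_update_increments:
  assumes "length Js = length xs"
    and "\<And>j. j < length xs \<Longrightarrow> f (Suc j) = f j + of_bool (Js ! j)"
    and "\<And>j. j < length xs \<Longrightarrow> g (Suc j) = max (f (Suc j)) (g j + of_bool (xs ! j))"
    and "f 0 \<le> g 0" and "j \<le> length xs"
  shows "(g j :: nat) = g 0 + ones (take j (col_update (g 0 - f 0) Js xs))"
  using assms
proof (induction Js xs arbitrary: f g j rule: list_induct2)
  case (Cons J Js x xs)
  show ?case
  proof (cases j)
    case (Suc j')
    have f1: "f 1 = f 0 + of_bool J" and g1: "g 1 = max (f 1) (g 0 + of_bool x)"
      using Cons.prems(1)[of 0] Cons.prems(2)[of 0] by auto
    have "g (Suc j') = g (Suc 0) + ones (take j' (col_update (g (Suc 0) - f (Suc 0)) Js xs))"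
    proof (rule Cons.IH)
      fix i assume "i < length xs"
      thus "f (Suc (Suc i)) = f (Suc i) + of_bool (Js ! i)"
        using Cons.prems(1)[of "Suc i"] by simp
    next
      fix i assume "i < length xs"
      thus "g (Suc (Suc i)) = max (f (Suc (Suc i))) (g (Suc i) + of_bool (xs ! i))"
        using Cons.prems(2)[of "Suc i"] by simp
    qed (use Cons.prems Suc g1 in auto)
    moreover have "cell (g 0 - f 0) J x = (g (Suc 0) - f (Suc 0), g (Suc 0) \<noteq> g 0)"
      and "g (Suc 0) = g 0 + of_bool (g (Suc 0) \<noteq> g 0)"
      using f1 g1 Cons.prems(3) by (auto simp: cell_def max_def of_bool_def split: if_splits)
    ultimately show ?thesis by (simp add: Suc)
  qed simp
qed simp

lemma lpp_bottom: "a 0 = b 0 \<Longrightarrow> lpp a b S i 0 = a i"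
  by (cases i) auto

text \<open>
The vertical increments of \<open>lpp\<close> in column \<open>i\<close> are the outcome of sweeping the first \<open>i\<close> columns. This turns
Burke's property into a statement about the corner value.
\<close>

lemma lpp_sweep:
  fixes S :: "(nat \<times> nat) set"
  assumes "length Is = m" "length Js = n" and "i \<le> m" "j \<le> n"
  defines "F \<equiv> \<lambda>i. sweep (take i Is) Js (columns S i n)"
  shows "length (F i) = n \<and>
    lpp (\<lambda>i. sum_list (take i Is)) (\<lambda>j. ones (take j Js)) S i j = sum_list (take i Is) + ones (take j (F i))"
  using assms(3,4)
proof (induction i arbitrary: j)
  case 0
  thus ?case using assms(2) by (simp add: F_def columns_def)
next
  case (Suc i)
  let ?a = "\<lambda>i. sum_list (take i Is)" and ?b = "\<lambda>j. ones (take j Js)"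
  let ?f = "lpp ?a ?b S i" and ?g = "lpp ?a ?b S (Suc i)"
  have i: "i < length Is" using Suc.prems assms(1) by simp
  have len: "length (F i) = n" using Suc.IH[of 0] Suc.prems by simp
  have f: "?f j = ?a i + ones (take j (F i))" if "j \<le> n" for j
    using Suc.IH[of j] Suc.prems that by simp
  have a: "?a (Suc i) = ?a i + Is ! i"
    using i by (simp add: take_Suc_conv_app_nth)
  have g0: "?g 0 = ?a (Suc i)" and f0: "?f 0 = ?a i"
    using lpp_bottom[of ?a ?b S i] by simp_all
  have cols: "columns S (Suc i) n = columns S i n @ [column S n (Suc i)]"
    by (simp add: columns_def)
  have "length (take i Is) = length (columns S i n)"
    using i by (simp add: columns_def)
  hence F: "F (Suc i) = col_update (Is ! i) (F i) (column S n (Suc i))"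
    using i by (simp add: F_def cols take_Suc_conv_app_nth sweep_snoc)
  have lc: "length (column S n (Suc i)) = n" by (simp add: column_def)
  have "?g j = ?g 0 + ones (take j (col_update (?g 0 - ?f 0) (F i) (column S n (Suc i))))"
  proof (rule col_update_increments)
    fix j assume "j < length (column S n (Suc i))"
    hence j: "j < n" by (simp add: lc)
    thus "?f (Suc j) = ?f j + of_bool (F i ! j)"
      by (simp add: f len take_Suc_conv_app_nth)
    show "?g (Suc j) = max (?f (Suc j)) (?g j + of_bool (column S n (Suc i) ! j))"
      using j by (simp add: column_def)
  qed (use Suc.prems len lc g0 f0 a in auto)
  moreover have "?g 0 - ?f 0 = Is ! i" by (simp add: g0 f0 a)
  ultimately have "?g j = ?a (Suc i) + ones (take j (F (Suc i)))"
    by (simp add: F g0)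
  thus ?case using length_col_update[of "F i" "column S n (Suc i)"] len lc by (simp add: F)
qed

text \<open>
For gap \<open>(0, 1)\<close> the last point is either the corner itself, or it avoids the last column or the last row.
\<close>

lemma reach_Suc_Suc:
  "reach (0, 1) S (Suc k) (Suc i) (Suc j) \<longleftrightarrow>
     reach (0, 1) S (Suc k) i (Suc j) \<or> reach (0, 1) S (Suc k) (Suc i) j \<or>
     (Suc i, Suc j) \<in> S \<and> reach (0, 1) S k (Suc i) j"
    (is "?l \<longleftrightarrow> ?r")
proof
  assume ?l
  thus ?r by (auto simp: le_Suc_eq)
next
  assume ?r
  thus ?l
  proof (elim disjE)
    assume "(Suc i, Suc j) \<in> S \<and> reach (0, 1) S k (Suc i) j"
    thus ?l unfolding reach.simps by (intro exI[of _ "Suc i"] exI[of _ "Suc j"]) simp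
  qed (auto elim: reach_mono simp del: reach.simps)
qed

abbreviation "chain01 \<equiv> longest_chain (0, 1)"

lemma le_chain01_iff: "k \<le> chain01 S i j \<longleftrightarrow> reach (0, 1) S k i j"
  by (rule le_longest_chain_iff_reach) simp

lemma chain01_0 [simp]: "chain01 S 0 j = 0" "chain01 S i 0 = 0"
proof -
  have "\<not> Suc 0 \<le> chain01 S 0 j" "\<not> Suc 0 \<le> chain01 S i 0"
    unfolding le_chain01_iff by auto
  thus "chain01 S 0 j = 0" "chain01 S i 0 = 0" by auto
qed

lemma chain01_Suc_Suc:
  "chain01 S (Suc i) (Suc j) = max (chain01 S i (Suc j)) (chain01 S (Suc i) j + of_bool ((Suc i, Suc j) \<in> S))"
    (is "?l = ?r")
proof -
  have "k \<le> ?l \<longleftrightarrow> k \<le> ?r" for k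
  proof (cases k)
    case (Suc k')
    have "k \<le> ?r \<longleftrightarrow> k \<le> chain01 S i (Suc j) \<or> k \<le> chain01 S (Suc i) j \<or>
        (Suc i, Suc j) \<in> S \<and> k' \<le> chain01 S (Suc i) j"
      by (auto simp: Suc le_max_iff_disj)
    thus ?thesis
      unfolding Suc le_chain01_iff reach_Suc_Suc by blast
  qed simp
  thus ?thesis by (meson order_antisym order_refl)
qed

lemma chain01_le_lpp: "chain01 S i j \<le> lpp a b S i j"
proof (induction a b S i j rule: lpp.induct)
  case (3 a b S i j)
  show ?case unfolding chain01_Suc_Suc lpp.simps
    by (intro max.mono add_right_mono 3)
qed (simp_all only: chain01_0 le0)

lemma mem_recenter_iff: "(i, j) \<in> recenter s S \<longleftrightarrow> (i + fst s, j + snd s) \<in> S"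
  by (simp add: recenter_def)

text \<open>
The maximizing path leaves the boundary somewhere; from there on it is a chain of the model without
boundary. Sources up to column \<open>s\<close> may be followed by points in column \<open>s\<close> itself, since chains for the gap
\<open>(0, 1)\<close> increase weakly in the first coordinate; hence the shift by \<open>s - 1\<close>.
\<close>

lemma lpp_exit:
  shows "(\<exists>s\<le>i. lpp a b S i j \<le> a s + chain01 (recenter (s - 1, 0) S) (i - (s - 1)) j) \<or>
         (\<exists>s\<le>j. lpp a b S i j \<le> b s + chain01 (recenter (0, s) S) i (j - s))"
proof (induction a b S i j rule: lpp.induct)
  case (1 a b S j)
  show ?case by (intro disjI2 exI[of _ j]) simp
next
  case (2 a b S i)
  show ?case by (intro disjI1 exI[of _ "Suc i"]) simp
next
  case (3 a b S i j)
  let ?x = "of_bool ((Suc i, Suc j) \<in> S) :: nat"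
  let ?H = "\<lambda>s i j. chain01 (recenter (s - 1, 0) S) (i - (s - 1)) j"
  let ?V = "\<lambda>s i j. chain01 (recenter (0, s) S) i (j - s)"
  have h: "?H s i (Suc j) \<le> ?H s (Suc i) (Suc j)" for s
    by (rule longest_chain_mono) auto
  have h': "?H s (Suc i) j + ?x \<le> ?H s (Suc i) (Suc j)" if "s \<le> Suc i" for s
  proof -
    have "Suc i - (s - 1) = Suc (i - (s - 1))" "i - (s - 1) + (s - 1) = i" using that by auto
    thus ?thesis
      using chain01_Suc_Suc[of "recenter (s - 1, 0) S" "i - (s - 1)" j]
      by (simp add: mem_recenter_iff)
  qed
  have v: "?V s i (Suc j) \<le> ?V s (Suc i) (Suc j)" for s
    by (rule longest_chain_mono) auto
  have v': "?V s (Suc i) j + ?x \<le> ?V s (Suc i) (Suc j)" if "s \<le> j" for s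
    using that chain01_Suc_Suc[of "recenter (0, s) S" i "j - s"] by (simp add: Suc_diff_le mem_recenter_iff)
  show ?case
  proof (cases "lpp a b S i (Suc j) \<ge> lpp a b S (Suc i) j + ?x")
    case True
    hence eq: "lpp a b S (Suc i) (Suc j) = lpp a b S i (Suc j)" by simp
    from 3(1) show ?thesis
    proof (elim disjE exE conjE)
      fix s assume "s \<le> i" "lpp a b S i (Suc j) \<le> a s + ?H s i (Suc j)"
      thus ?thesis unfolding eq using h[of s] by (intro disjI1 exI[of _ s]) linarith
    next
      fix s assume "s \<le> Suc j" "lpp a b S i (Suc j) \<le> b s + ?V s i (Suc j)"
      thus ?thesis unfolding eq using v[of s] by (intro disjI2 exI[of _ s]) linarith
    qed
  next
    case False
    hence eq: "lpp a b S (Suc i) (Suc j) = lpp a b S (Suc i) j + ?x" by simp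
    from 3(2) show ?thesis
    proof (elim disjE exE conjE)
      fix s assume "s \<le> Suc i" "lpp a b S (Suc i) j \<le> a s + ?H s (Suc i) j"
      thus ?thesis unfolding eq using h'[of s] by (intro disjI1 exI[of _ s]) linarith
    next
      fix s assume "s \<le> j" "lpp a b S (Suc i) j \<le> b s + ?V s (Suc i) j"
      thus ?thesis unfolding eq using v'[of s] by (intro disjI2 exI[of _ s]) linarith
    qed
  qed
qed

section \<open>The upper tail for gap (0, 1)\<close>

lemma sum_list_map_real: "sum_list (map (\<lambda>x. a * real (f x)) xs) = a * real (sum_list (map f xs))"
  by (induction xs) (auto simp: algebra_simps)

lemma integer_sum_deviation:
  fixes f :: "'a \<Rightarrow> nat"
  assumes conc: "\<And>\<sigma>. exp_conc \<mu> (\<lambda>x. \<sigma> * real (f x)) (\<sigma> * a)" and "\<epsilon> > 0" "K > 0"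
  obtains c where "c > 0"
    "\<And>k N. real k \<le> K * real N \<Longrightarrow>
       measure_pmf.prob (replicate_pmf k \<mu>) {xs. real k * a + \<epsilon> * real N \<le> real (sum_list (map f xs))} \<le> exp (- c * real N)"
    "\<And>k N. real k \<le> K * real N \<Longrightarrow>
       measure_pmf.prob (replicate_pmf k \<mu>) {xs. real (sum_list (map f xs)) \<le> real k * a - \<epsilon> * real N} \<le> exp (- c * real N)"
proof -
  obtain c1 where c1: "c1 > 0" "\<And>k N. real k \<le> K * real N \<Longrightarrow>
     measure_pmf.prob (replicate_pmf k \<mu>) {xs. real k * (1 * a) + \<epsilon> * real N \<le> sum_list (map (\<lambda>x. 1 * real (f x)) xs)} \<le> exp (- c1 * real N)"
    by (rule exp_conc_deviation[OF conc[of 1] assms(2,3)]) blast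
  obtain c2 where c2: "c2 > 0" "\<And>k N. real k \<le> K * real N \<Longrightarrow>
     measure_pmf.prob (replicate_pmf k \<mu>) {xs. real k * (-1 * a) + \<epsilon> * real N \<le> sum_list (map (\<lambda>x. -1 * real (f x)) xs)} \<le> exp (- c2 * real N)"
    by (rule exp_conc_deviation[OF conc[of "-1"] assms(2,3)]) blast
  show ?thesis
  proof (rule that[of "min c1 c2"])
    show "min c1 c2 > 0" using c1 c2 by simp
    fix k N :: nat assume k: "real k \<le> K * real N"
    have "exp (- c1 * real N) \<le> exp (- min c1 c2 * real N)" "exp (- c2 * real N) \<le> exp (- min c1 c2 * real N)"
      by (auto intro!: mult_right_mono)
    moreover have "{xs. real (sum_list (map f xs)) \<le> real k * a - \<epsilon> * real N} =
        {xs. real k * (-1 * a) + \<epsilon> * real N \<le> sum_list (map (\<lambda>x. -1 * real (f x)) xs)}"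
      unfolding sum_list_map_real by auto
    moreover have "{xs. real k * a + \<epsilon> * real N \<le> real (sum_list (map f xs))} =
        {xs. real k * (1 * a) + \<epsilon> * real N \<le> sum_list (map (\<lambda>x. 1 * real (f x)) xs)}"
      unfolding sum_list_map_real by auto
    ultimately show
      "measure_pmf.prob (replicate_pmf k \<mu>) {xs. real k * a + \<epsilon> * real N \<le> real (sum_list (map f xs))} \<le> exp (- min c1 c2 * real N)"
      "measure_pmf.prob (replicate_pmf k \<mu>) {xs. real (sum_list (map f xs)) \<le> real k * a - \<epsilon> * real N} \<le> exp (- min c1 c2 * real N)"
      using c1(2)[OF k] c2(2)[OF k] by (metis order_trans)+
  qed
qed

lemma bern_density_bounds:
  assumes "0 < p" "p < 1" "0 < r"
  shows "0 < bern_density p r" "bern_density p r < 1"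
proof -
  show "0 < bern_density p r"
    unfolding bern_density_def using assms by (intro divide_pos_pos mult_pos_pos add_pos_pos) auto
  show "bern_density p r < 1"
    unfolding bern_density_def using assms by (simp add: divide_less_eq_1 distrib_left)
qed

lemma geo_sum_deviation:
  assumes "r > 0" "\<epsilon> > 0" "K > 0"
  obtains c where "c > 0"
    "\<And>k N. real k \<le> K * real N \<Longrightarrow>
       measure_pmf.prob (replicate_pmf k (geo_pmf r)) {xs. real k * r + \<epsilon> * real N \<le> real (sum_list xs)} \<le> exp (- c * real N)"
    "\<And>k N. real k \<le> K * real N \<Longrightarrow>
       measure_pmf.prob (replicate_pmf k (geo_pmf r)) {xs. real (sum_list xs) \<le> real k * r - \<epsilon> * real N} \<le> exp (- c * real N)"
  using integer_sum_deviation[of "geo_pmf r" "\<lambda>x. x" r \<epsilon> K] exp_conc_geo[OF assms(1)] assms(2,3)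
  by auto

lemma bernoulli_sum_deviation:
  assumes "0 \<le> q" "q \<le> 1" "\<epsilon> > 0" "K > 0"
  obtains c where "c > 0"
    "\<And>k N. real k \<le> K * real N \<Longrightarrow>
       measure_pmf.prob (replicate_pmf k (bernoulli_pmf q)) {xs. real k * q + \<epsilon> * real N \<le> real (ones xs)} \<le> exp (- c * real N)"
    "\<And>k N. real k \<le> K * real N \<Longrightarrow>
       measure_pmf.prob (replicate_pmf k (bernoulli_pmf q)) {xs. real (ones xs) \<le> real k * q - \<epsilon> * real N} \<le> exp (- c * real N)"
  using integer_sum_deviation[of "bernoulli_pmf q" of_bool q \<epsilon> K] exp_conc_bernoulli[OF assms(1,2)] assms(3,4)
  by auto

definition stationary_pmf :: "real \<Rightarrow> real \<Rightarrow> nat \<Rightarrow> nat \<Rightarrow> (nat list \<times> bool list \<times> (nat \<times> nat) set) pmf" where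
  "stationary_pmf p r m n = pair_pmf (replicate_pmf m (geo_pmf r))
     (pair_pmf (replicate_pmf n (bernoulli_pmf (bern_density p r))) (bern_set p ({1..m} \<times> {1..n})))"

definition right_increments :: "nat \<Rightarrow> nat \<Rightarrow> (nat list \<times> bool list \<times> (nat \<times> nat) set) \<Rightarrow> bool list" where
  "right_increments m n = (\<lambda>(Is, Js, c). sweep Is Js (columns c m n))"

lemma map_pmf_take_replicate:
  assumes "s \<le> m"
  shows "map_pmf (take s) (replicate_pmf m \<mu>) = replicate_pmf s \<mu>"
proof -
  have "map_pmf (take s) (replicate_pmf (s + (m - s)) \<mu>) =
     do {xs \<leftarrow> replicate_pmf s \<mu>; ys \<leftarrow> replicate_pmf (m - s) \<mu>; return_pmf (take s (xs @ ys))}"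
    by (simp add: replicate_pmf_distrib map_bind_pmf)
  also have "\<dots> = do {xs \<leftarrow> replicate_pmf s \<mu>; ys \<leftarrow> replicate_pmf (m - s) \<mu>; return_pmf xs}"
    by (intro bind_pmf_cong refl) (auto simp: set_replicate_pmf)
  also have "\<dots> = replicate_pmf s \<mu>" by (simp add: bind_return_pmf')
  finally show ?thesis using assms by simp
qed

lemma prob_map_pmf: "measure_pmf.prob (map_pmf f \<mu>) {x. P x} = measure_pmf.prob \<mu> {x. P (f x)}"
  by (simp add: vimage_def)

lemma stationary_pmf_bottom:
  assumes "s \<le> m"
  shows "measure_pmf.prob (stationary_pmf p r m n) {z. P (take s (fst z))} = measure_pmf.prob (replicate_pmf s (geo_pmf r)) {xs. P xs}"
proof -
  have "map_pmf (\<lambda>z. take s (fst z)) (stationary_pmf p r m n) = replicate_pmf s (geo_pmf r)"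
    unfolding stationary_pmf_def map_pmf_comp[symmetric, of "take s" fst] map_fst_pair_pmf
    by (rule map_pmf_take_replicate[OF assms])
  thus ?thesis by (metis prob_map_pmf)
qed

lemma stationary_pmf_left:
  assumes "s \<le> n"
  shows "measure_pmf.prob (stationary_pmf p r m n) {z. P (take s (fst (snd z)))} =
         measure_pmf.prob (replicate_pmf s (bernoulli_pmf (bern_density p r))) {xs. P xs}"
proof -
  have "map_pmf (\<lambda>z. take s (fst (snd z))) (stationary_pmf p r m n) = map_pmf (take s) (map_pmf fst (map_pmf snd (stationary_pmf p r m n)))"
    by (simp add: map_pmf_comp)
  also have "\<dots> = replicate_pmf s (bernoulli_pmf (bern_density p r))"
    unfolding stationary_pmf_def map_fst_pair_pmf map_snd_pair_pmf by (rule map_pmf_take_replicate[OF assms])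
  finally show ?thesis by (metis prob_map_pmf)
qed

lemma stationary_pmf_field:
  "measure_pmf.prob (stationary_pmf p r m n) {z. P (snd (snd z))} = measure_pmf.prob (bern_set p ({1..m} \<times> {1..n})) {c. P c}"
proof -
  have "map_pmf (\<lambda>z. snd (snd z)) (stationary_pmf p r m n) = map_pmf snd (map_pmf snd (stationary_pmf p r m n))"
    by (simp add: map_pmf_comp)
  also have "\<dots> = bern_set p ({1..m} \<times> {1..n})"
    unfolding stationary_pmf_def map_snd_pair_pmf ..
  finally show ?thesis by (metis prob_map_pmf)
qed

text \<open>
Burke's property, column by column: the vertical increments at the right side of the box are again i.i.d.
\<close>

lemma stationary_pmf_right:
  assumes "0 < p" "p < 1" "0 < r"
  shows "measure_pmf.prob (stationary_pmf p r m n) {z. P (right_increments m n z)} =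
         measure_pmf.prob (replicate_pmf n (bernoulli_pmf (bern_density p r))) {xs. P xs}"
proof -
  have "map_pmf (right_increments m n) (stationary_pmf p r m n) =
     do {Is \<leftarrow> replicate_pmf m (geo_pmf r); Js \<leftarrow> replicate_pmf n (bernoulli_pmf (bern_density p r));
         Xs \<leftarrow> map_pmf (\<lambda>c. columns c m n) (bern_set p ({1..m} \<times> {1..n})); return_pmf (sweep Is Js Xs)}"
    by (simp add: stationary_pmf_def right_increments_def pair_pmf_def map_bind_pmf bind_map_pmf bind_assoc_pmf bind_return_pmf)
  also have "\<dots> = replicate_pmf n (bernoulli_pmf (bern_density p r))"
    unfolding columns_bern_set by (rule burke_sweep[OF assms])
  finally show ?thesis by (metis prob_map_pmf)
qed

lemma stationary_pmf_support:
  assumes "(Is, Js, c) \<in> set_pmf (stationary_pmf p r m n)"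
  shows "length Is = m" "length Js = n"
  using assms by (auto simp: stationary_pmf_def set_replicate_pmf)

definition stat_lpp :: "nat list \<Rightarrow> bool list \<Rightarrow> (nat \<times> nat) set \<Rightarrow> nat \<Rightarrow> nat \<Rightarrow> nat" where
  "stat_lpp Is Js = lpp (\<lambda>i. sum_list (take i Is)) (\<lambda>j. ones (take j Js))"

lemma stat_lpp_eq:
  assumes "z \<in> set_pmf (stationary_pmf p r m n)"
  shows "stat_lpp (fst z) (fst (snd z)) (snd (snd z)) m n = sum_list (fst z) + ones (right_increments m n z)"
proof -
  obtain Is Js c where z: "z = (Is, Js, c)" by (cases z)
  have len: "length Is = m" "length Js = n" using stationary_pmf_support assms unfolding z by auto
  have "length (right_increments m n z) = n"
    using lpp_sweep[OF len order_refl order_refl, of c] len by (simp add: z right_increments_def)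
  thus ?thesis
    using lpp_sweep[OF len order_refl order_refl, of c] len by (simp add: z right_increments_def stat_lpp_def)
qed

lemma prob_disj_le:
  "measure_pmf.prob \<mu> {x. P x \<or> Q x} \<le> measure_pmf.prob \<mu> {x. P x} + measure_pmf.prob \<mu> {x. Q x}"
  unfolding Collect_disj_eq by (rule measure_Un_le) auto

lemma prob_ex_le:
  fixes b :: real
  assumes "\<And>s. s \<le> m \<Longrightarrow> measure_pmf.prob \<mu> {x. P s x} \<le> b"
  shows "measure_pmf.prob \<mu> {x. \<exists>s\<le>(m::nat). P s x} \<le> (real m + 1) * b"
proof -
  have "{x. \<exists>s\<le>m. P s x} = (\<Union>s\<in>{..m}. {x. P s x})" by auto
  also have "measure_pmf.prob \<mu> \<dots> \<le> (\<Sum>s\<in>{..m}. measure_pmf.prob \<mu> {x. P s x})"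
    by (rule measure_pmf.finite_measure_subadditive_finite) auto
  also have "\<dots> \<le> (\<Sum>s\<in>{..m}. b)" by (rule sum_mono) (use assms in auto)
  finally show ?thesis by (simp add: algebra_simps)
qed

lemma prob_mono_supp:
  assumes "\<And>x. x \<in> set_pmf \<mu> \<Longrightarrow> P x \<Longrightarrow> Q x"
  shows "measure_pmf.prob \<mu> {x. P x} \<le> measure_pmf.prob \<mu> {x. Q x}"
  by (rule measure_pmf.finite_measure_mono_AE) (use assms in \<open>auto simp: AE_measure_pmf_iff\<close>)

text \<open>
Sources only help, so the longest chain is at most the stationary corner value, which is a geometric sum along the
bottom plus a Bernoulli sum along the right side.
\<close>

lemma chain01_upper_tail:
  assumes p: "0 < p" "p < 1" and r: "r > 0" and "\<epsilon> > 0" "K > 0"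
  obtains c where "c > 0"
    "\<And>m n N. real m \<le> K * real N \<Longrightarrow> real n \<le> K * real N \<Longrightarrow>
       measure_pmf.prob (bern_set p ({1..m} \<times> {1..n}))
         {S. real m * r + real n * bern_density p r + \<epsilon> * real N \<le> real (chain01 S m n)} \<le> 2 * exp (- c * real N)"
proof -
  let ?q = "bern_density p r"
  have e: "\<epsilon> / 2 > 0" using assms by simp
  obtain c1 where c1: "c1 > 0" "\<And>k N. real k \<le> K * real N \<Longrightarrow>
       measure_pmf.prob (replicate_pmf k (geo_pmf r)) {xs. real k * r + \<epsilon>/2 * real N \<le> real (sum_list xs)} \<le> exp (- c1 * real N)"
    using geo_sum_deviation[OF r e \<open>K > 0\<close>] by metis
  obtain c2 where c2: "c2 > 0" "\<And>k N. real k \<le> K * real N \<Longrightarrow>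
       measure_pmf.prob (replicate_pmf k (bernoulli_pmf ?q)) {xs. real k * ?q + \<epsilon>/2 * real N \<le> real (ones xs)} \<le> exp (- c2 * real N)"
    using bernoulli_sum_deviation[OF _ _ e \<open>K > 0\<close>] bern_density_bounds[OF p r] by (metis less_imp_le)
  show ?thesis
  proof (rule that[of "min c1 c2"])
    show "min c1 c2 > 0" using c1 c2 by simp
    fix m n N :: nat assume mn: "real m \<le> K * real N" "real n \<le> K * real N"
    let ?A = "\<lambda>xs. real m * r + \<epsilon>/2 * real N \<le> real (sum_list xs)"
    let ?B = "\<lambda>xs. real n * ?q + \<epsilon>/2 * real N \<le> real (ones xs)"
    have "measure_pmf.prob (bern_set p ({1..m} \<times> {1..n}))
         {S. real m * r + real n * ?q + \<epsilon> * real N \<le> real (chain01 S m n)} =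
      measure_pmf.prob (stationary_pmf p r m n)
         {z. real m * r + real n * ?q + \<epsilon> * real N \<le> real (chain01 (snd (snd z)) m n)}"
      by (rule stationary_pmf_field[of p r m n "\<lambda>S. real m * r + real n * ?q + \<epsilon> * real N \<le> real (chain01 S m n)", symmetric])
    also have "\<dots> \<le> measure_pmf.prob (stationary_pmf p r m n) {z. ?A (take m (fst z)) \<or> ?B (right_increments m n z)}"
    proof (rule prob_mono_supp)
      fix z assume z: "z \<in> set_pmf (stationary_pmf p r m n)"
        and le: "real m * r + real n * ?q + \<epsilon> * real N \<le> real (chain01 (snd (snd z)) m n)"
      have "chain01 (snd (snd z)) m n \<le> sum_list (fst z) + ones (right_increments m n z)"
        unfolding stat_lpp_eq[OF z, symmetric] stat_lpp_def by (rule chain01_le_lpp)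
      moreover have "take m (fst z) = fst z" using z stationary_pmf_support(1)[of "fst z" "fst (snd z)" "snd (snd z)"] by simp
      ultimately show "?A (take m (fst z)) \<or> ?B (right_increments m n z)"
        using le by (simp add: field_simps) linarith
    qed
    also have "\<dots> \<le> exp (- c1 * real N) + exp (- c2 * real N)"
      using c1(2)[OF mn(1)] c2(2)[OF mn(2)] stationary_pmf_bottom[OF order_refl, of p r m n ?A] stationary_pmf_right[OF p r, of m n ?B]
      by (intro order_trans[OF prob_disj_le] add_mono) simp_all
    also have "\<dots> \<le> exp (- min c1 c2 * real N) + exp (- min c1 c2 * real N)"
      by (intro add_mono) (auto intro!: mult_right_mono)
    finally show "measure_pmf.prob (bern_set p ({1..m} \<times> {1..n}))
         {S. real m * r + real n * ?q + \<epsilon> * real N \<le> real (chain01 S m n)} \<le> 2 * exp (- min c1 c2 * real N)"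
      by simp
  qed
qed

text \<open>
The value of \<open>w\<close> makes \<open>r\<close> a critical point of \<open>\<rho> \<mapsto> u \<rho> + w q(\<rho>)\<close>, so moving \<open>r\<close> to \<open>\<rho>\<close> costs
only a quadratic term.
\<close>

lemma stationary_slope_gap:
  assumes p: "0 < p" "p < 1" and r: "r > 0" "\<rho> > 0"
    and w: "w = u * (p + r)\<^sup>2 / (p * (1 - p))"
  shows "u * \<rho> + w * bern_density p \<rho> - (u * r + w * bern_density p r) = u * (\<rho> - r)\<^sup>2 / (p + \<rho>)"
    and "bern_density p \<rho> - bern_density p r = p * (1 - p) * (r - \<rho>) / ((p + r) * (p + \<rho>))"
proof -
  have nz: "p + r \<noteq> 0" "p + \<rho> \<noteq> 0" "p \<noteq> 0" "1 - p \<noteq> 0" using p r by auto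
  show d: "bern_density p \<rho> - bern_density p r = p * (1 - p) * (r - \<rho>) / ((p + r) * (p + \<rho>))"
    unfolding bern_density_def using nz by (simp add: divide_simps) (simp add: algebra_simps)
  have "w * (bern_density p \<rho> - bern_density p r) = u * (p + r) * (r - \<rho>) / (p + \<rho>)"
    unfolding d w using nz by (simp add: power2_eq_square)
  moreover have "u * (p + r) * (r - \<rho>) / (p + \<rho>) = u * (\<rho> - r)\<^sup>2 / (p + \<rho>) - u * (\<rho> - r)"
    using nz by (simp add: field_simps power2_eq_square)
  ultimately show "u * \<rho> + w * bern_density p \<rho> - (u * r + w * bern_density p r) = u * (\<rho> - r)\<^sup>2 / (p + \<rho>)"
    by (simp add: algebra_simps)
qed

text \<open>
A path that follows the bottom side up to \<open>\<sigma>\<close> collects \<open>\<sigma> r\<close> there and, by the upper bound with parameter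
\<open>r1 = r + \<eta>\<close>, at most \<open>(u - \<sigma>) r1 + w q(r1)\<close> afterwards. Compared with the stationary value this gains a term of order \<open>\<eta>\<^sup>2\<close>
and loses \<open>\<sigma> \<eta>\<close>, a net loss for small \<open>\<eta>\<close>. On the left side the same works with \<open>r2 = r - \<eta>\<close>, since the
density decreases in \<open>r\<close>.
\<close>

lemma late_exit_loses:
  assumes p: "0 < p" "p < 1" and r: "r > 0" and u: "u > 0"
    and w: "w = u * (p + r)\<^sup>2 / (p * (1 - p))" and \<delta>: "\<delta> > 0"
  obtains r1 r2 e where "r1 > 0" "r2 > 0" "e > 0"
    "\<And>\<sigma>. \<delta> \<le> \<sigma> \<Longrightarrow> \<sigma> * r + (u - \<sigma>) * r1 + w * bern_density p r1 \<le> u * r + w * bern_density p r - e"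
    "\<And>\<sigma>. \<delta> \<le> \<sigma> \<Longrightarrow> \<sigma> * bern_density p r + u * r2 + (w - \<sigma>) * bern_density p r2 \<le> u * r + w * bern_density p r - e"
proof -
  define \<kappa> where "\<kappa> = p * (1 - p) / (p + r)"
  have \<kappa>: "\<kappa> > 0" using p r by (simp add: \<kappa>_def)
  \<comment> \<open>The first two bounds make the quadratic gain at most half of the linear loss on the bottom
     and on the left side, respectively; the third keeps \<open>r2\<close> positive.\<close>
  define \<eta> where "\<eta> = min (p * \<delta> / (2 * u)) (min (\<delta> * \<kappa> / (2 * u)) (r / 2))"
  have \<eta>: "\<eta> > 0" "u * \<eta> \<le> p * \<delta> / 2" "u * \<eta> \<le> \<delta> * \<kappa> / 2" "\<eta> \<le> r / 2"
  proof -
    show "\<eta> > 0" using p r u \<delta> \<kappa> by (simp add: \<eta>_def)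
    have "\<eta> \<le> p * \<delta> / (2 * u)" "\<eta> \<le> \<delta> * \<kappa> / (2 * u)" by (simp_all add: \<eta>_def)
    thus "u * \<eta> \<le> p * \<delta> / 2" "u * \<eta> \<le> \<delta> * \<kappa> / 2" using u by (simp_all add: field_simps)
    show "\<eta> \<le> r / 2" by (simp add: \<eta>_def)
  qed
  define r1 where "r1 = r + \<eta>"
  define r2 where "r2 = r - \<eta>"
  define e where "e = min (\<delta> * \<eta> / 2) (\<delta> / 2 * (\<kappa> * \<eta> / (p + r)))"
  have r1: "r1 > 0" and r2: "r2 > 0" using r \<eta> by (auto simp: r1_def r2_def)
  show ?thesis
  proof (rule that[OF r1 r2])
    show "e > 0" using \<delta> \<eta> \<kappa> p r by (simp add: e_def)
  next
    fix \<sigma> assume \<sigma>: "\<delta> \<le> \<sigma>"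
    have "u * \<eta>\<^sup>2 / (p + r1) \<le> u * \<eta>\<^sup>2 / p"
      using p r1 u by (intro divide_left_mono) auto
    also have "\<dots> = (u * \<eta>) * \<eta> / p" by (simp add: power2_eq_square)
    also have "\<dots> \<le> (p * \<delta> / 2) * \<eta> / p" using \<eta> p by (intro divide_right_mono mult_right_mono) auto
    finally have "u * \<eta>\<^sup>2 / (p + r1) \<le> \<delta> * \<eta> / 2" using p by simp
    moreover have "\<delta> * \<eta> \<le> \<sigma> * \<eta>" using \<sigma> \<eta> by simp
    moreover have "e \<le> \<delta> * \<eta> / 2" unfolding e_def by (rule min.cobounded1)
    moreover have "u * r1 + w * bern_density p r1 - (u * r + w * bern_density p r) = u * \<eta>\<^sup>2 / (p + r1)"
      using stationary_slope_gap(1)[OF p r r1 w] by (simp add: r1_def)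
    moreover have "\<sigma> * r + (u - \<sigma>) * r1 = u * r1 - \<sigma> * \<eta>" by (simp add: r1_def algebra_simps)
    ultimately show "\<sigma> * r + (u - \<sigma>) * r1 + w * bern_density p r1 \<le> u * r + w * bern_density p r - e" by linarith
  next
    fix \<sigma> assume \<sigma>: "\<delta> \<le> \<sigma>"
    define x where "x = \<kappa> * \<eta> / (p + r2)"
    have d: "bern_density p r2 - bern_density p r = x"
      using stationary_slope_gap(2)[OF p r r2 w] by (simp add: r2_def \<kappa>_def x_def)
    have x: "x > 0" using \<kappa> \<eta> p r2 by (simp add: x_def)
    have "\<kappa> * \<eta> / (p + r) \<le> x"
      unfolding x_def using \<kappa> \<eta> p r2 by (intro divide_left_mono) (auto simp: r2_def)
    hence "\<delta> / 2 * (\<kappa> * \<eta> / (p + r)) \<le> \<delta> / 2 * x"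
      using \<delta> by (intro mult_left_mono) auto
    moreover have "e \<le> \<delta> / 2 * (\<kappa> * \<eta> / (p + r))" unfolding e_def by (rule min.cobounded2)
    ultimately have e: "e \<le> \<delta> / 2 * x" by linarith
    have "u * \<eta>\<^sup>2 / (p + r2) = (u * \<eta>) * \<eta> / (p + r2)" by (simp add: power2_eq_square)
    also have "\<dots> \<le> (\<delta> * \<kappa> / 2) * \<eta> / (p + r2)"
      using \<eta> p r2 by (intro divide_right_mono mult_right_mono) auto
    also have "\<dots> = \<delta> / 2 * x" by (simp add: x_def)
    finally have "u * \<eta>\<^sup>2 / (p + r2) \<le> \<delta> / 2 * x" .
    moreover have "u * r2 + w * bern_density p r2 - (u * r + w * bern_density p r) = u * \<eta>\<^sup>2 / (p + r2)"
      using stationary_slope_gap(1)[OF p r r2 w] by (simp add: r2_def)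
    moreover have "\<sigma> * bern_density p r + (w - \<sigma>) * bern_density p r2 = w * bern_density p r2 - \<sigma> * x"
      unfolding d[symmetric] by (simp add: algebra_simps)
    moreover have "\<delta> * x \<le> \<sigma> * x" using \<sigma> x by simp
    moreover have "\<delta> / 2 * x + \<delta> / 2 * x = \<delta> * x" by simp
    ultimately show "\<sigma> * bern_density p r + u * r2 + (w - \<sigma>) * bern_density p r2 \<le> u * r + w * bern_density p r - e"
      using e by linarith
  qed
qed

section \<open>The lower tail for gap (0, 1)\<close>

lemma reach_recenter:
  "reach (0, 1) (recenter (s, t) S) k i j \<Longrightarrow> reach (0, 1) S k (i + s) (j + t)"
proof (induction k arbitrary: i j)
  case (Suc k)
  then obtain x y where xy: "(x + s, y + t) \<in> S" "1 \<le> x" "x \<le> i" "1 \<le> y" "y \<le> j"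
    "reach (0, 1) (recenter (s, t) S) k x (y - 1)"
    by (auto simp: recenter_def)
  have "reach (0, 1) S k (x + s) (y + t - 1)"
    using Suc.IH[OF xy(6)] xy(4) by simp
  thus ?case
    unfolding reach.simps using xy by (intro exI[of _ "x + s"] exI[of _ "y + t"]) simp
qed simp

lemma chain01_recenter_le:
  assumes "s \<le> m" "t \<le> n"
  shows "chain01 (recenter (s, t) S) (m - s) (n - t) \<le> chain01 S m n"
proof -
  have "reach (0, 1) (recenter (s, t) S) (chain01 (recenter (s, t) S) (m - s) (n - t)) (m - s) (n - t)"
    by (simp only: le_chain01_iff[symmetric])
  from reach_recenter[OF this] show ?thesis
    using assms by (simp only: le_chain01_iff le_add_diff_inverse2)
qed

lemma prob_chain01_recenter:
  assumes "s \<le> m" "t \<le> n"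
  shows "measure_pmf.prob (bern_set p ({1..m} \<times> {1..n})) {S. P (chain01 (recenter (s, t) S) (m - s) (n - t))} =
         measure_pmf.prob (bern_set p ({1..m - s} \<times> {1..n - t})) {S. P (chain01 S (m - s) (n - t))}"
proof -
  let ?K = "{1..m - s} \<times> {1..n - t}"
  have "chain01 (recenter (s, t) S \<inter> ?K) (m - s) (n - t) = chain01 (recenter (s, t) S) (m - s) (n - t)" for S
    by (rule longest_chain_cong_box) auto
  moreover have "displace (s, t) ` ?K \<subseteq> {1..m} \<times> {1..n}"
    using assms by (auto simp: displace_def)
  ultimately show ?thesis
    using prob_bern_set_recenter[of "{1..m} \<times> {1..n}" "(s, t)" ?K p "\<lambda>S. P (chain01 S (m - s) (n - t))"]
    by simp
qed

lemma summable_linear_times_exp: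
  assumes "c > 0"
  shows "summable (\<lambda>n. (A + B * real n) * exp (- c * real n))"
proof (rule summable_comparison_test')
  show "summable (\<lambda>n. (\<bar>A\<bar> + \<bar>B\<bar> * (2 / c)) * exp (- c / 2) ^ n)"
    using assms by (intro summable_mult summable_geometric) auto
  fix n :: nat
  have ge: "1 \<le> exp (c / 2 * real n)" using assms by simp
  have "c / 2 * real n \<le> exp (c / 2 * real n)" using exp_ge_add_one_self[of "c / 2 * real n"] by linarith
  hence le: "real n \<le> 2 / c * exp (c / 2 * real n)" using assms by (simp add: field_simps)
  have "\<bar>A + B * real n\<bar> \<le> \<bar>A\<bar> + \<bar>B\<bar> * real n"
    by (rule order_trans[OF abs_triangle_ineq]) (simp add: abs_mult)
  also have "\<dots> \<le> \<bar>A\<bar> * exp (c / 2 * real n) + \<bar>B\<bar> * (2 / c * exp (c / 2 * real n))"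
    using ge le by (intro add_mono mult_left_mono) (auto simp: mult_le_cancel_left1)
  finally have "\<bar>A + B * real n\<bar> \<le> (\<bar>A\<bar> + \<bar>B\<bar> * (2 / c)) * exp (c / 2 * real n)"
    by (simp add: algebra_simps)
  hence "\<bar>A + B * real n\<bar> * exp (- c * real n) \<le> (\<bar>A\<bar> + \<bar>B\<bar> * (2 / c)) * exp (c / 2 * real n) * exp (- c * real n)"
    by (rule mult_right_mono) simp
  also have "\<dots> = (\<bar>A\<bar> + \<bar>B\<bar> * (2 / c)) * exp (- c / 2) ^ n"
    by (simp add: mult.assoc exp_add[symmetric] exp_of_nat_mult[symmetric] field_simps)
  finally show "norm ((A + B * real n) * exp (- c * real n)) \<le> (\<bar>A\<bar> + \<bar>B\<bar> * (2 / c)) * exp (- c / 2) ^ n"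
    by (simp add: abs_mult)
qed

text \<open>
The deterministic core of the lower bound: if all sums and all chains behind the exit point behave as they should,
late exits contradict the size of the stationary value, and an early exit collects little on the boundary.
\<close>

lemma early_exit:
  assumes p: "0 < p" "p < 1" and r: "r > 0" and u: "u > 0"
    and w: "w = u * (p + r)\<^sup>2 / (p * (1 - p))"
    and \<delta>: "\<delta> > 0" and e: "0 < e" "e \<le> e0 / 8"
    and late1: "\<And>\<sigma>. \<delta> \<le> \<sigma> \<Longrightarrow> \<sigma> * r + (u - \<sigma>) * r1 + w * bern_density p r1 \<le> u * r + w * bern_density p r - e0"
    and late2: "\<And>\<sigma>. \<delta> \<le> \<sigma> \<Longrightarrow> \<sigma> * bern_density p r + u * r2 + (w - \<sigma>) * bern_density p r2 \<le> u * r + w * bern_density p r - e0"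
    and r12: "r1 > 0" "r2 > 0"
    and N: "real N > 2 * (2 * r + 1) / e0"
    and m: "u * real N - 1 \<le> real m" "real m \<le> u * real N"
    and n: "w * real N - 1 \<le> real n" "real n \<le> w * real N"
    and G: "real m * r + real n * bern_density p r - 2 * e * real N < real (stat_lpp Is Js S m n)"
    and A3: "\<And>s. s \<le> m \<Longrightarrow> real (sum_list (take s Is)) < real s * r + e * real N"
    and A4: "\<And>s. s \<le> n \<Longrightarrow> real (ones (take s Js)) < real s * bern_density p r + e * real N"
    and A5: "\<And>s. s \<le> m \<Longrightarrow> real (chain01 (recenter (s, 0) S) (m - s) n) <
               real (m - s) * r1 + real n * bern_density p r1 + e * real N"
    and A6: "\<And>s. s \<le> n \<Longrightarrow> real (chain01 (recenter (0, s) S) m (n - s)) <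
               real m * r2 + real (n - s) * bern_density p r2 + e * real N"
  shows "(u * r + w * bern_density p r - (3 * e + \<delta> * (1 + r))) * real N - (2 * r + 1) < real (chain01 S m n)"
proof -
  let ?q = "bern_density p r"
  have q: "0 < ?q" "?q < 1" using bern_density_bounds[OF p r] by auto
  have q1: "0 < bern_density p r1" and q2: "0 < bern_density p r2" using bern_density_bounds[OF p] r12 by auto
  have e0: "e0 > 0" using e by linarith
  have Npos: "real N > 0"
  proof -
    have "0 \<le> 2 * (2 * r + 1) / e0" using e0 r by simp
    thus ?thesis using N by linarith
  qed
  have Ne0: "4 * r + 2 < e0 * real N" using N e0 by (simp add: divide_less_eq mult.commute)
  have eN: "8 * (e * real N) \<le> e0 * real N"
    using mult_right_mono[OF e(2), of "real N"] by simp
  have "real m * r + real n * ?q \<ge> (u * real N - 1) * r + (w * real N - 1) * ?q"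
    using m(1) n(1) r q by (intro add_mono mult_right_mono) auto
  also have "(u * real N - 1) * r + (w * real N - 1) * ?q = (u * r + w * ?q) * real N - r - ?q"
    by (simp add: algebra_simps)
  finally have main: "(u * r + w * ?q) * real N - r - 1 - 2 * (e * real N) < real (stat_lpp Is Js S m n)"
    using G q by simp
  have eNpos: "0 < e * real N" using e Npos by simp
  have \<delta>r: "\<delta> * r * real N \<ge> 0" "\<delta> * real N \<ge> 0" using \<delta> r Npos by auto
  from lpp_exit[of m "\<lambda>i. sum_list (take i Is)" "\<lambda>j. ones (take j Js)" S n] show ?thesis
    unfolding stat_lpp_def[symmetric]
  proof (elim disjE exE conjE)
    fix s assume s: "s \<le> m" and le: "stat_lpp Is Js S m n \<le> sum_list (take s Is) + chain01 (recenter (s - 1, 0) S) (m - (s - 1)) n"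
    define t where "t = s - 1"
    have t: "t \<le> m" "real s \<le> real t + 1" using s by (auto simp: t_def)
    have le': "real (stat_lpp Is Js S m n) \<le> real (sum_list (take s Is)) + real (chain01 (recenter (t, 0) S) (m - t) n)"
      using le unfolding t_def by (simp only: of_nat_add[symmetric] of_nat_le_iff)
    have a: "real (sum_list (take s Is)) < real s * r + e * real N" by (rule A3[OF s])
    have sr: "real s * r \<le> real t * r + r"
      using mult_right_mono[OF t(2), of r] r by (simp add: algebra_simps)
    have "real t < \<delta> * real N"
    proof (rule ccontr)
      assume "\<not> real t < \<delta> * real N"
      hence "\<delta> \<le> real t / real N" using Npos by (simp add: field_simps)
      from mult_right_mono[OF late1[OF this], of "real N"]
      have l: "real t * r + (u * real N - real t) * r1 + w * real N * bern_density p r1 \<le>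
          (u * r + w * ?q) * real N - e0 * real N"
        using Npos by (simp add: algebra_simps)
      have "real (m - t) * r1 + real n * bern_density p r1 \<le> (u * real N - real t) * r1 + w * real N * bern_density p r1"
        using m(2) n(2) r12 q1 t by (intro add_mono mult_right_mono) auto
      moreover have "real (chain01 (recenter (t, 0) S) (m - t) n) <
               real (m - t) * r1 + real n * bern_density p r1 + e * real N"
        by (rule A5[OF t(1)])
      ultimately have "real (chain01 (recenter (t, 0) S) (m - t) n) <
          (u * real N - real t) * r1 + w * real N * bern_density p r1 + e * real N" by linarith
      hence "real (stat_lpp Is Js S m n) < (u * r + w * ?q) * real N - e0 * real N + r + 2 * (e * real N)"
        using l le' a sr by linarith
      with main have "e0 * real N < 2 * r + 1 + 4 * (e * real N)" by linarith
      thus False using Ne0 eN by linarith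
    qed
    hence "real t * r \<le> \<delta> * real N * r" using r by (intro mult_right_mono) auto
    moreover have "chain01 (recenter (t, 0) S) (m - t) n \<le> chain01 S m n"
      using chain01_recenter_le[of t m 0 n S] t by simp
    ultimately have "(u * r + w * ?q) * real N - r - 1 - 2 * (e * real N) <
        \<delta> * real N * r + r + e * real N + real (chain01 S m n)"
      using le' a sr main by linarith
    thus ?thesis using \<delta>r by (simp add: algebra_simps)
  next
    fix s assume s: "s \<le> n" and le: "stat_lpp Is Js S m n \<le> ones (take s Js) + chain01 (recenter (0, s) S) m (n - s)"
    have a: "real (ones (take s Js)) < real s * ?q + e * real N" by (rule A4[OF s])
    have "real s < \<delta> * real N"
    proof (rule ccontr)
      assume "\<not> real s < \<delta> * real N"
      hence "\<delta> \<le> real s / real N" using Npos by (simp add: field_simps)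
      from mult_right_mono[OF late2[OF this], of "real N"]
      have l: "real s * ?q + u * real N * r2 + (w * real N - real s) * bern_density p r2 \<le>
          (u * r + w * ?q) * real N - e0 * real N"
        using Npos by (simp add: algebra_simps)
      have "real m * r2 + real (n - s) * bern_density p r2 \<le> u * real N * r2 + (w * real N - real s) * bern_density p r2"
        using m(2) n(2) r12 q2 s by (intro add_mono mult_right_mono) auto
      moreover have "real (chain01 (recenter (0, s) S) m (n - s)) <
               real m * r2 + real (n - s) * bern_density p r2 + e * real N"
        by (rule A6[OF s])
      ultimately show False using l le a main Ne0 eN r by linarith
    qed
    hence "real s * ?q \<le> \<delta> * real N * 1" using q by (intro mult_mono) auto
    moreover have "chain01 (recenter (0, s) S) m (n - s) \<le> chain01 S m n"
      using chain01_recenter_le[of 0 m s n S] s by simp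
    ultimately have "(u * r + w * ?q) * real N - r - 1 - 2 * (e * real N) <
        \<delta> * real N + e * real N + real (chain01 S m n)"
      using le a main by linarith
    thus ?thesis using \<delta>r r by (simp add: algebra_simps)
  qed
qed

text \<open>
The stated \<open>w\<close> ties the direction of the box to \<open>r\<close>. The bad events
\<open>A1\<close> to \<open>A6\<close> negate the hypotheses of \<open>early_exit\<close>; there are linearly many of them, each exponentially unlikely.
\<close>

lemma chain01_lower_tail:
  assumes p: "0 < p" "p < 1" and r: "r > 0" and u: "u > 0"
    and w: "w = u * (p + r)\<^sup>2 / (p * (1 - p))" and \<epsilon>: "\<epsilon> > 0"
  defines "m \<equiv> \<lambda>N. nat \<lfloor>u * real N\<rfloor>" and "n \<equiv> \<lambda>N. nat \<lfloor>w * real N\<rfloor>"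
  shows "summable (\<lambda>N. measure_pmf.prob (bern_set p ({1..m N} \<times> {1..n N}))
           {S. real (chain01 S (m N) (n N)) \<le> (u * r + w * bern_density p r - \<epsilon>) * real N})"
proof -
  let ?q = "bern_density p r"
  have w0: "w > 0" using p r u by (simp add: w)
  \<comment> \<open>Up to a constant, the mean collected on the boundary before an early exit is at most \<open>\<delta> (1 + r) N = \<epsilon> N / 4\<close>.\<close>
  define \<delta> where "\<delta> = \<epsilon> / (4 * (1 + r))"
  have \<delta>: "\<delta> > 0" "\<delta> * (1 + r) = \<epsilon> / 4" using \<epsilon> r by (auto simp: \<delta>_def field_simps)
  obtain r1 r2 e0 where r12: "r1 > 0" "r2 > 0" and e0: "e0 > 0"
    and late1: "\<And>\<sigma>. \<delta> \<le> \<sigma> \<Longrightarrow> \<sigma> * r + (u - \<sigma>) * r1 + w * bern_density p r1 \<le> u * r + w * bern_density p r - e0"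
    and late2: "\<And>\<sigma>. \<delta> \<le> \<sigma> \<Longrightarrow> \<sigma> * bern_density p r + u * r2 + (w - \<sigma>) * bern_density p r2 \<le> u * r + w * bern_density p r - e0"
    using late_exit_loses[OF p r u w \<delta>(1)] by metis
  \<comment> \<open>Four deviations of size \<open>e N\<close> enter a late exit and use up half of its loss \<open>e0 N\<close>; for an early exit
     there are three of them.\<close>
  define e where "e = min (e0 / 8) (\<epsilon> / 8)"
  have e: "e > 0" "e \<le> e0 / 8" "e \<le> \<epsilon> / 8" using e0 \<epsilon> by (auto simp: e_def)
  define K where "K = u + w"
  have K: "K > 0" using u w0 by (simp add: K_def)
  obtain cg where cg: "cg > 0"
    "\<And>k N. real k \<le> K * real N \<Longrightarrow>
       measure_pmf.prob (replicate_pmf k (geo_pmf r)) {xs. real k * r + e * real N \<le> real (sum_list xs)} \<le> exp (- cg * real N)"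
    "\<And>k N. real k \<le> K * real N \<Longrightarrow>
       measure_pmf.prob (replicate_pmf k (geo_pmf r)) {xs. real (sum_list xs) \<le> real k * r - e * real N} \<le> exp (- cg * real N)"
    using geo_sum_deviation[OF r e(1) K] by metis
  obtain cb where cb: "cb > 0"
    "\<And>k N. real k \<le> K * real N \<Longrightarrow>
       measure_pmf.prob (replicate_pmf k (bernoulli_pmf ?q)) {xs. real k * ?q + e * real N \<le> real (ones xs)} \<le> exp (- cb * real N)"
    "\<And>k N. real k \<le> K * real N \<Longrightarrow>
       measure_pmf.prob (replicate_pmf k (bernoulli_pmf ?q)) {xs. real (ones xs) \<le> real k * ?q - e * real N} \<le> exp (- cb * real N)"
    using bernoulli_sum_deviation[OF _ _ e(1) K, of ?q] bern_density_bounds[OF p r] by (metis less_imp_le)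
  obtain c1 where c1: "c1 > 0"
    "\<And>m n N. real m \<le> K * real N \<Longrightarrow> real n \<le> K * real N \<Longrightarrow>
       measure_pmf.prob (bern_set p ({1..m} \<times> {1..n}))
         {S. real m * r1 + real n * bern_density p r1 + e * real N \<le> real (chain01 S m n)} \<le> 2 * exp (- c1 * real N)"
    using chain01_upper_tail[OF p r12(1) e(1) K] by metis
  obtain c2 where c2: "c2 > 0"
    "\<And>m n N. real m \<le> K * real N \<Longrightarrow> real n \<le> K * real N \<Longrightarrow>
       measure_pmf.prob (bern_set p ({1..m} \<times> {1..n}))
         {S. real m * r2 + real n * bern_density p r2 + e * real N \<le> real (chain01 S m n)} \<le> 2 * exp (- c2 * real N)"
    using chain01_upper_tail[OF p r12(2) e(1) K] by metis
  define c where "c = min (min cg cb) (min c1 c2)"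
  have c: "c > 0" using cg cb c1 c2 by (simp add: c_def)
  have B: "exp (- cg * real N) \<le> 2 * exp (- c * real N)" "exp (- cb * real N) \<le> 2 * exp (- c * real N)"
      "2 * exp (- c1 * real N) \<le> 2 * exp (- c * real N)" "2 * exp (- c2 * real N) \<le> 2 * exp (- c * real N)" for N
  proof -
    have *: "exp (- x * real N) \<le> exp (- c * real N)" if "c \<le> x" for x
      using that by (auto intro!: mult_right_mono)
    have "c \<le> cg" "c \<le> cb" "c \<le> c1" "c \<le> c2" by (auto simp: c_def)
    from this[THEN *] show "exp (- cg * real N) \<le> 2 * exp (- c * real N)" "exp (- cb * real N) \<le> 2 * exp (- c * real N)"
      "2 * exp (- c1 * real N) \<le> 2 * exp (- c * real N)" "2 * exp (- c2 * real N) \<le> 2 * exp (- c * real N)"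
      using exp_gt_zero[of "- c * real N"] by linarith+
  qed
  have bound: "measure_pmf.prob (bern_set p ({1..m N} \<times> {1..n N}))
           {S. real (chain01 S (m N) (n N)) \<le> (u * r + ?q * w - \<epsilon>) * real N} \<le> (12 + 4 * K * real N) * exp (- c * real N)"
    if N1: "real N > 2 * (2 * r + 1) / e0" and N2: "real N > 4 * (2 * r + 1) / \<epsilon>" for N
  proof -
    let ?m = "m N" and ?n = "n N"
    let ?b = "2 * exp (- c * real N)"
    let ?St = "stationary_pmf p r ?m ?n"
    have m: "u * real N - 1 \<le> real ?m" "real ?m \<le> u * real N"
      using u by (auto simp: m_def of_nat_nat intro: less_imp_le)
    have n: "w * real N - 1 \<le> real ?n" "real ?n \<le> w * real N"
      using w0 by (auto simp: n_def of_nat_nat intro: less_imp_le)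
    have mn: "real ?m + real ?n \<le> K * real N" using m n by (simp add: K_def algebra_simps)
    have kK: "real k \<le> K * real N" if "k \<le> ?m \<or> k \<le> ?n" for k
      using that mn by linarith
    define A1 where "A1 = (\<lambda>z::nat list \<times> bool list \<times> (nat \<times> nat) set.
        real (sum_list (take ?m (fst z))) \<le> real ?m * r - e * real N)"
    define A2 where "A2 = (\<lambda>z. real (ones (right_increments ?m ?n z)) \<le> real ?n * ?q - e * real N)"
    define A3 where "A3 = (\<lambda>s (z::nat list \<times> bool list \<times> (nat \<times> nat) set).
        real s * r + e * real N \<le> real (sum_list (take s (fst z))))"
    define A4 where "A4 = (\<lambda>s (z::nat list \<times> bool list \<times> (nat \<times> nat) set).
        real s * ?q + e * real N \<le> real (ones (take s (fst (snd z)))))"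
    define A5 where "A5 = (\<lambda>s (z::nat list \<times> bool list \<times> (nat \<times> nat) set).
        real (?m - s) * r1 + real ?n * bern_density p r1 + e * real N \<le> real (chain01 (recenter (s, 0) (snd (snd z))) (?m - s) ?n))"
    define A6 where "A6 = (\<lambda>s (z::nat list \<times> bool list \<times> (nat \<times> nat) set).
        real ?m * r2 + real (?n - s) * bern_density p r2 + e * real N \<le> real (chain01 (recenter (0, s) (snd (snd z))) ?m (?n - s)))"
    have P1: "measure_pmf.prob ?St {z. A1 z} \<le> ?b"
      using cg(3)[OF kK, of ?m] B(1)[of N]
        stationary_pmf_bottom[OF order_refl, of p r ?m ?n "\<lambda>xs. real (sum_list xs) \<le> real ?m * r - e * real N"]
      by (simp add: A1_def)
    have P2: "measure_pmf.prob ?St {z. A2 z} \<le> ?b"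
      using cb(3)[OF kK, of ?n] B(2)[of N]
        stationary_pmf_right[OF p r, of ?m ?n "\<lambda>xs. real (ones xs) \<le> real ?n * ?q - e * real N"]
      by (simp add: A2_def)
    have P3: "measure_pmf.prob ?St {z. A3 s z} \<le> ?b" if "s \<le> ?m" for s
      using cg(2)[OF kK, of s] B(1)[of N] that
        stationary_pmf_bottom[OF that, of p r ?n "\<lambda>xs. real s * r + e * real N \<le> real (sum_list xs)"]
      by (simp add: A3_def)
    have P4: "measure_pmf.prob ?St {z. A4 s z} \<le> ?b" if "s \<le> ?n" for s
      using cb(2)[OF kK, of s] B(2)[of N] that
        stationary_pmf_left[OF that, of p r ?m "\<lambda>xs. real s * ?q + e * real N \<le> real (ones xs)"]
      by (simp add: A4_def)
    have P5: "measure_pmf.prob ?St {z. A5 s z} \<le> ?b" if "s \<le> ?m" for s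
    proof -
      let ?P = "\<lambda>l. real (?m - s) * r1 + real ?n * bern_density p r1 + e * real N \<le> real l"
      have "measure_pmf.prob ?St {z. A5 s z} =
          measure_pmf.prob (bern_set p ({1..?m} \<times> {1..?n})) {S. ?P (chain01 (recenter (s, 0) S) (?m - s) (?n - 0))}"
        unfolding A5_def using stationary_pmf_field[of p r ?m ?n "\<lambda>S. ?P (chain01 (recenter (s, 0) S) (?m - s) (?n - 0))"]
        by (simp only: diff_zero)
      also have "\<dots> = measure_pmf.prob (bern_set p ({1..?m - s} \<times> {1..?n})) {S. ?P (chain01 S (?m - s) ?n)}"
        using prob_chain01_recenter[OF that, of 0 ?n p ?P] by (simp only: diff_zero le0)
      also have "\<dots> \<le> ?b"
        by (rule order_trans[OF c1(2)[OF kK kK] B(3)]) simp_all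
      finally show ?thesis .
    qed
    have P6: "measure_pmf.prob ?St {z. A6 s z} \<le> ?b" if "s \<le> ?n" for s
    proof -
      let ?P = "\<lambda>l. real ?m * r2 + real (?n - s) * bern_density p r2 + e * real N \<le> real l"
      have "measure_pmf.prob ?St {z. A6 s z} =
          measure_pmf.prob (bern_set p ({1..?m} \<times> {1..?n})) {S. ?P (chain01 (recenter (0, s) S) (?m - 0) (?n - s))}"
        unfolding A6_def using stationary_pmf_field[of p r ?m ?n "\<lambda>S. ?P (chain01 (recenter (0, s) S) (?m - 0) (?n - s))"]
        by (simp only: diff_zero)
      also have "\<dots> = measure_pmf.prob (bern_set p ({1..?m} \<times> {1..?n - s})) {S. ?P (chain01 S ?m (?n - s))}"
        using prob_chain01_recenter[OF _ that, of 0 ?m p ?P] by (simp only: diff_zero le0)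
      also have "\<dots> \<le> ?b"
        by (rule order_trans[OF c2(2)[OF kK kK] B(4)]) simp_all
      finally show ?thesis .
    qed
    have "measure_pmf.prob (bern_set p ({1..?m} \<times> {1..?n}))
           {S. real (chain01 S ?m ?n) \<le> (u * r + ?q * w - \<epsilon>) * real N} =
       measure_pmf.prob ?St {z. real (chain01 (snd (snd z)) ?m ?n) \<le> (u * r + ?q * w - \<epsilon>) * real N}"
      by (rule stationary_pmf_field[of p r ?m ?n "\<lambda>S. real (chain01 S ?m ?n) \<le> (u * r + ?q * w - \<epsilon>) * real N", symmetric])
    also have "\<dots> \<le> measure_pmf.prob ?St {z. A1 z \<or> A2 z \<or> (\<exists>s\<le>?m. A3 s z) \<or> (\<exists>s\<le>?n. A4 s z) \<or>
        (\<exists>s\<le>?m. A5 s z) \<or> (\<exists>s\<le>?n. A6 s z)}"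
    proof (rule prob_mono_supp, rule ccontr)
      fix z assume z: "z \<in> set_pmf ?St" and small: "real (chain01 (snd (snd z)) ?m ?n) \<le> (u * r + ?q * w - \<epsilon>) * real N"
        and "\<not> (A1 z \<or> A2 z \<or> (\<exists>s\<le>?m. A3 s z) \<or> (\<exists>s\<le>?n. A4 s z) \<or> (\<exists>s\<le>?m. A5 s z) \<or> (\<exists>s\<le>?n. A6 s z))"
      hence no: "\<not> A1 z" "\<not> A2 z" "\<And>s. s \<le> ?m \<Longrightarrow> \<not> A3 s z" "\<And>s. s \<le> ?n \<Longrightarrow> \<not> A4 s z"
        "\<And>s. s \<le> ?m \<Longrightarrow> \<not> A5 s z" "\<And>s. s \<le> ?n \<Longrightarrow> \<not> A6 s z" by blast+
      have tk: "take ?m (fst z) = fst z"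
        using z stationary_pmf_support(1)[of "fst z" "fst (snd z)" "snd (snd z)"] by simp
      have G: "real ?m * r + real ?n * ?q - 2 * e * real N <
          real (stat_lpp (fst z) (fst (snd z)) (snd (snd z)) ?m ?n)"
        using no(1,2) unfolding A1_def A2_def tk stat_lpp_eq[OF z] by simp
      have "(u * r + w * ?q - (3 * e + \<delta> * (1 + r))) * real N - (2 * r + 1) < real (chain01 (snd (snd z)) ?m ?n)"
        by (rule early_exit[OF p r u w \<delta>(1) e(1,2) _ _ r12 N1 m n G])
           (use late1 late2 no(3-6) in \<open>auto simp: A3_def A4_def A5_def A6_def not_le\<close>)
      hence "(u * r + w * ?q - (3 * e + \<epsilon> / 4)) * real N - (2 * r + 1) < (u * r + ?q * w - \<epsilon>) * real N"
        using small \<delta>(2) by simp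
      hence "3 / 4 * \<epsilon> * real N < 3 * e * real N + (2 * r + 1)" by (simp add: algebra_simps)
      moreover have "e * real N \<le> \<epsilon> / 8 * real N" using e(3) by (intro mult_right_mono) auto
      moreover have "8 * r + 4 < \<epsilon> * real N" using N2 \<epsilon> by (simp add: divide_less_eq mult.commute)
      ultimately show False using r by linarith
    qed
    also have "\<dots> \<le> ?b + (?b + ((real ?m + 1) * ?b + ((real ?n + 1) * ?b + ((real ?m + 1) * ?b + (real ?n + 1) * ?b))))"
      by (intro order_trans[OF prob_disj_le] add_mono P1 P2 prob_ex_le P3 P4 P5 P6)
    also have "\<dots> = (12 + 4 * (real ?m + real ?n)) * exp (- c * real N)" by (simp add: algebra_simps)
    also have "\<dots> \<le> (12 + 4 * K * real N) * exp (- c * real N)"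
      using mn by (intro mult_right_mono) auto
    finally show ?thesis .
  qed
  show ?thesis
  proof (rule summable_comparison_test_ev)
    show "summable (\<lambda>N. (12 + 4 * K * real N) * exp (- c * real N))"
      by (rule summable_linear_times_exp[OF c])
    have "eventually (\<lambda>N. real N > 2 * (2 * r + 1) / e0) sequentially"
         "eventually (\<lambda>N. real N > 4 * (2 * r + 1) / \<epsilon>) sequentially"
      using filterlim_real_sequentially unfolding filterlim_at_top_dense by blast+
    thus "eventually (\<lambda>N. norm (measure_pmf.prob (bern_set p ({1..m N} \<times> {1..n N}))
           {S. real (chain01 S (m N) (n N)) \<le> (u * r + w * bern_density p r - \<epsilon>) * real N})
         \<le> (12 + 4 * K * real N) * exp (- c * real N)) sequentially"
      by eventually_elim (use bound in \<open>simp add: mult.commute\<close>)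
  qed
qed

section \<open>Transfer to an arbitrary gap\<close>

locale bernoulli_field = prob_space M for M :: "'w measure" +
  fixes \<Xi> :: "nat \<times> nat \<Rightarrow> 'w \<Rightarrow> bool" and p :: real
  assumes p0: "0 < p" and p1: "p < 1" and iid: "iid_bernoulli M \<Xi> p"
begin

text \<open>
On a finite window the given field has the same law as the discrete model.
\<close>

lemma points_in_box:
  assumes E: "finite E" "E \<subseteq> {1..} \<times> {1..}" and c: "c \<subseteq> E"
  shows "{\<omega> \<in> space M. bernoulli_points \<Xi> \<omega> \<inter> E = c} \<in> events"
    and "prob {\<omega> \<in> space M. bernoulli_points \<Xi> \<omega> \<inter> E = c} = pmf (bern_set p E) c"
proof -
  have indep: "indep_vars (\<lambda>_. count_space UNIV) \<Xi> ({1..} \<times> {1..})"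
    and law: "\<And>z. z \<in> {1..} \<times> {1..} \<Longrightarrow> distr M (count_space UNIV) (\<Xi> z) = measure_pmf (bernoulli_pmf p)"
    using iid by (auto simp: iid_bernoulli_def)
  have meas: "\<Xi> z \<in> measurable M (count_space UNIV)" if "z \<in> E" for z
    using indep E(2) that by (auto simp: indep_vars_def)
  have eq: "{\<omega> \<in> space M. bernoulli_points \<Xi> \<omega> \<inter> E = c} = (\<Inter>z\<in>E. \<Xi> z -` {z \<in> c} \<inter> space M)" if "E \<noteq> {}"
  proof (rule set_eqI)
    fix \<omega>
    have mem: "z \<in> bernoulli_points \<Xi> \<omega> \<longleftrightarrow> \<Xi> z \<omega>" if "z \<in> E" for z
      using E(2) that by (auto simp: bernoulli_points_def)
    have "bernoulli_points \<Xi> \<omega> \<inter> E = c \<longleftrightarrow> (\<forall>z\<in>E. z \<in> bernoulli_points \<Xi> \<omega> \<longleftrightarrow> z \<in> c)"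
      using c by blast
    also have "\<dots> \<longleftrightarrow> (\<forall>z\<in>E. \<Xi> z \<omega> = (z \<in> c))" using mem by simp
    finally show "\<omega> \<in> {\<omega> \<in> space M. bernoulli_points \<Xi> \<omega> \<inter> E = c} \<longleftrightarrow>
        \<omega> \<in> (\<Inter>z\<in>E. \<Xi> z -` {z \<in> c} \<inter> space M)"
      using that by auto
  qed
  have single: "\<Xi> z -` {b} \<inter> space M \<in> events" if "z \<in> E" for z b
    using meas[OF that] by (rule measurable_sets) simp
  have pr: "prob (\<Xi> z -` {b} \<inter> space M) = pmf (bernoulli_pmf p) b" if "z \<in> E" for z b
    using law[of z] E(2) that measure_distr[OF meas[OF that], of "{b}"] by (auto simp: measure_pmf_single)
  show "{\<omega> \<in> space M. bernoulli_points \<Xi> \<omega> \<inter> E = c} \<in> events"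
  proof (cases "E = {}")
    case True
    thus ?thesis using c by simp
  next
    case False
    thus ?thesis unfolding eq[OF False] using E(1) single by (intro sets.finite_INT) auto
  qed
  show "prob {\<omega> \<in> space M. bernoulli_points \<Xi> \<omega> \<inter> E = c} = pmf (bern_set p E) c"
  proof (cases "E = {}")
    case True
    thus ?thesis using c by (simp add: prob_space)
  next
    case False
    have "prob (\<Inter>z\<in>E. \<Xi> z -` {z \<in> c} \<inter> space M) = (\<Prod>z\<in>E. prob (\<Xi> z -` {z \<in> c} \<inter> space M))"
      by (rule indep_varsD[OF indep False E]) simp
    also have "\<dots> = pmf (bern_set p E) c"
      by (simp add: pmf_bern_set[OF E(1) c] pr)
    finally show ?thesis unfolding eq[OF False] .
  qed
qed

lemma prob_points:
  assumes E: "finite E" "E \<subseteq> {1..} \<times> {1..}"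
  shows "{\<omega> \<in> space M. Q (bernoulli_points \<Xi> \<omega> \<inter> E)} \<in> events"
    and "prob {\<omega> \<in> space M. Q (bernoulli_points \<Xi> \<omega> \<inter> E)} = measure_pmf.prob (bern_set p E) {c. Q c}"
proof -
  let ?A = "\<lambda>c. {\<omega> \<in> space M. bernoulli_points \<Xi> \<omega> \<inter> E = c}"
  have eq: "{\<omega> \<in> space M. Q (bernoulli_points \<Xi> \<omega> \<inter> E)} = (\<Union>c\<in>{c. c \<subseteq> E \<and> Q c}. ?A c)"
    by auto
  have fin: "finite {c. c \<subseteq> E \<and> Q c}" using E(1) by simp
  show "{\<omega> \<in> space M. Q (bernoulli_points \<Xi> \<omega> \<inter> E)} \<in> events"
    unfolding eq using fin points_in_box(1)[OF E] by (intro sets.finite_UN) auto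
  have "prob {\<omega> \<in> space M. Q (bernoulli_points \<Xi> \<omega> \<inter> E)} = (\<Sum>c\<in>{c. c \<subseteq> E \<and> Q c}. prob (?A c))"
    unfolding eq
    by (rule finite_measure_finite_Union) (use fin points_in_box(1)[OF E] in \<open>auto simp: disjoint_family_on_def\<close>)
  also have "\<dots> = (\<Sum>c\<in>{c. c \<subseteq> E \<and> Q c}. pmf (bern_set p E) c)"
    using points_in_box(2)[OF E] by (intro sum.cong) auto
  also have "\<dots> = measure_pmf.prob (bern_set p E) {c. c \<subseteq> E \<and> Q c}"
    by (rule measure_measure_pmf_finite[symmetric, OF fin])
  also have "\<dots> = measure_pmf.prob (bern_set p E) {c. Q c}"
    by (rule prob_bern_set_cong[OF E(1)]) auto
  finally show "prob {\<omega> \<in> space M. Q (bernoulli_points \<Xi> \<omega> \<inter> E)} = measure_pmf.prob (bern_set p E) {c. Q c}" .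
qed

definition len :: "nat \<times> nat \<Rightarrow> nat \<Rightarrow> nat \<Rightarrow> 'w \<Rightarrow> nat" where
  "len h m n \<omega> = longest_chain h (bernoulli_points \<Xi> \<omega>) m n"

lemma prob_len:
  assumes h: "h \<noteq> (0, 0)"
  shows "{\<omega> \<in> space M. Q (len h m n \<omega>)} \<in> events"
    and "prob {\<omega> \<in> space M. Q (len h m n \<omega>)} =
      measure_pmf.prob (bern_set p ({1..m} \<times> {1..n})) {c. Q (longest_chain h c m n)}"
proof -
  let ?E = "{1..m} \<times> {1..n}"
  have eq: "{\<omega> \<in> space M. Q (len h m n \<omega>)} = {\<omega> \<in> space M. Q (longest_chain h (bernoulli_points \<Xi> \<omega> \<inter> ?E) m n)}"
  proof -
    have "longest_chain h (bernoulli_points \<Xi> \<omega> \<inter> ?E) m n = longest_chain h (bernoulli_points \<Xi> \<omega>) m n" for \<omega>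
      by (rule longest_chain_cong_box[OF h]) auto
    thus ?thesis by (simp add: len_def)
  qed
  have E: "finite ?E" "?E \<subseteq> {1..} \<times> {1..}" by auto
  show "{\<omega> \<in> space M. Q (len h m n \<omega>)} \<in> events"
    unfolding eq by (rule prob_points(1)[OF E])
  show "prob {\<omega> \<in> space M. Q (len h m n \<omega>)} =
      measure_pmf.prob (bern_set p ?E) {c. Q (longest_chain h c m n)}"
    unfolding eq by (rule prob_points(2)[OF E])
qed

lemma len_mono: "h \<noteq> (0, 0) \<Longrightarrow> i \<le> i' \<Longrightarrow> j \<le> j' \<Longrightarrow> len h i j \<omega> \<le> len h i' j' \<omega>"
  unfolding len_def by (rule longest_chain_mono)

lemma prob_len_gap_change:
  fixes m n k :: nat
  assumes h: "h \<noteq> (0, 0)" and k: "1 \<le> k"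
  defines "u \<equiv> m - (k - 1) * fst h" and "v \<equiv> n - (k - 1) * snd h + (k - 1)"
  shows "prob {\<omega> \<in> space M. k \<le> len h m n \<omega>} = prob {\<omega> \<in> space M. k \<le> len (0, 1) u v \<omega>}"
    and "prob {\<omega> \<in> space M. len h m n \<omega> < k} = prob {\<omega> \<in> space M. len (0, 1) u v \<omega> < k}"
proof -
  have 01: "(0::nat, 1::nat) \<noteq> (0, 0)" by simp
  show *: "prob {\<omega> \<in> space M. k \<le> len h m n \<omega>} = prob {\<omega> \<in> space M. k \<le> len (0, 1) u v \<omega>}"
    unfolding prob_len(2)[OF h, of "\<lambda>l. k \<le> l"] prob_len(2)[OF 01, of "\<lambda>l. k \<le> l"]
      le_longest_chain_iff_reach[OF h] le_longest_chain_iff_reach[OF 01] u_def v_def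
    by (rule prob_reach_gap_change[OF h k])
  have "prob {\<omega> \<in> space M. len h' i j \<omega> < k} = 1 - prob {\<omega> \<in> space M. k \<le> len h' i j \<omega>}"
    if "h' \<noteq> (0, 0)" for h' i j
  proof -
    have "{\<omega> \<in> space M. len h' i j \<omega> < k} = space M - {\<omega> \<in> space M. k \<le> len h' i j \<omega>}" by auto
    thus ?thesis using prob_compl[OF prob_len(1)[OF that, of "\<lambda>l. k \<le> l" i j]] by simp
  qed
  thus "prob {\<omega> \<in> space M. len h m n \<omega> < k} = prob {\<omega> \<in> space M. len (0, 1) u v \<omega> < k}"
    using * h 01 by simp
qed

end

text \<open>
Divided by \<open>1 - q(r)\<close>, the inequality \<open>u r + (v + \<theta>) q(r) < \<theta>\<close> becomes
\<open>(p (u + v) + u r + v p / r) / (1 - p) < \<theta>\<close>. The left side is minimal at \<open>r = sqrt (v p / u)\<close>, with minimum \<open>g(u, v)\<close>. The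
height \<open>v + g(u, v)\<close> is exactly the one for which this \<open>r\<close> is critical in the sense of \<open>stationary_slope_gap\<close>.
\<close>

lemma optimal_density:
  assumes p: "0 < p" "p < 1" and uv: "u > 0" "v > 0"
  defines "r \<equiv> sqrt (v * p / u)"
  shows "r > 0" "v + g_fun p u v = u * (p + r)\<^sup>2 / (p * (1 - p))"
    "u * r + (v + g_fun p u v) * bern_density p r = g_fun p u v"
proof -
  show r: "r > 0" using assms by (simp add: r_def)
  have r2: "r\<^sup>2 = v * p / u" using assms by (simp add: r_def)
  hence v: "v = u * r\<^sup>2 / p" using p uv by (simp add: field_simps)
  have "sqrt (u * v) * sqrt p = sqrt (u\<^sup>2 * r\<^sup>2)"
    unfolding real_sqrt_mult[symmetric] v using p by (simp add: power2_eq_square)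
  hence sq: "sqrt p * sqrt (u * v) = u * r" using r uv by (simp add: real_sqrt_mult mult.commute)
  have "g_fun p u v = (2 * (sqrt p * sqrt (u * v)) + (u + v) * (sqrt p * sqrt p)) / (1 - p)"
    by (simp add: g_fun_def algebra_simps)
  also have "\<dots> = u * (2 * r + p + r\<^sup>2) / (1 - p)"
    unfolding sq using p by (simp add: v field_simps)
  finally have g: "g_fun p u v = u * (2 * r + p + r\<^sup>2) / (1 - p)" .
  have nz: "p \<noteq> 0" "1 - p \<noteq> 0" "p + r \<noteq> 0" using p r by auto
  show w: "v + g_fun p u v = u * (p + r)\<^sup>2 / (p * (1 - p))"
    unfolding g unfolding v using nz by (simp add: divide_simps) (simp add: algebra_simps power2_eq_square)
  have "(v + g_fun p u v) * bern_density p r = u * (p + r) * (1 + r) / (1 - p)"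
    unfolding w bern_density_def using nz by (simp add: power2_eq_square)
  thus "u * r + (v + g_fun p u v) * bern_density p r = g_fun p u v"
    unfolding g using nz by (simp add: divide_simps) (simp add: algebra_simps power2_eq_square)
qed

context bernoulli_field
begin

text \<open>
After the change of gap the box has size about \<open>(u N, (v + \<theta>) N)\<close>, and the upper tail bound with the optimal \<open>r\<close>
beats \<open>\<theta> N\<close> because \<open>\<theta> - (u r + (v + \<theta>) q) = (\<theta> - g(u, v)) (1 - q)\<close>.
\<close>

lemma summable_len_ge:
  assumes h: "(h1, h2) \<noteq> (0, 0)" and l: "\<theta> > 0"
    and u: "a - real h1 * \<theta> > 0" and v: "b - real h2 * \<theta> > 0"
    and g: "g_fun p (a - real h1 * \<theta>) (b - real h2 * \<theta>) < \<theta>"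
  shows "summable (\<lambda>N. prob {\<omega> \<in> space M. \<theta> * real N \<le> real (len (h1, h2) (nat \<lfloor>a * real N\<rfloor>) (nat \<lfloor>b * real N\<rfloor>) \<omega>)})"
proof -
  define u where "u = a - real h1 * \<theta>"
  define v where "v = b - real h2 * \<theta>"
  define r where "r = sqrt (v * p / u)"
  define q where "q = bern_density p r"
  have uv: "u > 0" "v > 0" using u v by (auto simp: u_def v_def)
  note opt = optimal_density[OF p0 p1 uv, folded r_def]
  have r: "r > 0" by (rule opt(1))
  have q: "0 < q" "q < 1" unfolding q_def using bern_density_bounds[OF p0 p1 r] by auto
  have "0 < (\<theta> - g_fun p u v) * (1 - q)" using g q by (simp add: u_def v_def)
  also have "\<dots> = \<theta> - (u * r + (v + \<theta>) * q)"
    using opt(3) unfolding q_def[symmetric] by (simp add: algebra_simps)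
  finally have gap: "u * r + (v + \<theta>) * q < \<theta>" by simp
  define \<epsilon> where "\<epsilon> = (\<theta> - (u * r + (v + \<theta>) * q)) / 2"
  have \<epsilon>: "\<epsilon> > 0" using gap by (simp add: \<epsilon>_def)
  define K where "K = u + (v + \<theta>) + real h1 + real h2"
  have K: "K > 0" using uv l by (simp add: K_def)
  obtain c where c: "c > 0" and tail: "\<And>m n N. real m \<le> K * real N \<Longrightarrow> real n \<le> K * real N \<Longrightarrow>
       measure_pmf.prob (bern_set p ({1..m} \<times> {1..n}))
         {S. real m * r + real n * q + \<epsilon> * real N \<le> real (chain01 S m n)} \<le> 2 * exp (- c * real N)"
    using chain01_upper_tail[OF p0 p1 r \<epsilon> K] unfolding q_def by metis
  have bound: "prob {\<omega> \<in> space M. \<theta> * real N \<le> real (len (h1, h2) (nat \<lfloor>a * real N\<rfloor>) (nat \<lfloor>b * real N\<rfloor>) \<omega>)}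
      \<le> 2 * exp (- c * real N)" if N: "real N > (real h1 * r + real h2) / \<epsilon>" "N \<ge> 1" for N
  proof -
    define m where "m = nat \<lfloor>a * real N\<rfloor>"
    define n where "n = nat \<lfloor>b * real N\<rfloor>"
    define k where "k = nat \<lceil>\<theta> * real N\<rceil>"
    have lN: "\<theta> * real N > 0" using l N by simp
    have k: "1 \<le> k" "\<theta> * real N \<le> real k" "real k - 1 < \<theta> * real N"
      using lN unfolding k_def by (linarith | simp)+
    have ab: "a > 0" "b > 0"
    proof -
      have "0 \<le> real h1 * \<theta>" "0 \<le> real h2 * \<theta>" using l by auto
      thus "a > 0" "b > 0" using u v by linarith+
    qed
    have mn: "real m \<le> a * real N" "real n \<le> b * real N"
      using ab unfolding m_def n_def by (auto simp: of_nat_nat)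
    define m' where "m' = m - (k - 1) * h1"
    define n' where "n' = n - (k - 1) * h2 + (k - 1)"
    have km: "(\<theta> * real N - 1) * real h \<le> real ((k - 1) * h)" for h :: nat
      using k by (auto simp: of_nat_diff intro!: mult_right_mono)
    have N1: "real N \<ge> 1" using N by simp
    have sub: "real (i - (k - 1) * h) \<le> x * real N + real h"
      if "real i \<le> y * real N" "x = y - real h * \<theta>" "x > 0" for i h x y
    proof (cases "(k - 1) * h \<le> i")
      case True
      hence "real (i - (k - 1) * h) \<le> y * real N - (\<theta> * real N - 1) * real h"
        using km[of h] that by (simp only: of_nat_diff)
      moreover have "x * real N = y * real N - \<theta> * real N * real h" by (simp add: that(2) algebra_simps)
      ultimately show ?thesis by (simp add: left_diff_distrib)
    next
      case False
      thus ?thesis using that by simp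
    qed
    have m': "real m' \<le> u * real N + real h1"
      unfolding m'_def by (rule sub[OF mn(1) _ uv(1)]) (simp add: u_def)
    have "real (n - (k - 1) * h2) \<le> v * real N + real h2"
      by (rule sub[OF mn(2) _ uv(2)]) (simp add: v_def)
    hence n': "real n' \<le> (v + \<theta>) * real N + real h2"
      unfolding n'_def using k by (simp add: of_nat_diff algebra_simps)
    have "real h1 \<le> real h1 * real N" "real h2 \<le> real h2 * real N"
      using N1 by (simp_all add: mult_le_cancel_left1)
    moreover have "0 \<le> u * real N" "0 \<le> (v + \<theta>) * real N" "0 \<le> real h1 * real N" "0 \<le> real h2 * real N"
      using uv l by auto
    ultimately have K': "real m' \<le> K * real N" "real n' \<le> K * real N"
      using m' n' by (simp_all add: K_def distrib_right)
    have "real m' * r + real n' * q \<le> (u * real N + real h1) * r + ((v + \<theta>) * real N + real h2) * q"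
      using m' n' r q by (intro add_mono mult_right_mono) auto
    also have "\<dots> = (u * r + (v + \<theta>) * q) * real N + real h1 * r + real h2 * q"
      by (simp add: algebra_simps)
    also have "\<dots> \<le> (\<theta> - 2 * \<epsilon>) * real N + real h1 * r + real h2"
    proof -
      have "\<theta> - 2 * \<epsilon> = u * r + (v + \<theta>) * q" by (simp add: \<epsilon>_def field_simps)
      moreover have "real h2 * q \<le> real h2" using q by (simp add: mult_left_le)
      ultimately show ?thesis by simp
    qed
    also have "\<dots> \<le> (\<theta> - \<epsilon>) * real N"
      using N(1) \<epsilon> by (simp add: divide_less_eq algebra_simps)
    finally have fit: "real m' * r + real n' * q + \<epsilon> * real N \<le> real k"
      using k(2) by (simp add: algebra_simps)
    have "{\<omega> \<in> space M. \<theta> * real N \<le> real (len (h1, h2) m n \<omega>)} = {\<omega> \<in> space M. k \<le> len (h1, h2) m n \<omega>}"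
      unfolding k_def by (auto simp: ceiling_le_iff nat_le_iff)
    also have "prob \<dots> = prob {\<omega> \<in> space M. k \<le> len (0, 1) m' n' \<omega>}"
      using prob_len_gap_change(1)[OF h k(1), of m n] by (simp add: m'_def n'_def)
    also have "\<dots> = measure_pmf.prob (bern_set p ({1..m'} \<times> {1..n'})) {S. k \<le> chain01 S m' n'}"
      by (rule prob_len(2)) simp
    also have "\<dots> \<le> measure_pmf.prob (bern_set p ({1..m'} \<times> {1..n'}))
         {S. real m' * r + real n' * q + \<epsilon> * real N \<le> real (chain01 S m' n')}"
      using fit by (intro prob_mono_supp) linarith
    also have "\<dots> \<le> 2 * exp (- c * real N)" by (rule tail[OF K'])
    finally show ?thesis unfolding m_def n_def .
  qed
  show ?thesis
  proof (rule summable_comparison_test_ev)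
    show "summable (\<lambda>N. (2 + 0 * real N) * exp (- c * real N))"
      by (rule summable_linear_times_exp[OF c])
    have "eventually (\<lambda>N. real N > (real h1 * r + real h2) / \<epsilon>) sequentially"
      using filterlim_real_sequentially unfolding filterlim_at_top_dense by blast
    thus "eventually (\<lambda>N. norm (prob {\<omega> \<in> space M. \<theta> * real N \<le> real (len (h1, h2) (nat \<lfloor>a * real N\<rfloor>) (nat \<lfloor>b * real N\<rfloor>) \<omega>)})
        \<le> (2 + 0 * real N) * exp (- c * real N)) sequentially"
      using eventually_ge_at_top[of 1] by eventually_elim (use bound in simp)
  qed
qed

text \<open>
The lower tail bound concerns boxes of the critical shape. Such a box is found inside the given one by scaling
\<open>(u, v)\<close> with some \<open>s < 1\<close>: its width \<open>s u\<close> and height \<open>s (v + g)\<close> fit with room to spare, and its constant \<open>s g\<close>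
still exceeds \<open>\<theta>\<close>.
\<close>

lemma summable_len_less:
  assumes h: "(h1, h2) \<noteq> (0, 0)" and l: "\<theta> > 0"
    and u: "a - real h1 * \<theta> > 0" and v: "b - real h2 * \<theta> > 0"
    and g: "\<theta> < g_fun p (a - real h1 * \<theta>) (b - real h2 * \<theta>)"
  shows "summable (\<lambda>N. prob {\<omega> \<in> space M. real (len (h1, h2) (nat \<lfloor>a * real N\<rfloor>) (nat \<lfloor>b * real N\<rfloor>) \<omega>) < \<theta> * real N})"
proof -
  define u where "u = a - real h1 * \<theta>"
  define v where "v = b - real h2 * \<theta>"
  define G where "G = g_fun p u v"
  define r where "r = sqrt (v * p / u)"
  have uv: "u > 0" "v > 0" using u v by (auto simp: u_def v_def)
  note opt = optimal_density[OF p0 p1 uv, folded r_def G_def]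
  have r: "r > 0" by (rule opt(1))
  have G: "\<theta> < G" using g by (simp add: G_def u_def v_def)
  \<comment> \<open>The left end means \<open>\<theta> < s g\<close>, the right end that the height \<open>s (v + g)\<close> is below \<open>v + \<theta>\<close>.\<close>
  have "\<theta> / G < (\<theta> + v) / (G + v)"
  proof -
    have "\<theta> * v < G * v" using G uv by simp
    hence "\<theta> * (G + v) < (\<theta> + v) * G" by (simp add: algebra_simps)
    thus ?thesis using G l uv by (simp add: divide_simps)
  qed
  then obtain s where s: "\<theta> / G < s" "s < (\<theta> + v) / (G + v)" using dense by blast
  have sG: "\<theta> < s * G" and sw: "s * (v + G) < v + \<theta>"
    using s G l uv by (simp_all add: divide_less_eq less_divide_eq algebra_simps)
  have s1: "s < 1"
  proof -
    have "(\<theta> + v) / (G + v) < 1" using G uv l by simp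
    thus ?thesis using s(2) by linarith
  qed
  have s0: "s > 0" using s(1) G l by (intro less_trans[OF divide_pos_pos s(1)]) auto
  define u' where "u' = s * u"
  define w' where "w' = s * (v + G)"
  have u': "u' > 0" using s0 uv by (simp add: u'_def)
  have w': "w' = u' * (p + r)\<^sup>2 / (p * (1 - p))" by (simp add: w'_def u'_def opt(2))
  define \<epsilon> where "\<epsilon> = (s * G - \<theta>) / 2"
  have \<epsilon>: "\<epsilon> > 0" using sG by (simp add: \<epsilon>_def)
  have val: "u' * r + w' * bern_density p r = s * G"
    using arg_cong[OF opt(3), of "\<lambda>x. s * x"] by (simp add: u'_def w'_def algebra_simps)
  have gaps: "u - u' > 0" "v + \<theta> - w' > 0" using s1 uv sw by (auto simp: u'_def w'_def)
  let ?mu = "\<lambda>N. nat \<lfloor>u' * real N\<rfloor>" and ?nu = "\<lambda>N. nat \<lfloor>w' * real N\<rfloor>"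
  have tail: "summable (\<lambda>N. measure_pmf.prob (bern_set p ({1..?mu N} \<times> {1..?nu N}))
           {S. real (chain01 S (?mu N) (?nu N)) \<le> (s * G - \<epsilon>) * real N})"
    using chain01_lower_tail[OF p0 p1 r u' w' \<epsilon>] unfolding val .
  have bound: "prob {\<omega> \<in> space M. real (len (h1, h2) (nat \<lfloor>a * real N\<rfloor>) (nat \<lfloor>b * real N\<rfloor>) \<omega>) < \<theta> * real N}
      \<le> measure_pmf.prob (bern_set p ({1..?mu N} \<times> {1..?nu N}))
           {S. real (chain01 S (?mu N) (?nu N)) \<le> (s * G - \<epsilon>) * real N}"
    if N: "real N > 1 / (u - u')" "real N > 2 / (v + \<theta> - w')" "real N > 1 / \<epsilon>" for N
  proof -
    define m where "m = nat \<lfloor>a * real N\<rfloor>"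
    define n where "n = nat \<lfloor>b * real N\<rfloor>"
    define k where "k = nat \<lceil>\<theta> * real N\<rceil>"
    have N0: "real N > 0" using \<epsilon> by (intro less_trans[OF divide_pos_pos N(3)]) auto
    have lN: "\<theta> * real N > 0" using l N0 by simp
    have k: "1 \<le> k" "\<theta> * real N \<le> real k" "real k - 1 < \<theta> * real N"
      using lN unfolding k_def by (linarith | simp)+
    have mn: "a * real N - 1 \<le> real m" "b * real N - 1 \<le> real n"
      unfolding m_def n_def by linarith+
    define m' where "m' = m - (k - 1) * h1"
    define n' where "n' = n - (k - 1) * h2 + (k - 1)"
    have sub: "x * real N - 1 \<le> real (i - (k - 1) * h)"
      if "y * real N - 1 \<le> real i" "x = y - real h * \<theta>" for i h x y
    proof -
      have "real ((k - 1) * h) \<le> \<theta> * real N * real h"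
        using k by (auto simp: of_nat_diff intro!: mult_right_mono)
      moreover have "real i - real ((k - 1) * h) \<le> real (i - (k - 1) * h)" by linarith
      moreover have "x * real N = y * real N - \<theta> * real N * real h" by (simp add: that(2) algebra_simps)
      ultimately show ?thesis using that(1) by linarith
    qed
    have m': "u * real N - 1 \<le> real m'"
      unfolding m'_def by (rule sub[OF mn(1)]) (simp add: u_def)
    have "v * real N - 1 \<le> real (n - (k - 1) * h2)"
      by (rule sub[OF mn(2)]) (simp add: v_def)
    hence n': "(v + \<theta>) * real N - 2 \<le> real n'"
      unfolding n'_def using k by (simp add: of_nat_diff algebra_simps)
    have "1 < (u - u') * real N" "2 < (v + \<theta> - w') * real N" "1 < \<epsilon> * real N"
      using N gaps \<epsilon> by (simp_all add: divide_less_eq mult.commute)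
    moreover have "s * G - \<epsilon> = \<theta> + \<epsilon>" by (simp add: \<epsilon>_def field_simps)
    ultimately have le: "u' * real N \<le> real m'" "w' * real N \<le> real n'" and keps: "real k \<le> (s * G - \<epsilon>) * real N"
      using m' n' k(3) by (simp_all add: algebra_simps)
    have le': "?mu N \<le> m'" "?nu N \<le> n'" using le by linarith+
    have "{\<omega> \<in> space M. real (len (h1, h2) m n \<omega>) < \<theta> * real N} = {\<omega> \<in> space M. len (h1, h2) m n \<omega> < k}"
      unfolding k_def by (auto simp: less_ceiling_iff zless_nat_eq_int_zless)
    also have "prob \<dots> = prob {\<omega> \<in> space M. len (0, 1) m' n' \<omega> < k}"
      using prob_len_gap_change(2)[OF h k(1), of m n] by (simp add: m'_def n'_def)
    also have "\<dots> \<le> prob {\<omega> \<in> space M. real (len (0, 1) (?mu N) (?nu N) \<omega>) \<le> (s * G - \<epsilon>) * real N}"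
    proof (rule finite_measure_mono)
      show "{\<omega> \<in> space M. len (0, 1) m' n' \<omega> < k} \<subseteq>
         {\<omega> \<in> space M. real (len (0, 1) (?mu N) (?nu N) \<omega>) \<le> (s * G - \<epsilon>) * real N}"
      proof safe
        fix \<omega> assume "len (0, 1) m' n' \<omega> < k"
        moreover have "len (0, 1) (?mu N) (?nu N) \<omega> \<le> len (0, 1) m' n' \<omega>"
          by (rule len_mono[OF _ le']) simp
        ultimately show "real (len (0, 1) (?mu N) (?nu N) \<omega>) \<le> (s * G - \<epsilon>) * real N"
          using keps by linarith
      qed
    qed (rule prob_len(1)[of _ "\<lambda>l. real l \<le> (s * G - \<epsilon>) * real N"], simp)
    also have "\<dots> = measure_pmf.prob (bern_set p ({1..?mu N} \<times> {1..?nu N}))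
           {S. real (chain01 S (?mu N) (?nu N)) \<le> (s * G - \<epsilon>) * real N}"
      by (rule prob_len(2)) simp
    finally show ?thesis unfolding m_def n_def .
  qed
  show ?thesis
  proof (rule summable_comparison_test_ev[OF _ tail])
    have "eventually (\<lambda>N. real N > x) sequentially" for x
      using filterlim_real_sequentially unfolding filterlim_at_top_dense by blast
    from this[of "1 / (u - u')"] this[of "2 / (v + \<theta> - w')"] this[of "1 / \<epsilon>"]
    show "eventually (\<lambda>N. norm (prob {\<omega> \<in> space M. real (len (h1, h2) (nat \<lfloor>a * real N\<rfloor>) (nat \<lfloor>b * real N\<rfloor>) \<omega>) < \<theta> * real N})
      \<le> measure_pmf.prob (bern_set p ({1..?mu N} \<times> {1..?nu N}))
           {S. real (chain01 S (?mu N) (?nu N)) \<le> (s * G - \<epsilon>) * real N}) sequentially"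
      by eventually_elim (use bound in simp)
  qed
qed

end

section \<open>The limit and its identification\<close>

context bernoulli_field
begin

lemma len_coordinate_bound:
  assumes h: "h \<noteq> (0, 0)"
  shows "len h m n \<omega> * fst h \<le> m + fst h" "len h m n \<omega> * snd h \<le> n + snd h"
    and "len h m n \<omega> \<le> m + n"
proof -
  have "len h m n \<omega> * fst h \<le> m + fst h \<and> len h m n \<omega> * snd h \<le> n + snd h \<and> len h m n \<omega> \<le> m + n"
  proof (cases "len h m n \<omega>")
    case (Suc k)
    have "Suc k \<le> longest_chain h (bernoulli_points \<Xi> \<omega>) m n"
      unfolding len_def[symmetric] Suc by simp
    hence "reach h (bernoulli_points \<Xi> \<omega>) (Suc k) m n"
      by (simp only: le_longest_chain_iff_reach[OF h])
    from reach_lower_bound[OF this] have b: "Suc (k * fst h) \<le> m" "Suc (k * snd h) \<le> n" by auto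
    have "1 \<le> fst h \<or> 1 \<le> snd h" using h by (auto simp: prod_eq_iff)
    hence "k * 1 \<le> k * fst h \<or> k * 1 \<le> k * snd h" by (meson mult_le_mono2)
    hence "Suc k \<le> m + n" using b by linarith
    thus ?thesis unfolding Suc mult_Suc using b by linarith
  qed simp
  thus "len h m n \<omega> * fst h \<le> m + fst h" "len h m n \<omega> * snd h \<le> n + snd h" "len h m n \<omega> \<le> m + n" by auto
qed

lemma summable_len_ge_mono:
  assumes h: "h \<noteq> (0, 0)" and "\<theta>' \<le> \<theta>"
    and "summable (\<lambda>N. prob {\<omega> \<in> space M. \<theta>' * real N \<le> real (len h (m N) (n N) \<omega>)})"
  shows "summable (\<lambda>N. prob {\<omega> \<in> space M. \<theta> * real N \<le> real (len h (m N) (n N) \<omega>)})"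
proof (rule summable_comparison_test[OF _ assms(3)], intro exI[of _ 0] allI impI)
  fix N
  have "{\<omega> \<in> space M. \<theta> * real N \<le> real (len h (m N) (n N) \<omega>)} \<subseteq> {\<omega> \<in> space M. \<theta>' * real N \<le> real (len h (m N) (n N) \<omega>)}"
    using mult_right_mono[OF assms(2), of "real N"] by auto
  thus "norm (prob {\<omega> \<in> space M. \<theta> * real N \<le> real (len h (m N) (n N) \<omega>)}) \<le>
      prob {\<omega> \<in> space M. \<theta>' * real N \<le> real (len h (m N) (n N) \<omega>)}"
    using finite_measure_mono[OF _ prob_len(1)[OF h, of "\<lambda>l. \<theta>' * real N \<le> real l" "m N" "n N"]] by simp
qed

text \<open>
Borel--Cantelli for a countable set of thresholds on either side of \<open>\<gamma>\<close>; dominated convergence then gives the convergence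
in mean.
\<close>

lemma limit_of_len:
  assumes h: "h \<noteq> (0, 0)" and ab: "a > 0" "b > 0" and \<gamma>: "\<gamma> > 0"
    and upper: "\<And>\<theta>. \<gamma> < \<theta> \<Longrightarrow> summable (\<lambda>N. prob {\<omega> \<in> space M. \<theta> * real N \<le> real (len h (nat \<lfloor>a * real N\<rfloor>) (nat \<lfloor>b * real N\<rfloor>) \<omega>)})"
    and lower: "\<And>\<theta>. 0 < \<theta> \<Longrightarrow> \<theta> < \<gamma> \<Longrightarrow> summable (\<lambda>N. prob {\<omega> \<in> space M. real (len h (nat \<lfloor>a * real N\<rfloor>) (nat \<lfloor>b * real N\<rfloor>) \<omega>) < \<theta> * real N})"
  shows "AE \<omega> in M. (\<lambda>N. real (len h (nat \<lfloor>a * real N\<rfloor>) (nat \<lfloor>b * real N\<rfloor>) \<omega>) / real N) \<longlonglongrightarrow> \<gamma>"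
    and "tendsto_L1 M (\<lambda>N \<omega>. real (len h (nat \<lfloor>a * real N\<rfloor>) (nat \<lfloor>b * real N\<rfloor>) \<omega>) / real N) (\<lambda>_. \<gamma>)"
proof -
  define L where "L = (\<lambda>N \<omega>. real (len h (nat \<lfloor>a * real N\<rfloor>) (nat \<lfloor>b * real N\<rfloor>) \<omega>))"
  have ev: "{\<omega> \<in> space M. Q (L N \<omega>)} \<in> events" for Q N
    unfolding L_def by (rule prob_len(1)[OF h, of "\<lambda>l. Q (real l)"])
  have "AE \<omega> in M. eventually (\<lambda>N. L N \<omega> < \<theta> * real N) sequentially" if "\<gamma> < \<theta>" for \<theta>
  proof -
    have "summable (\<lambda>N. prob {\<omega> \<in> space M. \<theta> * real N \<le> L N \<omega>})"
      using upper[OF that] by (simp add: L_def)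
    moreover have "{\<omega> \<in> space M. \<theta> * real N \<le> L N \<omega>} \<in> events" for N by (rule ev)
    ultimately have "AE \<omega> in M. eventually (\<lambda>N. \<omega> \<in> space M - {\<omega> \<in> space M. \<theta> * real N \<le> L N \<omega>}) sequentially"
      by (intro borel_cantelli_AE1) (auto simp: emeasure_eq_measure)
    thus ?thesis by eventually_elim (auto elim!: eventually_mono)
  qed
  hence "AE \<omega> in M. \<forall>j::nat. eventually (\<lambda>N. L N \<omega> < (\<gamma> + inverse (real (Suc j))) * real N) sequentially"
    unfolding AE_all_countable by simp
  moreover have low: "AE \<omega> in M. eventually (\<lambda>N. \<theta> * real N \<le> L N \<omega>) sequentially" if "0 < \<theta>" "\<theta> < \<gamma>" for \<theta>
  proof -
    have "summable (\<lambda>N. prob {\<omega> \<in> space M. L N \<omega> < \<theta> * real N})"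
      using lower[OF that] by (simp add: L_def)
    moreover have "{\<omega> \<in> space M. L N \<omega> < \<theta> * real N} \<in> events" for N by (rule ev)
    ultimately have "AE \<omega> in M. eventually (\<lambda>N. \<omega> \<in> space M - {\<omega> \<in> space M. L N \<omega> < \<theta> * real N}) sequentially"
      by (intro borel_cantelli_AE1) (auto simp: emeasure_eq_measure)
    thus ?thesis by eventually_elim (auto elim!: eventually_mono)
  qed
  \<comment> \<open>With \<open>Suc (Suc j)\<close> all thresholds are positive.\<close>
  have "AE \<omega> in M. \<forall>j::nat. eventually (\<lambda>N. (\<gamma> * (1 - inverse (real (Suc (Suc j))))) * real N \<le> L N \<omega>) sequentially"
    unfolding AE_all_countable
  proof
    fix j :: nat
    have "0 < inverse (real (Suc (Suc j)))" "inverse (real (Suc (Suc j))) < 1"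
      by (simp_all add: inverse_less_1_iff)
    thus "AE \<omega> in M. eventually (\<lambda>N. (\<gamma> * (1 - inverse (real (Suc (Suc j))))) * real N \<le> L N \<omega>) sequentially"
      using \<gamma> by (intro low) (auto simp: mult_less_cancel_left1)
  qed
  ultimately have lim: "AE \<omega> in M. (\<lambda>N. L N \<omega> / real N) \<longlonglongrightarrow> \<gamma>"
  proof eventually_elim
    case (elim \<omega>)
    show ?case
    proof (rule order_tendstoI)
      fix y assume "\<gamma> < y"
      then obtain j where "inverse (real (Suc j)) < y - \<gamma>"
        using reals_Archimedean[of "y - \<gamma>"] by auto
      hence y: "\<gamma> + inverse (real (Suc j)) < y" by simp
      have "eventually (\<lambda>N. L N \<omega> < (\<gamma> + inverse (real (Suc j))) * real N) sequentially" using elim(1) by blast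
      with eventually_gt_at_top[of 0] show "eventually (\<lambda>N. L N \<omega> / real N < y) sequentially"
      proof eventually_elim
        case (elim N)
        hence "L N \<omega> / real N < \<gamma> + inverse (real (Suc j))" by (simp add: divide_less_eq)
        thus ?case using y by linarith
      qed
    next
      fix y assume y: "y < \<gamma>"
      hence "(\<gamma> - y) / \<gamma> > 0" using \<gamma> by simp
      then obtain j where j: "inverse (real (Suc j)) < (\<gamma> - y) / \<gamma>"
        using reals_Archimedean by blast
      have "inverse (real (Suc (Suc j))) < (\<gamma> - y) / \<gamma>"
        by (rule le_less_trans[OF _ j]) (simp add: field_simps)
      hence y: "y < \<gamma> * (1 - inverse (real (Suc (Suc j))))"
        using \<gamma> by (simp add: less_divide_eq algebra_simps)
      have "eventually (\<lambda>N. (\<gamma> * (1 - inverse (real (Suc (Suc j))))) * real N \<le> L N \<omega>) sequentially" using elim(2) by blast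
      with eventually_gt_at_top[of 0] show "eventually (\<lambda>N. y < L N \<omega> / real N) sequentially"
      proof eventually_elim
        case (elim N)
        hence "\<gamma> * (1 - inverse (real (Suc (Suc j)))) \<le> L N \<omega> / real N" by (simp only: pos_le_divide_eq of_nat_0_less_iff)
        thus ?case using y by linarith
      qed
    qed
  qed
  thus "AE \<omega> in M. (\<lambda>N. real (len h (nat \<lfloor>a * real N\<rfloor>) (nat \<lfloor>b * real N\<rfloor>) \<omega>) / real N) \<longlonglongrightarrow> \<gamma>"
    by (simp add: L_def)
  have meas: "(\<lambda>\<omega>. L N \<omega> / real N) \<in> borel_measurable M" for N
  proof -
    have "L N \<in> borel_measurable M"
      by (rule borel_measurableI_le) (rule ev)
    thus ?thesis by simp
  qed
  have bound: "\<bar>L N \<omega> / real N\<bar> \<le> a + b" for N \<omega>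
  proof (cases "N = 0")
    case False
    have "L N \<omega> \<le> real (nat \<lfloor>a * real N\<rfloor>) + real (nat \<lfloor>b * real N\<rfloor>)"
      using len_coordinate_bound(3)[OF h] unfolding L_def by (simp only: of_nat_add[symmetric] of_nat_le_iff)
    also have "\<dots> \<le> a * real N + b * real N"
      using ab by (intro add_mono) (auto simp: of_nat_nat)
    finally have "L N \<omega> / real N \<le> a + b" using False by (simp add: divide_le_eq distrib_right)
    moreover have "0 \<le> L N \<omega> / real N" by (simp add: L_def)
    ultimately show ?thesis by simp
  qed (use ab in simp)
  have int: "integrable M (\<lambda>\<omega>. L N \<omega> / real N)" for N
    by (rule integrable_const_bound[of _ "a + b"]) (use bound meas in auto)
  have "(\<lambda>N. \<integral>\<omega>. \<bar>L N \<omega> / real N - \<gamma>\<bar> \<partial>M) \<longlonglongrightarrow> (\<integral>\<omega>. 0 \<partial>M)"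
  proof (rule integral_dominated_convergence[where w = "\<lambda>_. a + b + \<gamma>"])
    show "AE \<omega> in M. (\<lambda>N. \<bar>L N \<omega> / real N - \<gamma>\<bar>) \<longlonglongrightarrow> 0"
      using lim
    proof eventually_elim
      case (elim \<omega>)
      hence "(\<lambda>N. \<bar>L N \<omega> / real N - \<gamma>\<bar>) \<longlonglongrightarrow> \<bar>\<gamma> - \<gamma>\<bar>" by (intro tendsto_intros)
      thus ?case by simp
    qed
    show "AE \<omega> in M. norm \<bar>L N \<omega> / real N - \<gamma>\<bar> \<le> a + b + \<gamma>" for N
    proof (rule AE_I2)
      fix \<omega>
      have "\<bar>L N \<omega> / real N - \<gamma>\<bar> \<le> a + b + \<gamma>"
        using bound[of N \<omega>] \<gamma> by linarith
      thus "norm \<bar>L N \<omega> / real N - \<gamma>\<bar> \<le> a + b + \<gamma>" by simp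
    qed
  qed (use meas in auto)
  thus "tendsto_L1 M (\<lambda>N \<omega>. real (len h (nat \<lfloor>a * real N\<rfloor>) (nat \<lfloor>b * real N\<rfloor>) \<omega>) / real N) (\<lambda>_. \<gamma>)"
    using int by (simp add: tendsto_L1_def L_def)
qed

text \<open>
Beyond the point where \<open>u\<close> or \<open>v\<close> vanishes the event is impossible for large \<open>N\<close>: the gaps of a chain must fit into the
box.
\<close>

lemma summable_len_ge_boundary:
  assumes h: "h \<noteq> (0, 0)" and ab: "a > 0" "b > 0"
    and \<theta>: "a < real (fst h) * \<theta> \<or> b < real (snd h) * \<theta>"
  shows "summable (\<lambda>N. prob {\<omega> \<in> space M. \<theta> * real N \<le> real (len h (nat \<lfloor>a * real N\<rfloor>) (nat \<lfloor>b * real N\<rfloor>) \<omega>)})"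
proof -
  have ev0: "eventually (\<lambda>N. prob {\<omega> \<in> space M. \<theta> * real N \<le> real (len h (nat \<lfloor>a * real N\<rfloor>) (nat \<lfloor>b * real N\<rfloor>) \<omega>)} = 0) sequentially"
    if x: "x > 0" "x < real k * \<theta>" and le: "\<And>N \<omega>. len h (nat \<lfloor>a * real N\<rfloor>) (nat \<lfloor>b * real N\<rfloor>) \<omega> * k \<le> nat \<lfloor>x * real N\<rfloor> + k" for x k
  proof -
    have "eventually (\<lambda>N. real N > real k / (real k * \<theta> - x)) sequentially"
      using filterlim_real_sequentially unfolding filterlim_at_top_dense by blast
    thus ?thesis
    proof eventually_elim
      case (elim N)
      hence N: "real k < (real k * \<theta> - x) * real N" using x by (simp add: divide_less_eq mult.commute)
      have "\<not> \<theta> * real N \<le> real (len h (nat \<lfloor>a * real N\<rfloor>) (nat \<lfloor>b * real N\<rfloor>) \<omega>)" for \<omega>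
      proof
        assume "\<theta> * real N \<le> real (len h (nat \<lfloor>a * real N\<rfloor>) (nat \<lfloor>b * real N\<rfloor>) \<omega>)"
        hence "\<theta> * real N * real k \<le> real (len h (nat \<lfloor>a * real N\<rfloor>) (nat \<lfloor>b * real N\<rfloor>) \<omega>) * real k"
          by (rule mult_right_mono) simp
        also have "\<dots> \<le> real (nat \<lfloor>x * real N\<rfloor>) + real k"
          using le by (simp only: of_nat_add[symmetric] of_nat_mult[symmetric] of_nat_le_iff)
        also have "\<dots> \<le> x * real N + real k" using x by (simp add: of_nat_nat)
        finally show False using N by (simp add: algebra_simps)
      qed
      thus ?case by simp
    qed
  qed
  have "eventually (\<lambda>N. prob {\<omega> \<in> space M. \<theta> * real N \<le> real (len h (nat \<lfloor>a * real N\<rfloor>) (nat \<lfloor>b * real N\<rfloor>) \<omega>)} = 0) sequentially"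
    using \<theta>
  proof
    assume "a < real (fst h) * \<theta>"
    thus ?thesis by (rule ev0[OF ab(1)]) (rule len_coordinate_bound(1)[OF h])
  next
    assume "b < real (snd h) * \<theta>"
    thus ?thesis by (rule ev0[OF ab(2)]) (rule len_coordinate_bound(2)[OF h])
  qed
  thus ?thesis
    by (rule summable_cong[THEN iffD2]) simp
qed

end

lemma g_fun_commute: "g_fun p u v = g_fun p v u"
  by (simp add: g_fun_def mult.commute add.commute)

lemma g_fun_mono:
  assumes "0 < p" "p < 1" "0 \<le> u" "u \<le> u'" "0 \<le> v" "v \<le> v'"
  shows "g_fun p u v \<le> g_fun p u' v'"
proof -
  have "u * v \<le> u' * v'" using assms by (intro mult_mono) auto
  thus ?thesis unfolding g_fun_def using assms
    by (intro divide_right_mono mult_left_mono add_mono mult_right_mono) auto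
qed

lemma g_fun_0_left:
  assumes "0 < p" "p < 1"
  shows "g_fun p 0 v = v / (1 / p - 1)"
  using assms by (simp add: g_fun_def field_simps)

text \<open>
The flat part of the shape. For \<open>\<theta> < a / h\<^sub>1\<close> already \<open>g(0, v) = v / (1 / p - 1)\<close> is at least \<open>a / h\<^sub>1\<close>, and \<open>g\<close> is
monotone. Here \<open>h1\<close> and \<open>h2\<close> are arbitrary reals so that the lemma also serves with the coordinates exchanged.
\<close>

lemma below_flat_edge:
  assumes p: "0 < p" "p < 1" and h1: "h1 > 0" and "h2 \<ge> 0" and a: "a > 0"
    and edge: "a * (h2 + (1 / p - 1)) \<le> b * h1" and \<theta>: "\<theta> < a / h1"
  shows "a - h1 * \<theta> > 0" "b - h2 * \<theta> > 0" "\<theta> < g_fun p (a - h1 * \<theta>) (b - h2 * \<theta>)"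
proof -
  define c where "c = 1 / p - 1"
  have c: "c > 0" using p by (simp add: c_def)
  show u: "a - h1 * \<theta> > 0" using \<theta> h1 by (simp add: field_simps)
  have "h2 * \<theta> \<le> h2 * (a / h1)" using \<theta> assms by (intro mult_left_mono) auto
  moreover have "a / h1 * c \<le> b - h2 * (a / h1)"
  proof -
    have "a * (h2 + c) / h1 \<le> b" using edge[folded c_def] h1 by (simp add: divide_le_eq)
    moreover have "a * (h2 + c) / h1 = h2 * (a / h1) + a / h1 * c"
      by (simp add: distrib_left add_divide_distrib mult.commute)
    ultimately show ?thesis by linarith
  qed
  ultimately have v: "a / h1 * c \<le> b - h2 * \<theta>" by linarith
  thus v0: "b - h2 * \<theta> > 0" using a h1 c by (intro less_le_trans[OF _ v] mult_pos_pos divide_pos_pos)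
  have "a / h1 \<le> (b - h2 * \<theta>) / c" using v c by (simp add: field_simps)
  also have "\<dots> = g_fun p 0 (b - h2 * \<theta>)" using g_fun_0_left[OF p] by (simp add: c_def)
  also have "\<dots> \<le> g_fun p (a - h1 * \<theta>) (b - h2 * \<theta>)" by (rule g_fun_mono) (use p u v0 in auto)
  finally show "\<theta> < g_fun p (a - h1 * \<theta>) (b - h2 * \<theta>)" using \<theta> by linarith
qed

lemma above_at_edge:
  assumes p: "0 < p" "p < 1" and h1: "h1 > 0" and edge: "b * h1 < a * (h2 + (1 / p - 1))"
  shows "g_fun p (a - h1 * (a / h1)) (b - h2 * (a / h1)) < a / h1"
proof -
  define c where "c = 1 / p - 1"
  have c: "c > 0" using p by (simp add: c_def)
  have "b < a * (h2 + c) / h1" using edge[folded c_def] h1 by (simp add: less_divide_eq)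
  moreover have "a * (h2 + c) / h1 = h2 * (a / h1) + a / h1 * c"
    by (simp add: distrib_left add_divide_distrib mult.commute)
  ultimately have "b - h2 * (a / h1) < a / h1 * c" by linarith
  hence "(b - h2 * (a / h1)) / c < a / h1" using c by (simp add: divide_less_eq)
  thus ?thesis using h1 g_fun_0_left[OF p, folded c_def] by simp
qed

text \<open>
\<open>\<theta> - g(a - h\<^sub>1 \<theta>, b - h\<^sub>2 \<theta>)\<close> is increasing, negative at \<open>0\<close>, and positive at the point \<open>l\<close> where the first coordinate to
vanish vanishes.
\<close>

lemma unique_crossing:
  fixes h1 h2 :: real
  assumes p: "0 < p" "p < 1" and h: "h1 \<ge> 0" "h2 \<ge> 0" "h1 > 0 \<or> h2 > 0" and ab: "a > 0" "b > 0"
    and e1: "h1 > 0 \<Longrightarrow> b * h1 < a * (h2 + (1 / p - 1))"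
    and e2: "h2 > 0 \<Longrightarrow> a * h2 < b * (h1 + (1 / p - 1))"
  obtains \<gamma> where "\<gamma> > 0" "a - h1 * \<gamma> > 0" "b - h2 * \<gamma> > 0" "\<gamma> = g_fun p (a - h1 * \<gamma>) (b - h2 * \<gamma>)"
    "\<And>\<theta>. a - h1 * \<theta> > 0 \<Longrightarrow> b - h2 * \<theta> > 0 \<Longrightarrow> \<gamma> < \<theta> \<Longrightarrow> g_fun p (a - h1 * \<theta>) (b - h2 * \<theta>) < \<theta>"
    "\<And>\<theta>. \<theta> < \<gamma> \<Longrightarrow> \<theta> < g_fun p (a - h1 * \<theta>) (b - h2 * \<theta>)"
proof -
  define G where "G = (\<lambda>\<theta>. g_fun p (a - h1 * \<theta>) (b - h2 * \<theta>))"
  have anti: "G \<theta>' \<le> G \<theta>" if "\<theta> \<le> \<theta>'" "a - h1 * \<theta>' \<ge> 0" "b - h2 * \<theta>' \<ge> 0" for \<theta> \<theta>'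
    unfolding G_def using that h p by (intro g_fun_mono diff_left_mono mult_left_mono) auto
  \<comment> \<open>The first coordinate vanishes first iff \<open>a / h1 \<le> b / h2\<close>.\<close>
  have "\<exists>l>0. G l < l \<and> a - h1 * l \<ge> 0 \<and> b - h2 * l \<ge> 0"
  proof (cases "h1 > 0 \<and> b * h1 \<ge> a * h2")
    case True
    hence "G (a / h1) < a / h1" unfolding G_def by (intro above_at_edge p e1) auto
    thus ?thesis using True ab by (intro exI[of _ "a / h1"]) (auto simp: field_simps)
  next
    case False
    have h2: "h2 > 0"
    proof (rule ccontr)
      assume "\<not> h2 > 0"
      hence "h2 = 0" "h1 > 0" using h by auto
      moreover have "b * h1 > 0" using ab \<open>h1 > 0\<close> by simp
      ultimately show False using False by simp
    qed
    hence "G (b / h2) < b / h2"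
      unfolding G_def by (subst g_fun_commute) (intro above_at_edge p e2)
    moreover have "b * h1 \<le> a * h2"
      using False h ab h2 by (cases "h1 > 0") auto
    ultimately show ?thesis using h2 ab by (intro exI[of _ "b / h2"]) (auto simp: field_simps)
  qed
  then obtain l where l: "l > 0" "G l < l" "a - h1 * l \<ge> 0" "b - h2 * l \<ge> 0" by blast
  have G0: "G 0 > 0" unfolding G_def g_fun_def using p ab
    by (simp add: divide_pos_pos add_nonneg_pos)
  have "\<exists>x\<ge>0. x \<le> l \<and> x - G x = 0"
  proof (rule IVT')
    show "0 - G 0 \<le> 0" "0 \<le> l - G l" "0 \<le> l" using G0 l by auto
    show "continuous_on {0..l} (\<lambda>x. x - G x)"
      unfolding G_def g_fun_def using p by (intro continuous_intros) auto
  qed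
  then obtain \<gamma> where \<gamma>: "0 \<le> \<gamma>" "\<gamma> \<le> l" "\<gamma> = G \<gamma>" by auto
  have \<gamma>l: "\<gamma> < l" "0 < \<gamma>" using \<gamma> l G0 by (auto simp: order.order_iff_strict)
  have pos: "a - h1 * \<gamma> > 0" "b - h2 * \<gamma> > 0"
  proof -
    show "a - h1 * \<gamma> > 0"
    proof (cases "h1 = 0")
      case False
      hence "h1 * \<gamma> < h1 * l" using h \<gamma>l by simp
      thus ?thesis using l by linarith
    qed (use ab in simp)
    show "b - h2 * \<gamma> > 0"
    proof (cases "h2 = 0")
      case False
      hence "h2 * \<gamma> < h2 * l" using h \<gamma>l by simp
      thus ?thesis using l by linarith
    qed (use ab in simp)
  qed
  show ?thesis
  proof (rule that[OF \<gamma>l(2) pos])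
    show "\<gamma> = g_fun p (a - h1 * \<gamma>) (b - h2 * \<gamma>)" using \<gamma>(3) by (simp add: G_def)
    fix \<theta>
    show "g_fun p (a - h1 * \<theta>) (b - h2 * \<theta>) < \<theta>" if "a - h1 * \<theta> > 0" "b - h2 * \<theta> > 0" "\<gamma> < \<theta>"
      using anti[of \<gamma> \<theta>] that \<gamma>(3) unfolding G_def by linarith
    show "\<theta> < g_fun p (a - h1 * \<theta>) (b - h2 * \<theta>)" if "\<theta> < \<gamma>"
      using anti[of \<theta> \<gamma>] that \<gamma>(3) pos unfolding G_def by linarith
  qed
qed

context bernoulli_field
begin

text \<open>
The constant is the largest \<open>\<theta>\<close> with \<open>u, v \<ge> 0\<close> and \<open>\<theta> \<le> g(u, v)\<close>. In the two flat regimes this inequality holds until a coordinate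
vanishes; otherwise there is a crossing before.
\<close>

lemma limit_constant_exists:
  assumes h: "(h1, h2) \<noteq> (0, 0)" and ab: "a > 0" "b > 0"
  shows "\<exists>\<gamma>>0. (\<forall>\<theta>>\<gamma>. summable (\<lambda>N. prob {\<omega> \<in> space M. \<theta> * real N \<le> real (len (h1, h2) (nat \<lfloor>a * real N\<rfloor>) (nat \<lfloor>b * real N\<rfloor>) \<omega>)})) \<and>
    (\<forall>\<theta>>0. \<theta> < \<gamma> \<longrightarrow> summable (\<lambda>N. prob {\<omega> \<in> space M. real (len (h1, h2) (nat \<lfloor>a * real N\<rfloor>) (nat \<lfloor>b * real N\<rfloor>) \<omega>) < \<theta> * real N})) \<and>
    (ereal (lower_slope p (h1, h2)) < ereal (a / b) \<and> ereal (a / b) < upper_slope p (h1, h2) \<longrightarrow>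
       (\<forall>x::real. (a - real h1 * x > 0 \<and> b - real h2 * x > 0 \<and>
              x = g_fun p (a - real h1 * x) (b - real h2 * x)) \<longleftrightarrow> x = \<gamma>)) \<and>
    (a / b \<le> lower_slope p (h1, h2) \<longrightarrow> \<gamma> = a / real h1) \<and>
    (ereal (a / b) \<ge> upper_slope p (h1, h2) \<longrightarrow> \<gamma> = b / real h2)"
proof -
  define c where "c = 1 / p - 1"
  have c: "c > 0" using p0 p1 by (simp add: c_def)
  have low: "a / b \<le> lower_slope p (h1, h2) \<longleftrightarrow> a * (real h2 + c) \<le> b * real h1"
    unfolding lower_slope_def using ab c by (simp add: c_def divide_le_eq le_divide_eq field_simps)
  have up: "ereal (a / b) \<ge> upper_slope p (h1, h2) \<longleftrightarrow> h2 > 0 \<and> b * (real h1 + c) \<le> a * real h2"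
    unfolding upper_slope_def using ab c by (auto simp: c_def field_simps)
  have mid: "ereal (lower_slope p (h1, h2)) < ereal (a / b) \<and> ereal (a / b) < upper_slope p (h1, h2) \<longleftrightarrow>
      \<not> a / b \<le> lower_slope p (h1, h2) \<and> \<not> ereal (a / b) \<ge> upper_slope p (h1, h2)"
    by (simp add: not_le)
  have excl: False if "a * (real h2 + c) \<le> b * real h1" "b * (real h1 + c) \<le> a * real h2"
  proof -
    have "a * c > 0" "b * c > 0" using ab c by auto
    thus False using that by (simp add: distrib_left)
  qed
  consider (lo) "a * (real h2 + c) \<le> b * real h1" | (hi) "h2 > 0" "b * (real h1 + c) \<le> a * real h2"
    | (mi) "b * real h1 < a * (real h2 + c)" "h2 > 0 \<Longrightarrow> a * real h2 < b * (real h1 + c)" by fastforce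
  thus ?thesis
  proof cases
    case lo
    have "a * (real h2 + c) > 0" using ab c by (simp add: add_nonneg_pos)
    hence h1: "h1 > 0" using lo ab by (auto intro!: gr0I)
    note edge = below_flat_edge[OF p0 p1 _ _ ab(1) lo[unfolded c_def]]
    show ?thesis
    proof (intro exI[of _ "a / real h1"] conjI allI impI)
      fix \<theta> :: real assume "a / real h1 < \<theta>"
      hence "a < real h1 * \<theta>" using h1 by (simp add: divide_less_eq mult.commute)
      thus "summable (\<lambda>N. prob {\<omega> \<in> space M. \<theta> * real N \<le> real (len (h1, h2) (nat \<lfloor>a * real N\<rfloor>) (nat \<lfloor>b * real N\<rfloor>) \<omega>)})"
        by (intro summable_len_ge_boundary h ab) simp
    next
      fix \<theta> :: real assume "0 < \<theta>" "\<theta> < a / real h1"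
      thus "summable (\<lambda>N. prob {\<omega> \<in> space M. real (len (h1, h2) (nat \<lfloor>a * real N\<rfloor>) (nat \<lfloor>b * real N\<rfloor>) \<omega>) < \<theta> * real N})"
        using h1 by (intro summable_len_less h edge) auto
    next
      assume "upper_slope p (h1, h2) \<le> ereal (a / b)"
      thus "a / real h1 = b / real h2" using up excl lo by blast
    qed (use h1 ab lo low mid in auto)
  next
    case hi
    note edge = below_flat_edge[OF p0 p1 _ _ ab(2) hi(2)[unfolded c_def]]
    show ?thesis
    proof (intro exI[of _ "b / real h2"] conjI allI impI)
      fix \<theta> :: real assume "b / real h2 < \<theta>"
      hence "b < real h2 * \<theta>" using hi(1) by (simp add: divide_less_eq mult.commute)
      thus "summable (\<lambda>N. prob {\<omega> \<in> space M. \<theta> * real N \<le> real (len (h1, h2) (nat \<lfloor>a * real N\<rfloor>) (nat \<lfloor>b * real N\<rfloor>) \<omega>)})"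
        by (intro summable_len_ge_boundary h ab) simp
    next
      fix \<theta> :: real assume \<theta>: "0 < \<theta>" "\<theta> < b / real h2"
      show "summable (\<lambda>N. prob {\<omega> \<in> space M. real (len (h1, h2) (nat \<lfloor>a * real N\<rfloor>) (nat \<lfloor>b * real N\<rfloor>) \<omega>) < \<theta> * real N})"
      proof (rule summable_len_less[OF h \<theta>(1)])
        show "a - real h1 * \<theta> > 0" "b - real h2 * \<theta> > 0"
          by (rule edge(2) edge(1); use hi(1) \<theta> in simp)+
        show "\<theta> < g_fun p (a - real h1 * \<theta>) (b - real h2 * \<theta>)"
          by (subst g_fun_commute, rule edge(3)) (use hi(1) \<theta> in simp_all)
      qed
    next
      assume "a / b \<le> lower_slope p (h1, h2)"
      thus "b / real h2 = a / real h1" using low excl hi by blast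
    qed (use hi ab up mid in auto)
  next
    case mi
    have nn: "real h1 \<ge> 0" "real h2 \<ge> 0" "real h1 > 0 \<or> real h2 > 0" using h by auto
    obtain \<gamma> where \<gamma>: "\<gamma> > 0" "a - real h1 * \<gamma> > 0" "b - real h2 * \<gamma> > 0"
      "\<gamma> = g_fun p (a - real h1 * \<gamma>) (b - real h2 * \<gamma>)"
      and above: "\<And>\<theta>. a - real h1 * \<theta> > 0 \<Longrightarrow> b - real h2 * \<theta> > 0 \<Longrightarrow> \<gamma> < \<theta> \<Longrightarrow> g_fun p (a - real h1 * \<theta>) (b - real h2 * \<theta>) < \<theta>"
      and below: "\<And>\<theta>. \<theta> < \<gamma> \<Longrightarrow> \<theta> < g_fun p (a - real h1 * \<theta>) (b - real h2 * \<theta>)"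
    proof (rule unique_crossing[OF p0 p1 nn ab])
      show "b * real h1 < a * (real h2 + (1 / p - 1))" using mi(1) by (simp add: c_def)
      show "a * real h2 < b * (real h1 + (1 / p - 1))" if "real h2 > 0"
        using mi(2) that by (simp add: c_def)
    qed blast
    show ?thesis
    proof (intro exI[of _ \<gamma>] conjI allI impI)
      fix \<theta> assume \<theta>: "\<gamma> < \<theta>"
      have "eventually (\<lambda>x. \<gamma> < x) (at_right \<gamma>)" "eventually (\<lambda>x. x < \<theta>) (at_right \<gamma>)"
        using \<theta> by (auto intro: eventually_at_right_less eventually_at_rightI)
      moreover have "eventually (\<lambda>x. a - real h1 * x > 0) (at_right \<gamma>)"
        by (rule order_tendstoD(1)[OF _ \<gamma>(2)]) (intro tendsto_intros)
      moreover have "eventually (\<lambda>x. b - real h2 * x > 0) (at_right \<gamma>)"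
        by (rule order_tendstoD(1)[OF _ \<gamma>(3)]) (intro tendsto_intros)
      ultimately have "eventually (\<lambda>x. \<gamma> < x \<and> x < \<theta> \<and> a - real h1 * x > 0 \<and> b - real h2 * x > 0) (at_right \<gamma>)"
        by eventually_elim simp
      then obtain x where x: "\<gamma> < x" "x < \<theta>" "a - real h1 * x > 0" "b - real h2 * x > 0"
        using eventually_happens[of _ "at_right \<gamma>"] by (auto simp: trivial_limit_at_right_real)
      have "summable (\<lambda>N. prob {\<omega> \<in> space M. x * real N \<le> real (len (h1, h2) (nat \<lfloor>a * real N\<rfloor>) (nat \<lfloor>b * real N\<rfloor>) \<omega>)})"
        using x \<gamma>(1) above by (intro summable_len_ge h) auto
      thus "summable (\<lambda>N. prob {\<omega> \<in> space M. \<theta> * real N \<le> real (len (h1, h2) (nat \<lfloor>a * real N\<rfloor>) (nat \<lfloor>b * real N\<rfloor>) \<omega>)})"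
        by (rule summable_len_ge_mono[OF h less_imp_le[OF x(2)]])
    next
      fix \<theta> assume \<theta>: "0 < \<theta>" "\<theta> < \<gamma>"
      have "real h1 * \<theta> \<le> real h1 * \<gamma>" "real h2 * \<theta> \<le> real h2 * \<gamma>"
        using \<theta> by (auto intro: mult_left_mono)
      thus "summable (\<lambda>N. prob {\<omega> \<in> space M. real (len (h1, h2) (nat \<lfloor>a * real N\<rfloor>) (nat \<lfloor>b * real N\<rfloor>) \<omega>) < \<theta> * real N})"
        using \<theta> \<gamma>(2,3) below by (intro summable_len_less h) auto
    next
      fix x
      show "(a - real h1 * x > 0 \<and> b - real h2 * x > 0 \<and>
              x = g_fun p (a - real h1 * x) (b - real h2 * x)) \<longleftrightarrow> x = \<gamma>"
        using above[of x] below[of x] \<gamma> by (cases x \<gamma> rule: linorder_cases) auto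
    qed (use \<gamma>(1) mi low up in auto)
  qed
qed

end

theorem proposition9:
  fixes M :: "'w measure" and \<Xi> :: "nat \<times> nat \<Rightarrow> 'w \<Rightarrow> bool"
    and p :: real and h1 h2 :: nat
  assumes "prob_space M"
    and "0 < p" and "p < 1"
    and "iid_bernoulli M \<Xi> p"
    and "(h1, h2) \<noteq> (0, 0)"
  shows "\<exists>gh :: real \<Rightarrow> real \<Rightarrow> real. \<forall>a > 0. \<forall>b > 0.
    (let L = (\<lambda>n \<omega>. real (longest_chain (h1, h2) (bernoulli_points \<Xi> \<omega>)
                        (nat \<lfloor>a * real n\<rfloor>) (nat \<lfloor>b * real n\<rfloor>)))
     in (AE \<omega> in M. (\<lambda>n. L n \<omega> / real n) \<longlonglongrightarrow> gh a b) \<and>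
        tendsto_L1 M (\<lambda>n \<omega>. L n \<omega> / real n) (\<lambda>_. gh a b)) \<and>
    (ereal (lower_slope p (h1, h2)) < ereal (a / b) \<and> ereal (a / b) < upper_slope p (h1, h2) \<longrightarrow>
       (\<forall>x::real. (a - real h1 * x > 0 \<and> b - real h2 * x > 0 \<and>
              x = g_fun p (a - real h1 * x) (b - real h2 * x)) \<longleftrightarrow> x = gh a b)) \<and>
    (a / b \<le> lower_slope p (h1, h2) \<longrightarrow> gh a b = a / real h1) \<and>
    (ereal (a / b) \<ge> upper_slope p (h1, h2) \<longrightarrow> gh a b = b / real h2)"
    (is "\<exists>gh. \<forall>a>0. \<forall>b>0. ?P a b (gh a b)")
proof -
  interpret prob_space M by fact
  interpret bernoulli_field M \<Xi> p by standard fact+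
  have "\<exists>\<gamma>. ?P a b \<gamma>" if ab: "a > 0" "b > 0" for a b
  proof -
    from limit_constant_exists[OF assms(5) ab] obtain \<gamma> where
      "\<gamma> > 0" and upper: "\<forall>\<theta>>\<gamma>. summable (\<lambda>N. prob {\<omega> \<in> space M. \<theta> * real N \<le> real (len (h1, h2) (nat \<lfloor>a * real N\<rfloor>) (nat \<lfloor>b * real N\<rfloor>) \<omega>)})"
      and lower: "\<forall>\<theta>>0. \<theta> < \<gamma> \<longrightarrow> summable (\<lambda>N. prob {\<omega> \<in> space M. real (len (h1, h2) (nat \<lfloor>a * real N\<rfloor>) (nat \<lfloor>b * real N\<rfloor>) \<omega>) < \<theta> * real N})"
      and eqs: "ereal (lower_slope p (h1, h2)) < ereal (a / b) \<and> ereal (a / b) < upper_slope p (h1, h2) \<longrightarrow>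
       (\<forall>x::real. (a - real h1 * x > 0 \<and> b - real h2 * x > 0 \<and>
              x = g_fun p (a - real h1 * x) (b - real h2 * x)) \<longleftrightarrow> x = \<gamma>)"
       "a / b \<le> lower_slope p (h1, h2) \<longrightarrow> \<gamma> = a / real h1"
       "ereal (a / b) \<ge> upper_slope p (h1, h2) \<longrightarrow> \<gamma> = b / real h2"
      by (elim exE conjE) blast
    note lim = limit_of_len[OF assms(5) ab \<open>\<gamma> > 0\<close> upper[rule_format] lower[rule_format], unfolded len_def]
    show ?thesis
      unfolding Let_def by (intro exI[of _ \<gamma>] conjI lim eqs)
  qed
  hence "\<forall>a b. \<exists>\<gamma>. a > 0 \<longrightarrow> b > 0 \<longrightarrow> ?P a b \<gamma>" by blast
  then obtain gh where "\<forall>a b. a > 0 \<longrightarrow> b > 0 \<longrightarrow> ?P a b (gh a b)"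
    unfolding choice_iff by blast
  thus ?thesis by (intro exI[of _ gh]) blast
qed

end
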